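(* Let $d\ge1$, $E_D=1/d$, and let $L$ be an oriented link with $\ell$ components. Let $\mathcal{N}(L)_k$ ($1\le k\le\ell$) and $c(\widehat\alpha)\in\mathcal{A}=\mathbb{Q}[q^{\pm1},\sqrt{\lambda_D}^{\pm1}]$ be the sets of disjoint unions of $k$ knots, and the coefficients, obtained by resolving $L$ via the special skein relation. With $P=P(q,\lambda_D)$ and $\Theta_d=\Theta_d(q,\lambda_D)$, the value $\Theta_d(L)$ is an $\mathcal{A}$-linear combination of $P(L)$ and the values of $P$ on disjoint unions of knots obtained by the skein relation: $$\Theta_d(L)=\sum_{k=1}^{\ell}E_D^{1-k}\sum_{\widehat\alpha\in\mathcal{N}(L)_k}c(\widehat\alpha)\,P(\widehat\alpha)=P(L)+\sum_{k=2}^{\ell}(E_D^{1-k}-1)\sum_{\widehat\alpha\in\mathcal{N}(L)_k}c(\widehat\alpha)\,P(\widehat\alpha).$$ Conversely, $P(L)$ is an $\mathcal{A}$-linear combination of $\Theta_d(L)$ and the values of $\Theta_d$ on disjoint unions of knots obtained by the skein relation: $$P(L)=\sum_{k=1}^{\ell}E_D^{k-1}\sum_{\widehat\alpha\in\mathcal{N}(L)_k}c(\widehat\alpha)\,\Theta_d(\widehat\alpha)=\Theta_d(L)+\sum_{k=2}^{\ell}(E_D^{k-1}-1)\sum_{\widehat\alpha\in\mathcal{N}(L)_k}c(\widehat\alpha)\,\Theta_d(\widehat\alpha).$$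
   Context: The Yokonuma--Hecke algebra $Y_{d,n}(q)$ ($q\in\mathbb{C}\setminus\{0\}$) is the $\mathbb{C}$-algebra generated by $g_1,\dots,g_{n-1},t_1,\dots,t_n$ with relations: $g_ig_jg_i=g_jg_ig_j$ for $|i-j|=1$; $g_ig_j=g_jg_i$ for $|i-j|>1$; $t_it_j=t_jt_i$; $t_jg_i=g_it_{s_i(j)}$ where $s_i=(i,i+1)$; $t_j^d=1$; and $g_i^2=1+(q-q^{-1})e_ig_i$, where $e_i=\frac1d\sum_{s=0}^{d-1}t_i^st_{i+1}^{d-s}$. Set $Y_{d,0}(q)=\mathbb{C}$; there are natural inclusions $Y_{d,n}(q)\subset Y_{d,n+1}(q)$. Let $D=\mathbb{Z}/d\mathbb{Z}$, $E_D=1/d$. The trace $\mathrm{tr}_{d,D}:\bigcup_{n}Y_{d,n}(q)\to\mathbb{C}[z]$ is the unique linear map with, for $a,b\in Y_{d,n}(q)$: $\mathrm{tr}_{d,D}(ab)=\mathrm{tr}_{d,D}(ba)$; $\mathrm{tr}_{d,D}(1)=1$; $\mathrm{tr}_{d,D}(ag_n)=z\,\mathrm{tr}_{d,D}(a)$; $\mathrm{tr}_{d,D}(at_{n+1}^k)=0$ for $1\le k\le d-1$. Set $\lambda_D=\frac{z-(q-q^{-1})E_D}{z}$, $\Lambda_D=\frac{1}{z\sqrt{\lambda_D}}$. For a braid $\alpha\in B_n$ with exponent sum $\epsilon(\alpha)$, $\Theta_d(\widehat\alpha)=\Lambda_D^{n-1}(\sqrt{\lambda_D})^{\epsilon(\alpha)}\mathrm{tr}_{d,D}(\alpha)$,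 where $\mathrm{tr}_{d,D}(\alpha)$ is the trace of the image of $\alpha$ under $\sigma_i\mapsto g_i$; this is an isotopy invariant of oriented links. Using $z=\frac{(q-q^{-1})E_D}{1-\lambda_D}$ it is viewed as a function of $(q,\lambda_D)$. $P(q,\lambda_D)$ is the Homflypt polynomial, determined by $P(\text{unknot})=1$ and $\frac{1}{\sqrt{\lambda_D}}P(L_+)-\sqrt{\lambda_D}P(L_-)=(q-q^{-1})P(L_0)$ for every Conway triple. A disjoint union of $k$ knots is a split link whose $k$ components are mutually unlinked. Special skein relation: when the crossing of $L_\pm$ in a Conway triple involves two different components, $\Theta_d(L_\pm)=\lambda_D^{\pm1}\Theta_d(L_\mp)\pm(q-q^{-1})\sqrt{\lambda_D}^{\pm1}\Theta_d(L_0)$. Resolving $L$ means: start with the formal expression $1\cdot L$ and repeatedly replace a link appearing in it by the corresponding two-term right-hand side of this relation at a crossing between different components, until (after finitely many steps, which is always possible) all links in the expression are disjoint unions of at most $\ell$ knots. $\mathcal{N}(L)_k$ is the finite set of disjoint unions of $k$ knots that appear, and $c(\widehat\alpha)\in\mathcal{A}$ is the coefficient of $\widehat\alpha$ in the resulting combination. *)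

theory Defs
  imports
    Complex_Main
    "HOL-Library.Poly_Mapping"
    "HOL-Library.Product_Plus"
    "HOL-Combinatorics.Transposition"
    "HOL-Computational_Algebra.Polynomial"
begin

section \<open>Oriented link diagrams and links\<close>

text \<open>
  A diagram in general position with respect to the height function is read from bottom to top
  as a list of slices. A slice \<open>(k, p)\<close> is the piece \<open>p\<close> with exactly \<open>k\<close> vertical strands to its
  left (and any number to its right). In \<open>Cross c\<close> two strands cross; the one running from bottom
  left to top right is the upper one iff \<open>c\<close> holds. \<open>Cup b\<close> is a local minimum; its left leg is
  oriented upwards iff \<open>b\<close> holds. \<open>Cap\<close> is a local maximum. The orientations of the strands met
  by a horizontal line form a list of booleans, \<open>True\<close> meaning upwards.
\<close>

datatype piece = Cross bool | Cup bool | Cap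

type_synonym slice = "nat \<times> piece"
type_synonym diagram = "slice list"

fun inputs :: "piece \<Rightarrow> nat" where
  "inputs (Cross c) = 2"
| "inputs (Cup b) = 0"
| "inputs Cap = 2"

fun outputs :: "piece \<Rightarrow> nat" where
  "outputs (Cross c) = 2"
| "outputs (Cup b) = 2"
| "outputs Cap = 0"

text \<open>\<open>None\<close> signals a slice that does not fit on top of the given oriented strands.\<close>

fun slice_step :: "slice \<Rightarrow> bool list \<Rightarrow> bool list option" where
  "slice_step (k, Cross c) st =
     (if Suc k < length st then Some (take k st @ [st ! Suc k, st ! k] @ drop (k + 2) st)
      else None)"
| "slice_step (k, Cup b) st =
     (if k \<le> length st then Some (take k st @ [b, \<not> b] @ drop k st) else None)"
| "slice_step (k, Cap) st =
     (if Suc k < length st \<and> st ! k \<noteq> st ! Suc k then Some (take k st @ drop (k + 2) st)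
      else None)"

fun run :: "diagram \<Rightarrow> bool list \<Rightarrow> bool list option" where
  "run [] st = Some st"
| "run (s # D) st = Option.bind (slice_step s st) (run D)"

definition strands :: "diagram \<Rightarrow> bool list" where
  "strands D = the (run D [])"

definition link_diagram :: "diagram \<Rightarrow> bool" where
  "link_diagram D \<longleftrightarrow> run D [] = Some []"

text \<open>
  Planar isotopy (the first five rules: change of relative heights, straightening of a strand,
  sliding a strand past a local extremum) and the Reidemeister moves I (in the form of a curl at
  a local extremum), II and III. Orientations are carried along; admissibility of
  an application of a rule is expressed by requiring a link diagram on both sides.
\<close>

inductive local_move :: "diagram \<Rightarrow> diagram \<Rightarrow> bool" where
  height: "local_move [(k, a), (k + outputs a + j, b)] [(k + inputs a + j, b), (k, a)]"
| zigzag_left: "local_move [(Suc k, Cup b), (k, Cap)] []"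
| zigzag_right: "local_move [(k, Cup b), (Suc k, Cap)] []"
| slide_cup: "local_move [(Suc k, Cup b), (k, Cross c)] [(k, Cup b), (Suc k, Cross (\<not> c))]"
| slide_cap: "local_move [(k, Cross c), (Suc k, Cap)] [(Suc k, Cross (\<not> c)), (k, Cap)]"
| R1_cup: "local_move [(k, Cup b), (k, Cross c)] [(k, Cup (\<not> b))]"
| R1_cap: "local_move [(k, Cross c), (k, Cap)] [(k, Cap)]"
| R2: "local_move [(k, Cross c), (k, Cross (\<not> c))] []"
| R3: "local_move [(k, Cross c), (Suc k, Cross c), (k, Cross c)]
                  [(Suc k, Cross c), (k, Cross c), (Suc k, Cross c)]"

inductive move :: "diagram \<Rightarrow> diagram \<Rightarrow> bool" where
  "local_move A B \<Longrightarrow> link_diagram (X @ A @ Y) \<Longrightarrow> link_diagram (X @ B @ Y) \<Longrightarrow>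
   move (X @ A @ Y) (X @ B @ Y)"

definition isotopic :: "diagram \<Rightarrow> diagram \<Rightarrow> bool" where
  "isotopic D D' \<longleftrightarrow> link_diagram D \<and> link_diagram D' \<and> equivclp move D D'"

quotient_type link = diagram / partial: isotopic
  morphisms rep_link link_of
proof (rule part_equivpI)
  show "\<exists>D. isotopic D D"
    by (rule exI[of _ "[]"]) (simp add: isotopic_def link_diagram_def)
  show "symp isotopic"
    unfolding isotopic_def by (auto intro!: sympI intro: equivclp_sym)
  show "transp isotopic"
    unfolding isotopic_def by (auto intro!: transpI intro: equivclp_trans)
qed

text \<open>
  The components of a diagram are the classes of the points \<open>(i, p)\<close>, the \<open>p\<close>-th strand
  (counted from 0) on the horizontal line below slice number \<open>i\<close>, under the relation of being
  connected along the diagram.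
\<close>

definition points :: "diagram \<Rightarrow> (nat \<times> nat) set" where
  "points D = {(i, p). i \<le> length D \<and> p < length (strands (take i D))}"

inductive adjacent :: "diagram \<Rightarrow> nat \<times> nat \<Rightarrow> nat \<times> nat \<Rightarrow> bool" for D where
  left: "i < length D \<Longrightarrow> D ! i = (k, a) \<Longrightarrow> p < k \<Longrightarrow> adjacent D (i, p) (Suc i, p)"
| right: "i < length D \<Longrightarrow> D ! i = (k, a) \<Longrightarrow>
    adjacent D (i, k + inputs a + p) (Suc i, k + outputs a + p)"
| cross1: "i < length D \<Longrightarrow> D ! i = (k, Cross c) \<Longrightarrow> adjacent D (i, k) (Suc i, Suc k)"
| cross2: "i < length D \<Longrightarrow> D ! i = (k, Cross c) \<Longrightarrow> adjacent D (i, Suc k) (Suc i, k)"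
| cup: "i < length D \<Longrightarrow> D ! i = (k, Cup b) \<Longrightarrow> adjacent D (Suc i, k) (Suc i, Suc k)"
| cap: "i < length D \<Longrightarrow> D ! i = (k, Cap) \<Longrightarrow> adjacent D (i, k) (i, Suc k)"

definition same_component :: "diagram \<Rightarrow> nat \<times> nat \<Rightarrow> nat \<times> nat \<Rightarrow> bool" where
  "same_component D x y \<longleftrightarrow> x \<in> points D \<and> y \<in> points D \<and> equivclp (adjacent D) x y"

definition components :: "diagram \<Rightarrow> (nat \<times> nat) set set" where
  "components D = points D // {(x, y). same_component D x y}"

definition knot_diagram :: "diagram \<Rightarrow> bool" where
  "knot_diagram D \<longleftrightarrow> link_diagram D \<and> card (components D) = 1"

definition unknot :: link where
  "unknot = link_of [(0, Cup True), (0, Cap)]"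

text \<open>Link diagrams placed above each other are separated by a horizontal line.\<close>

definition disjoint_union_of_knots :: "nat \<Rightarrow> link \<Rightarrow> bool" where
  "disjoint_union_of_knots k L \<longleftrightarrow>
     (\<exists>Ds. length Ds = k \<and> (\<forall>D \<in> set Ds. knot_diagram D) \<and> L = link_of (concat Ds))"

subsection \<open>Conway triples\<close>

text \<open>
  The three diagrams agree below (\<open>X\<close>) and above (\<open>Y\<close>) a slice whose active part involves the
  strands \<open>k\<close> and \<open>Suc k\<close>. For parallel strands \<open>Cross True\<close> is the positive crossing and the
  oriented smoothing is trivial; for antiparallel strands \<open>Cross False\<close> is the positive crossing
  and the oriented smoothing is a cap followed by a cup.
\<close>

definition parallel :: "diagram \<Rightarrow> nat \<Rightarrow> bool" where
  "parallel X k \<longleftrightarrow> strands X ! k = strands X ! Suc k"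

definition pos_diagram :: "diagram \<Rightarrow> nat \<Rightarrow> diagram \<Rightarrow> diagram" where
  "pos_diagram X k Y = X @ [(k, Cross (parallel X k))] @ Y"

definition neg_diagram :: "diagram \<Rightarrow> nat \<Rightarrow> diagram \<Rightarrow> diagram" where
  "neg_diagram X k Y = X @ [(k, Cross (\<not> parallel X k))] @ Y"

definition smooth_diagram :: "diagram \<Rightarrow> nat \<Rightarrow> diagram \<Rightarrow> diagram" where
  "smooth_diagram X k Y =
     X @ (if parallel X k then [] else [(k, Cap), (k, Cup (strands X ! Suc k))]) @ Y"

definition conway_triple :: "link \<Rightarrow> link \<Rightarrow> link \<Rightarrow> bool" where
  "conway_triple Lp Lm L0 \<longleftrightarrow>
     (\<exists>X k Y. link_diagram (pos_diagram X k Y) \<and>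
        Lp = link_of (pos_diagram X k Y) \<and>
        Lm = link_of (neg_diagram X k Y) \<and>
        L0 = link_of (smooth_diagram X k Y))"

definition mixed_conway_triple :: "link \<Rightarrow> link \<Rightarrow> link \<Rightarrow> bool" where
  "mixed_conway_triple Lp Lm L0 \<longleftrightarrow>
     (\<exists>X k Y. link_diagram (pos_diagram X k Y) \<and>
        \<not> same_component (pos_diagram X k Y) (length X, k) (length X, Suc k) \<and>
        Lp = link_of (pos_diagram X k Y) \<and>
        Lm = link_of (neg_diagram X k Y) \<and>
        L0 = link_of (smooth_diagram X k Y))"

subsection \<open>Closures of braids\<close>

text \<open>
  The braid generators are numbered from 0: the letter \<open>(i, True)\<close> is \<open>\<sigma>\<^sub>i\<^sub>+\<^sub>1\<close>, and \<open>(i, False)\<close> is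
  its inverse.
\<close>

type_synonym braid_word = "(nat \<times> bool) list"

definition braid_word :: "nat \<Rightarrow> braid_word \<Rightarrow> bool" where
  "braid_word n w \<longleftrightarrow> (\<forall>(i, b) \<in> set w. Suc i < n)"

definition exponent_sum :: "braid_word \<Rightarrow> int" where
  "exponent_sum w = (\<Sum>(i, b) \<leftarrow> w. if b then 1 else - 1)"

text \<open>The \<open>n\<close> strands of the braid run upwards, and return downwards on the right.\<close>

definition closure_diagram :: "nat \<Rightarrow> braid_word \<Rightarrow> diagram" where
  "closure_diagram n w =
     map (\<lambda>i. (i, Cup True)) [0..<n] @
     map (\<lambda>(i, b). (i, Cross b)) w @
     map (\<lambda>i. (i, Cap)) (rev [0..<n])"

definition braid_closure :: "nat \<Rightarrow> braid_word \<Rightarrow> link" where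
  "braid_closure n w = link_of (closure_diagram n w)"


section \<open>The Yokonuma-Hecke algebra and its trace\<close>

text \<open>
  Generators are numbered from 0, so that \<open>G i\<close> and \<open>T j\<close> stand for \<open>g\<^sub>i\<^sub>+\<^sub>1\<close> and \<open>t\<^sub>j\<^sub>+\<^sub>1\<close>. The free
  complex algebra on the generators is the monoid algebra of the free monoid of words, the
  addition on words being concatenation.
\<close>

datatype yh_gen = G nat | T nat

datatype yh_word = Word (letters: "yh_gen list")

instantiation yh_word :: monoid_add
begin

definition zero_yh_word :: yh_word where
  "0 = Word []"

definition plus_yh_word :: "yh_word \<Rightarrow> yh_word \<Rightarrow> yh_word" where
  "v + w = Word (letters v @ letters w)"

instance
  by standard (simp_all add: zero_yh_word_def plus_yh_word_def)

end

type_synonym yh_free = "yh_word \<Rightarrow>\<^sub>0 complex"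

definition scal :: "complex \<Rightarrow> yh_free" where
  "scal c = Poly_Mapping.single 0 c"

definition yh_g :: "nat \<Rightarrow> yh_free" where
  "yh_g i = Poly_Mapping.single (Word [G i]) 1"

definition yh_t :: "nat \<Rightarrow> yh_free" where
  "yh_t j = Poly_Mapping.single (Word [T j]) 1"

definition yh_e :: "nat \<Rightarrow> nat \<Rightarrow> yh_free" where
  "yh_e d i = scal (1 / of_nat d) * (\<Sum>s<d. yh_t i ^ s * yh_t (Suc i) ^ (d - s))"

text \<open>The free algebra on the generators of \<open>Y\<^sub>d\<^sub>,\<^sub>n\<close>, as a subalgebra of the free algebra on all
  generators.\<close>

definition yh_gens :: "nat \<Rightarrow> yh_gen set" where
  "yh_gens n = {G i | i. Suc i < n} \<union> {T j | j. j < n}"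

definition yh_free_on :: "nat \<Rightarrow> yh_free set" where
  "yh_free_on n = {x. \<forall>w \<in> Poly_Mapping.keys x. set (letters w) \<subseteq> yh_gens n}"

inductive_set yh_relators :: "nat \<Rightarrow> complex \<Rightarrow> nat \<Rightarrow> yh_free set" for d q n where
  braid: "i + 2 < n \<Longrightarrow>
    yh_g i * yh_g (Suc i) * yh_g i - yh_g (Suc i) * yh_g i * yh_g (Suc i) \<in> yh_relators d q n"
| far: "Suc i < n \<Longrightarrow> Suc j < n \<Longrightarrow> \<bar>int i - int j\<bar> > 1 \<Longrightarrow>
    yh_g i * yh_g j - yh_g j * yh_g i \<in> yh_relators d q n"
| comm: "i < n \<Longrightarrow> j < n \<Longrightarrow> yh_t i * yh_t j - yh_t j * yh_t i \<in> yh_relators d q n"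
| swap: "Suc i < n \<Longrightarrow> j < n \<Longrightarrow>
    yh_t j * yh_g i - yh_g i * yh_t (transpose i (Suc i) j) \<in> yh_relators d q n"
| torsion: "j < n \<Longrightarrow> yh_t j ^ d - 1 \<in> yh_relators d q n"
| quadratic: "Suc i < n \<Longrightarrow>
    yh_g i ^ 2 - (1 + scal (q - inverse q) * yh_e d i * yh_g i) \<in> yh_relators d q n"

text \<open>\<open>Y\<^sub>d\<^sub>,\<^sub>n(q)\<close> is the quotient of \<open>yh_free_on n\<close> by the following two-sided ideal.\<close>

inductive_set yh_ideal :: "nat \<Rightarrow> complex \<Rightarrow> nat \<Rightarrow> yh_free set" for d q n where
  zero: "0 \<in> yh_ideal d q n"
| add: "x \<in> yh_ideal d q n \<Longrightarrow> y \<in> yh_ideal d q n \<Longrightarrow> x + y \<in> yh_ideal d q n"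
| gen: "a \<in> yh_free_on n \<Longrightarrow> r \<in> yh_relators d q n \<Longrightarrow> b \<in> yh_free_on n \<Longrightarrow>
    a * r * b \<in> yh_ideal d q n"

text \<open>
  A linear map on the union of the algebras \<open>Y\<^sub>d\<^sub>,\<^sub>n(q)\<close> is a linear map on the free algebra on all
  generators that vanishes on all the ideals. The indeterminate \<open>z\<close> is \<open>[:0, 1:]\<close>.
\<close>

definition yh_trace :: "nat \<Rightarrow> complex \<Rightarrow> (yh_free \<Rightarrow> complex poly) \<Rightarrow> bool" where
  "yh_trace d q tr \<longleftrightarrow>
     (\<forall>x y. tr (x + y) = tr x + tr y) \<and>
     (\<forall>c x. tr (scal c * x) = smult c (tr x)) \<and>
     (\<forall>n. \<forall>x \<in> yh_ideal d q n. tr x = 0) \<and>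
     (\<forall>n. \<forall>a \<in> yh_free_on n. \<forall>b \<in> yh_free_on n. tr (a * b) = tr (b * a)) \<and>
     tr 1 = 1 \<and>
     (\<forall>n. \<forall>a \<in> yh_free_on (Suc n). tr (a * yh_g n) = [:0, 1:] * tr a) \<and>
     (\<forall>n. \<forall>a \<in> yh_free_on n. \<forall>k. 1 \<le> k \<and> k \<le> d - 1 \<longrightarrow> tr (a * yh_t n ^ k) = 0)"

text \<open>
  In the quotient, \<open>e\<^sub>i\<close> and \<open>g\<^sub>i\<close> commute, so that the quadratic relation gives
  \<open>g\<^sub>i\<^sup>-\<^sup>1 = g\<^sub>i - (q - q\<^sup>-\<^sup>1) e\<^sub>i\<close>.
\<close>

definition yh_ginv :: "nat \<Rightarrow> complex \<Rightarrow> nat \<Rightarrow> yh_free" where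
  "yh_ginv d q i = yh_g i - scal (q - inverse q) * yh_e d i"

definition braid_image :: "nat \<Rightarrow> complex \<Rightarrow> braid_word \<Rightarrow> yh_free" where
  "braid_image d q w = prod_list (map (\<lambda>(i, b). if b then yh_g i else yh_ginv d q i) w)"


section \<open>The two link invariants\<close>

text \<open>
  The invariants are considered at fixed values of the parameters; \<open>s\<close> is the value of \<open>\<surd>\<lambda>\<^sub>D\<close>. The parameters are restricted to those for which \<open>z\<close>, as a
  function of \<open>q\<close> and \<open>\<lambda>\<^sub>D\<close>, and \<open>\<Lambda>\<^sub>D\<close> are defined.
\<close>

definition admissible :: "complex \<Rightarrow> complex \<Rightarrow> bool" where
  "admissible q s \<longleftrightarrow> q \<noteq> 0 \<and> q\<^sup>2 \<noteq> 1 \<and> s \<noteq> 0 \<and> s\<^sup>2 \<noteq> 1"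

definition E_D :: "nat \<Rightarrow> complex" where
  "E_D d = 1 / of_nat d"

definition z_of :: "nat \<Rightarrow> complex \<Rightarrow> complex \<Rightarrow> complex" where
  "z_of d q s = (q - inverse q) * E_D d / (1 - s\<^sup>2)"

definition Lambda_D :: "nat \<Rightarrow> complex \<Rightarrow> complex \<Rightarrow> complex" where
  "Lambda_D d q s = 1 / (z_of d q s * s)"

definition theta_braid ::
  "nat \<Rightarrow> complex \<Rightarrow> complex \<Rightarrow> (yh_free \<Rightarrow> complex poly) \<Rightarrow> nat \<Rightarrow> braid_word \<Rightarrow> complex" where
  "theta_braid d q s tr n w =
     Lambda_D d q s ^ (n - 1) * s powi exponent_sum w *
     poly (tr (braid_image d q w)) (z_of d q s)"

text \<open>
  Every link is the closure of a braid, so the following condition determines \<open>\<Theta>\<close> as an invariant of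
  links (except for its value at the empty link, which never enters).
\<close>

definition is_Theta ::
  "nat \<Rightarrow> complex \<Rightarrow> complex \<Rightarrow> (yh_free \<Rightarrow> complex poly) \<Rightarrow> (link \<Rightarrow> complex) \<Rightarrow> bool" where
  "is_Theta d q s tr \<Theta> \<longleftrightarrow>
     (\<forall>n w. 1 \<le> n \<longrightarrow> braid_word n w \<longrightarrow> \<Theta> (braid_closure n w) = theta_braid d q s tr n w)"

definition is_Homflypt :: "complex \<Rightarrow> complex \<Rightarrow> (link \<Rightarrow> complex) \<Rightarrow> bool" where
  "is_Homflypt q s P \<longleftrightarrow>
     P unknot = 1 \<and>
     (\<forall>Lp Lm L0. conway_triple Lp Lm L0 \<longrightarrow>
        1 / s * P Lp - s * P Lm = (q - inverse q) * P L0)"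


section \<open>Resolving a link\<close>

text \<open>
  Laurent polynomials in \<open>q\<close> and \<open>\<surd>\<lambda>\<^sub>D\<close> over the rationals; the key \<open>(a, b)\<close> is the monomial
  \<open>q\<^sup>a \<surd>\<lambda>\<^sub>D\<^sup>b\<close>.
\<close>

type_synonym laurent = "(int \<times> int) \<Rightarrow>\<^sub>0 rat"

definition monomial :: "int \<Rightarrow> int \<Rightarrow> laurent" where
  "monomial a b = Poly_Mapping.single (a, b) 1"

definition eval_laurent :: "complex \<Rightarrow> complex \<Rightarrow> laurent \<Rightarrow> complex" where
  "eval_laurent q s p =
     (\<Sum>(a, b) \<in> Poly_Mapping.keys p.
        of_rat (Poly_Mapping.lookup p (a, b)) * q powi a * s powi b)"

type_synonym link_comb = "link \<Rightarrow>\<^sub>0 laurent"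

text \<open>
  Every occurrence of \<open>L\<close> in \<open>C\<close> is replaced by \<open>x \<cdot> L' + y \<cdot> L0\<close>.
\<close>

definition replace_link ::
  "link_comb \<Rightarrow> link \<Rightarrow> laurent \<Rightarrow> link \<Rightarrow> laurent \<Rightarrow> link \<Rightarrow> link_comb" where
  "replace_link C L x L' y L0 =
     (let c = Poly_Mapping.lookup C L in
      C - Poly_Mapping.single L c + Poly_Mapping.single L' (c * x) + Poly_Mapping.single L0 (c * y))"

inductive resolves_to :: "link \<Rightarrow> link_comb \<Rightarrow> bool" for L where
  start: "resolves_to L (Poly_Mapping.single L 1)"
| pos: "resolves_to L C \<Longrightarrow> mixed_conway_triple Lp Lm L0 \<Longrightarrow> Lp \<in> Poly_Mapping.keys C \<Longrightarrow>
    resolves_to L (replace_link C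
      Lp (monomial 0 2) Lm ((monomial 1 0 - monomial (- 1) 0) * monomial 0 1) L0)"
| neg: "resolves_to L C \<Longrightarrow> mixed_conway_triple Lp Lm L0 \<Longrightarrow> Lm \<in> Poly_Mapping.keys C \<Longrightarrow>
    resolves_to L (replace_link C
      Lm (monomial 0 (- 2)) Lp (- (monomial 1 0 - monomial (- 1) 0) * monomial 0 (- 1)) L0)"

definition resolution :: "link \<Rightarrow> nat \<Rightarrow> link_comb \<Rightarrow> bool" where
  "resolution L l C \<longleftrightarrow>
     resolves_to L C \<and>
     (\<forall>K \<in> Poly_Mapping.keys C. \<exists>k. 1 \<le> k \<and> k \<le> l \<and> disjoint_union_of_knots k K)"

definition knot_unions :: "link_comb \<Rightarrow> nat \<Rightarrow> link set" where
  "knot_unions C k = {K \<in> Poly_Mapping.keys C. disjoint_union_of_knots k K}"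

definition knot_unions_sum ::
  "complex \<Rightarrow> complex \<Rightarrow> link_comb \<Rightarrow> nat \<Rightarrow> (link \<Rightarrow> complex) \<Rightarrow> complex" where
  "knot_unions_sum q s C k F =
     (\<Sum>K \<in> knot_unions C k. eval_laurent q s (Poly_Mapping.lookup C K) * F K)"

end

theory Submission
  imports Defs
begin

text \<open>
  At a crossing between different components both invariants satisfy the special skein relation: for
  \<open>P\<close> it is the Homflypt relation, for \<open>\<Theta>\<close> it is the lemma \<open>Theta_mixed_skein\<close>. Hence both
  are unchanged along a resolution, and the values of \<open>P\<close> and \<open>\<Theta>\<close> at \<open>L\<close> are the same
  combination of their values at disjoint unions of knots. The theorem therefore
  amounts to the comparison \<open>\<Theta> K = d\<^sup>k\<^sup>-\<^sup>1 P K\<close> for a disjoint union \<open>K\<close> of \<open>k\<close> knots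
  (\<open>Theta_knot_union\<close>), together with the fact that \<open>k\<close> is determined by \<open>K\<close>.

  Since \<open>\<Theta>\<close> is prescribed on closed braids only, diagrams have to be turned into closed braids:
  \<open>Alexander\<close> and \<open>Alexander_Conway_triple\<close>, where the latter treats the three diagrams of a
  Conway triple by one and the same isotopy. All crossings are rotated until they point upwards.
  Then the strands at every height are sorted, the upward ones to the left, by letting
  the downward ones pass over everything else; an over-strand slides
  freely across any diagram (\<open>pass_natural\<close>), so every slice becomes a crossing among
  upward strands, a crossing among downward strands, or an extremum in the middle. Such
  slices are finally absorbed one by one into a partially closed braid.

  Components are counted by two-colourings: a closed diagram with \<open>c\<close> components has \<open>2\<^sup>c\<close> of
  them, and this number is easy to follow through moves, disjoint unions and braid closures. A mixed
  crossing has more colourings than its smoothing (\<open>colourings_mixed\<close>), so the two strands of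
  the smoothed braid at the crossing lie on the same cycle. Framings may be moved along cycles inside the
  trace, so \<open>e\<^sub>i\<close> acts as \<open>1\<close> there, and the relation for \<open>g\<^sub>i\<^sup>-\<^sup>1\<close> becomes the special skein relation.

  For the comparison, let \<open>E\<close> be the average of all framings on \<open>n\<close> strands. It is a central
  idempotent with \<open>e\<^sub>i E = E\<close>, so on multiples of \<open>E\<close> the quadratic relation is that of the
  Hecke algebra, and \<open>w \<mapsto> d\<^sup>n tr (w E)\<close> is a Markov trace with parameter \<open>d z\<close>. A Markov trace is unique
  (\<open>markov_family_unique\<close>), and the Homflypt polynomial of closed braids, suitably normalised, is
  another one with the same parameter; hence \<open>P\<close> is computed by \<open>tr (w E)\<close> (\<open>P_braid_closure\<close>). If the closure
  of \<open>w\<close> is a knot, then all framings can be collected on one strand, and nontrivial ones have trace \<open>0\<close> by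
  invariance under \<open>t\<^sub>j \<mapsto> \<zeta> t\<^sub>j\<close>; so \<open>tr (w E) = tr w / d\<close>. For a disjoint union of \<open>k\<close> knots the
  trace is multiplicative, which yields the factor \<open>d\<^sup>-\<^sup>k\<close>.
\<close>

section \<open>Isotopy of tangle diagrams\<close>

inductive valid_step :: "bool list \<Rightarrow> diagram \<Rightarrow> diagram \<Rightarrow> bool" for st where
  "local_move A B \<Longrightarrow> run (X @ A @ Y) st = Some u \<Longrightarrow> run (X @ B @ Y) st = Some u \<Longrightarrow>
   valid_step st (X @ A @ Y) (X @ B @ Y)"

text \<open>
  Two words that are both inadmissible on \<open>st\<close> count as equivalent. This makes the
  relation a congruence for concatenation without any admissibility assumption.
\<close>

definition tangle_eq :: "bool list \<Rightarrow> diagram \<Rightarrow> diagram \<Rightarrow> bool" where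
  "tangle_eq st A B \<longleftrightarrow> run A st = run B st \<and> (run A st \<noteq> None \<longrightarrow> equivclp (valid_step st) A B)"

lemma run_append: "run (A @ B) st = Option.bind (run A st) (run B)"
  by (induction A arbitrary: st) (auto simp: bind_assoc split: Option.bind_splits)

lemma equivclp_map:
  assumes "equivclp R x y" "\<And>x y. R x y \<Longrightarrow> equivclp S (f x) (f y)"
  shows "equivclp S (f x) (f y)"
  using assms(1)
proof (induction rule: equivclp_induct)
  case (step y z)
  then show ?case by (metis assms(2) equivclp_sym equivclp_trans)
qed simp

lemma equivclp_invariant:
  assumes "equivclp R x y" "\<And>x y. R x y \<Longrightarrow> f x = f y"
  shows "f x = f y"
  using assms(1) by (induction rule: equivclp_induct) (auto dest: assms(2))

lemma tangle_eq_refl [simp]: "tangle_eq st A A"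
  by (auto simp: tangle_eq_def)

lemma tangle_eq_sym: "tangle_eq st A B \<Longrightarrow> tangle_eq st B A"
  by (auto simp: tangle_eq_def intro: equivclp_sym)

lemma tangle_eq_trans [trans]: "tangle_eq st A B \<Longrightarrow> tangle_eq st B C \<Longrightarrow> tangle_eq st A C"
  by (auto simp: tangle_eq_def intro: equivclp_trans)

lemma valid_step_append_right:
  assumes "valid_step st x y" "run (x @ C) st \<noteq> None" shows "valid_step st (x @ C) (y @ C)"
  using assms(1)
proof cases
  case (1 A B X Y u)
  then have u: "run x st = Some u" "run y st = Some u" by simp_all
  obtain v where v: "run C u = Some v" using assms(2) by (auto simp: run_append u)
  have "run (X @ A @ (Y @ C)) st = Some v" "run (X @ B @ (Y @ C)) st = Some v"
    using u v 1 run_append[of x C st] run_append[of y C st] by simp_all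
  from valid_step.intros[OF 1(3) this] show ?thesis using 1 by simp
qed

lemma valid_step_run: "valid_step st x y \<Longrightarrow> run x st = run y st"
  by (auto elim: valid_step.cases)

lemma tangle_eq_append_right:
  assumes "tangle_eq st A B" shows "tangle_eq st (A @ C) (B @ C)"
proof -
  have "equivclp (valid_step st) (A @ C) (B @ C)" if C: "run (A @ C) st \<noteq> None"
  proof -
    from C have "equivclp (valid_step st) A B"
      using assms by (auto simp: tangle_eq_def run_append)
    then have "run (B @ C) st \<noteq> None \<and> equivclp (valid_step st) (A @ C) (B @ C)"
    proof (induction rule: equivclp_induct)
      case base show ?case using C by simp
    next
      case (step y z)
      then have "run (z @ C) st \<noteq> None" "valid_step st (y @ C) (z @ C) \<or> valid_step st (z @ C) (y @ C)"
        using valid_step_append_right valid_step_run by (auto simp: run_append)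
      then show ?case using step by (meson equivclp_sym equivclp_trans r_into_equivclp)
    qed
    then show ?thesis by blast
  qed
  then show ?thesis using assms by (auto simp: tangle_eq_def run_append)
qed

lemma tangle_eq_append_left:
  assumes "\<And>u. run C st = Some u \<Longrightarrow> tangle_eq u A B" shows "tangle_eq st (C @ A) (C @ B)"
proof (cases "run C st")
  case None
  then show ?thesis by (auto simp: tangle_eq_def run_append)
next
  case (Some u)
  from assms[OF Some] have AB: "tangle_eq u A B" .
  have "valid_step st (C @ x) (C @ y)" if "valid_step u x y" for x y
    using that
  proof cases
    case (1 A' B' X Y v)
    have "valid_step st ((C @ X) @ A' @ Y) ((C @ X) @ B' @ Y)"
      by (rule valid_step.intros[where u = v]) (use 1 Some in \<open>auto simp: run_append\<close>)
    then show ?thesis using 1 by simp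
  qed
  then have "equivclp (valid_step st) (C @ A) (C @ B)" if "equivclp (valid_step u) A B"
    using equivclp_map[OF that, of "valid_step st" "(@) C"] by (simp add: r_into_equivclp)
  then show ?thesis using AB Some by (simp add: tangle_eq_def run_append)
qed

text \<open>
  Every intermediate diagram has the same \<open>run\<close>, hence is a link diagram as the
  definition of a move requires.
\<close>

lemma isotopic_if_tangle_eq:
  assumes "tangle_eq [] D D'" "link_diagram D" shows "isotopic D D'"
proof -
  have run: "run D [] = Some []" "run D' [] = Some []" using assms by (auto simp: tangle_eq_def link_diagram_def)
  have "equivclp (valid_step []) D D'" using assms by (auto simp: tangle_eq_def link_diagram_def)
  then have "run D' [] = Some [] \<and> equivclp move D D'"
  proof (induction rule: equivclp_induct)
    case base show ?case by (simp add: run)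
  next
    case (step y z)
    from step(2) have "run z [] = Some [] \<and> (move y z \<or> move z y)"
      by (elim disjE valid_step.cases) (use step.IH in \<open>auto simp: link_diagram_def intro!: move.intros\<close>)
    then show ?case using step.IH
      by (meson equivclp_sym equivclp_trans r_into_equivclp)
  qed
  then show ?thesis using run by (simp add: isotopic_def link_diagram_def)
qed

lemma link_of_eq_iff: "link_diagram D \<Longrightarrow> link_diagram D' \<Longrightarrow> link_of D = link_of D' \<longleftrightarrow> isotopic D D'"
  using Quotient3_rel[OF Quotient3_link] by (auto simp: isotopic_def)

text \<open>
  The counterpart of \<open>run\<close> when orientations are forgotten.
\<close>

fun fit :: "diagram \<Rightarrow> nat \<Rightarrow> nat option" where
  "fit [] n = Some n"
| "fit ((k, p) # D) n = (if k + inputs p \<le> n then fit D (n - inputs p + outputs p) else None)"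

lemma fit_append: "fit (A @ B) n = Option.bind (fit A n) (fit B)"
  by (induction A n rule: fit.induct) auto

text \<open>
  All moves except the straightening of a strand are possible whatever the orientations are, so
  almost all isotopies can be established from the number \<open>n\<close> of strands alone.
\<close>

definition width_eq :: "nat \<Rightarrow> diagram \<Rightarrow> diagram \<Rightarrow> bool" where
  "width_eq n A B \<longleftrightarrow> (\<forall>st. length st = n \<longrightarrow> tangle_eq st A B)"

lemma slice_step_fit: "slice_step (k, p) st = Some u \<Longrightarrow> k + inputs p \<le> length st \<and> length u = length st - inputs p + outputs p"
  by (cases p) (auto split: if_splits)

lemma run_fit: "run D st = Some u \<Longrightarrow> fit D (length st) = Some (length u)"
proof (induction D arbitrary: st)
  case (Cons s D)
  obtain k p where s: "s = (k, p)" by force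
  from Cons.prems obtain v where "slice_step (k, p) st = Some v" "run D v = Some u"
    by (auto simp: s bind_eq_Some_conv)
  then show ?case using Cons.IH slice_step_fit s by fastforce
qed simp

lemma run_length: "run C st = Some u \<Longrightarrow> fit C (length st) = Some n \<Longrightarrow> length u = n"
  using run_fit by fastforce

lemma width_eq_refl [simp]: "width_eq n A A"
  by (simp add: width_eq_def)

lemma width_eq_sym: "width_eq n A B \<Longrightarrow> width_eq n B A"
  by (auto simp: width_eq_def intro: tangle_eq_sym)

lemma width_eq_trans [trans]: "width_eq n A B \<Longrightarrow> width_eq n B C \<Longrightarrow> width_eq n A C"
  by (auto simp: width_eq_def intro: tangle_eq_trans)

lemma width_eq_context:
  assumes "width_eq m A B" "fit P n = Some m" shows "width_eq n (P @ A @ Q) (P @ B @ Q)"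
  using assms unfolding width_eq_def
  by (metis append.assoc run_length tangle_eq_append_left tangle_eq_append_right)

lemma width_eq_left: "width_eq m A B \<Longrightarrow> fit P n = Some m \<Longrightarrow> width_eq n (P @ A) (P @ B)"
  using width_eq_context[of m A B P n "[]"] by simp

lemma width_eq_right: "width_eq n A B \<Longrightarrow> width_eq n (A @ Q) (B @ Q)"
  using width_eq_context[of n A B "[]" n Q] by simp

lemma tangle_eq_local:
  assumes "local_move A B" "run A st = run B st" shows "tangle_eq st A B"
  using assms valid_step.intros[OF assms(1), of "[]" "[]" st "the (run A st)"]
  by (auto simp: tangle_eq_def intro: r_into_equivclp)

fun piece_output :: "piece \<Rightarrow> bool list \<Rightarrow> bool list option" where
  "piece_output (Cross c) [a, b] = Some [b, a]"
| "piece_output (Cup b) [] = Some [b, \<not> b]"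
| "piece_output Cap [a, b] = (if a \<noteq> b then Some [] else None)"
| "piece_output _ _ = None"

text \<open>
  With the strands split into those left of the piece, at the piece and right of it, a slice is
  easy to compute with; the take-and-drop form of the definition is not.
\<close>

lemma slice_step_split:
  assumes "length xs = k" "length ys = inputs p"
  shows "slice_step (k, p) (xs @ ys @ zs) = map_option (\<lambda>v. xs @ v @ zs) (piece_output p ys)"
  using assms
  by (cases "(p, ys)" rule: piece_output.cases; cases p) (auto simp: nth_append)
 
lemma slice_step_None: "length st < k + inputs p \<Longrightarrow> slice_step (k, p) st = None"
  by (cases p) auto
 
lemma width_eq_height:
  "width_eq n [(k, a), (k + outputs a + j, b)] [(k + inputs a + j, b), (k, a)]"
  unfolding width_eq_def
proof safe
  fix st :: "bool list" assume n: "n = length st"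
  show "tangle_eq st [(k, a), (k + outputs a + j, b)] [(k + inputs a + j, b), (k, a)]"
  proof (rule tangle_eq_local[OF local_move.height])
    show "run [(k, a), (k + outputs a + j, b)] st = run [(k + inputs a + j, b), (k, a)] st"
    proof (cases "k + inputs a + j + inputs b \<le> length st")
      case True
      define xs where "xs = take k st"
      define ys where "ys = take (inputs a) (drop k st)"
      define zs where "zs = take j (drop (k + inputs a) st)"
      define us where "us = take (inputs b) (drop (k + inputs a + j) st)"
      define vs where "vs = drop (k + inputs a + j + inputs b) st"
      have st: "st = xs @ ys @ zs @ us @ vs"
        unfolding xs_def ys_def zs_def us_def vs_def
        by (metis add.commute append_take_drop_id drop_drop)
      have len: "length xs = k" "length ys = inputs a" "length zs = j" "length us = inputs b"
        using True by (auto simp: xs_def ys_def zs_def us_def)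
      have la: "length o' = outputs p" if "piece_output p w = Some o'" for p w o'
        using that by (cases "(p, w)" rule: piece_output.cases) (auto split: if_splits)
      have 1: "slice_step (k, a) (xs @ ys @ w) = map_option (\<lambda>v. xs @ v @ w) (piece_output a ys)" for w
        by (rule slice_step_split) (use len in auto)
      have 2: "slice_step (k + inputs a + j, b) (xs @ ys @ zs @ us @ vs) = map_option (\<lambda>v. (xs @ ys @ zs) @ v @ vs) (piece_output b us)"
        using slice_step_split[of "xs @ ys @ zs" "k + inputs a + j" us b vs] len by simp
      have 3: "slice_step (k + outputs a + j, b) (xs @ w @ zs @ us @ vs) = map_option (\<lambda>v. (xs @ w @ zs) @ v @ vs) (piece_output b us)"
        if "length w = outputs a" for w
        using slice_step_split[of "xs @ w @ zs" "k + outputs a + j" us b vs] len that by simp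
      show ?thesis
        by (cases "piece_output a ys"; cases "piece_output b us") (auto simp: st 1 2 3 la)
    next
      case False
      have "run [(k, a), (k + outputs a + j, b)] st = None"
      proof (rule ccontr)
        assume "run [(k, a), (k + outputs a + j, b)] st \<noteq> None"
        then obtain u where "run [(k, a), (k + outputs a + j, b)] st = Some u" by blast
        from run_fit[OF this] show False using False by (auto split: if_splits)
      qed
      moreover have "slice_step (k + inputs a + j, b) st = None"
        using False by (intro slice_step_None) auto
      ultimately show ?thesis by simp
    qed
  qed
qed

lemma length_split:
  assumes "n \<le> length st" obtains xs ys where "st = xs @ ys" "length xs = n"
  using assms by (metis append_take_drop_id length_take min.absorb2)

lemma length_ge_2_split:
  assumes "Suc k < length st" obtains xs a b zs where "st = xs @ a # b # zs" "length xs = k"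
proof -
  from assms have "st = take k st @ st ! k # st ! Suc k # drop (Suc (Suc k)) st"
    by (metis Cons_nth_drop_Suc Suc_lessD append_take_drop_id)
  then show ?thesis using that assms by (metis Suc_lessD length_take less_imp_le min.absorb2)
qed

lemma length_ge_3_split:
  assumes "Suc (Suc k) < length st" obtains xs a b c zs where "st = xs @ a # b # c # zs" "length xs = k"
proof -
  from assms have "st = take k st @ st ! k # st ! Suc k # st ! Suc (Suc k) # drop (Suc (Suc (Suc k))) st"
    by (metis Cons_nth_drop_Suc Suc_lessD append_take_drop_id)
  then show ?thesis using that assms by (metis Suc_lessD length_take less_imp_le min.absorb2)
qed

lemma nth_append_Suc_length [simp]: "(xs @ a # b # zs) ! Suc (length xs) = b"
  by (simp add: nth_append)
lemma nth_append_Suc_Suc_length [simp]: "(xs @ a # b # c # zs) ! Suc (Suc (length xs)) = c"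
  by (simp add: nth_append)

lemma width_eq_slide_cup:
  "width_eq n [(Suc k, Cup b), (k, Cross c)] [(k, Cup b), (Suc k, Cross (\<not> c))]"
  unfolding width_eq_def
proof safe
  fix st :: "bool list" 
  have "run [(Suc k, Cup b), (k, Cross c)] st = run [(k, Cup b), (Suc k, Cross (\<not> c))] st"
  proof (cases "Suc k \<le> length st")
    case True
    then obtain xs a zs where "st = xs @ a # zs" "length xs = k"
      by (metis Suc_le_eq id_take_nth_drop length_take less_imp_le min.absorb2)
    then show ?thesis by auto
  qed auto
  then show "tangle_eq st [(Suc k, Cup b), (k, Cross c)] [(k, Cup b), (Suc k, Cross (\<not> c))]"
    by (rule tangle_eq_local[OF local_move.slide_cup])
qed

lemma width_eq_slide_cap:
  "width_eq n [(k, Cross c), (Suc k, Cap)] [(Suc k, Cross (\<not> c)), (k, Cap)]"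
  unfolding width_eq_def
proof safe
  fix st :: "bool list" 
  have "run [(k, Cross c), (Suc k, Cap)] st = run [(Suc k, Cross (\<not> c)), (k, Cap)] st"
  proof (cases "Suc (Suc k) < length st")
    case True
    then obtain xs a b d zs where "st = xs @ a # b # d # zs" "length xs = k"
      by (rule length_ge_3_split)
    then show ?thesis by (auto simp: Suc_diff_le)
  qed auto
  then show "tangle_eq st [(k, Cross c), (Suc k, Cap)] [(Suc k, Cross (\<not> c)), (k, Cap)]"
    by (rule tangle_eq_local[OF local_move.slide_cap])
qed

lemma width_eq_R1_cup: "width_eq n [(k, Cup b), (k, Cross c)] [(k, Cup (\<not> b))]"
  unfolding width_eq_def
proof safe
  fix st :: "bool list" 
  have "run [(k, Cup b), (k, Cross c)] st = run [(k, Cup (\<not> b))] st"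
  proof (cases "k \<le> length st")
    case True
    then obtain xs zs where "st = xs @ zs" "length xs = k"
      by (rule length_split)
    then show ?thesis by auto
  qed auto
  then show "tangle_eq st [(k, Cup b), (k, Cross c)] [(k, Cup (\<not> b))]"
    by (rule tangle_eq_local[OF local_move.R1_cup])
qed

lemma width_eq_R1_cap: "width_eq n [(k, Cross c), (k, Cap)] [(k, Cap)]"
  unfolding width_eq_def
proof safe
  fix st :: "bool list" 
  have "run [(k, Cross c), (k, Cap)] st = run [(k, Cap)] st"
  proof (cases "Suc k < length st")
    case True
    then obtain xs a b zs where "st = xs @ a # b # zs" "length xs = k"
      by (rule length_ge_2_split)
    then show ?thesis by auto
  qed auto
  then show "tangle_eq st [(k, Cross c), (k, Cap)] [(k, Cap)]"
    by (rule tangle_eq_local[OF local_move.R1_cap])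
qed

lemma width_eq_R2:
  assumes "Suc k < n" shows "width_eq n [(k, Cross c), (k, Cross (\<not> c))] []"
  unfolding width_eq_def
proof safe
  fix st :: "bool list" assume "n = length st"
  with assms obtain xs a b zs where "st = xs @ a # b # zs" "length xs = k"
    by (metis length_ge_2_split)
  then have "run [(k, Cross c), (k, Cross (\<not> c))] st = run [] st" by auto
  then show "tangle_eq st [(k, Cross c), (k, Cross (\<not> c))] []"
    by (rule tangle_eq_local[OF local_move.R2])
qed

lemma width_eq_R3:
  "width_eq n [(k, Cross c), (Suc k, Cross c), (k, Cross c)]
              [(Suc k, Cross c), (k, Cross c), (Suc k, Cross c)]"
  unfolding width_eq_def
proof safe
  fix st :: "bool list" 
  have "run [(k, Cross c), (Suc k, Cross c), (k, Cross c)] st = run [(Suc k, Cross c), (k, Cross c), (Suc k, Cross c)] st"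
  proof (cases "Suc (Suc k) < length st")
    case True
    then obtain xs a b d zs where "st = xs @ a # b # d # zs" "length xs = k"
      by (rule length_ge_3_split)
    then show ?thesis by auto
  qed auto
  then show "tangle_eq st [(k, Cross c), (Suc k, Cross c), (k, Cross c)]
              [(Suc k, Cross c), (k, Cross c), (Suc k, Cross c)]"
    by (rule tangle_eq_local[OF local_move.R3])
qed

lemma tangle_eq_zigzag_right:
  assumes "k < length st" "st ! k = b"
  shows "tangle_eq st [(k, Cup b), (Suc k, Cap)] []"
proof (rule tangle_eq_local[OF local_move.zigzag_right])
  have "st = take k st @ b # drop (Suc k) st" using assms id_take_nth_drop[of k st] by simp
  moreover define xs zs where "xs = take k st" and "zs = drop (Suc k) st"
  ultimately have "st = xs @ b # zs" "length xs = k" using assms by simp_all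
  then show "run [(k, Cup b), (Suc k, Cap)] st = run [] st"
    by (simp add: nth_append)
qed

lemma tangle_eq_zigzag_left:
  assumes "k < length st" "st ! k = (\<not> b)"
  shows "tangle_eq st [(Suc k, Cup b), (k, Cap)] []"
proof (rule tangle_eq_local[OF local_move.zigzag_left])
  have "st = take k st @ (\<not> b) # drop (Suc k) st" using assms id_take_nth_drop[of k st] by simp
  moreover define xs zs where "xs = take k st" and "zs = drop (Suc k) st"
  ultimately have "st = xs @ (\<not> b) # zs" "length xs = k" using assms by simp_all
  then show "run [(Suc k, Cup b), (k, Cap)] st = run [] st"
    by (simp add: nth_append)
qed

section \<open>Sliding a strand over a diagram\<close>

lemma run_None_if_fit_None: "fit C (length st) = None \<Longrightarrow> run C st = None"
  using run_fit by (metis not_None_eq option.distinct(1))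

lemma width_eq_append_left:
  assumes "\<And>m. fit P n = Some m \<Longrightarrow> width_eq m A B" shows "width_eq n (P @ A) (P @ B)"
proof (cases "fit P n")
  case None
  then show ?thesis by (auto simp: width_eq_def tangle_eq_def run_append run_None_if_fit_None)
next
  case (Some m)
  then show ?thesis using assms width_eq_left by blast
qed

lemma width_eq_Cons:
  assumes "\<And>m. fit [s] n = Some m \<Longrightarrow> width_eq m A B" shows "width_eq n (s # A) (s # B)"
  using width_eq_append_left[of "[s]" n A B] assms by simp

definition shift :: "nat \<Rightarrow> diagram \<Rightarrow> diagram" where
  "shift k = map (\<lambda>(i, p). (i + k, p))"

lemma shift_Nil [simp]: "shift k [] = []"
  and shift_Cons [simp]: "shift k ((i, p) # A) = (i + k, p) # shift k A"
  and shift_append [simp]: "shift k (A @ B) = shift k A @ shift k B"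
  and shift_shift [simp]: "shift k (shift l A) = shift (l + k) A"
  and shift_0 [simp]: "shift 0 A = A"
  by (auto simp: shift_def)

lemma slice_right_commute:
  "fit A a = Some b \<Longrightarrow> width_eq n (A @ [(b + j, p)]) ([(a + j, p)] @ A)"
proof (induction A arbitrary: a n)
  case (Cons s A)
  obtain k x where s: "s = (k, x)" by force
  define r where "r = a - k - inputs x"
  from Cons.prems have a: "a = k + inputs x + r" and fit: "fit A (k + outputs x + r) = Some b"
    by (auto simp: s r_def algebra_simps split: if_splits)
  have "width_eq n ((k, x) # A @ [(b + j, p)]) ((k, x) # [(k + outputs x + r + j, p)] @ A)"
    by (rule width_eq_Cons) (rule Cons.IH[OF fit])
  also have "width_eq n ([(k, x), (k + outputs x + (r + j), p)] @ A) ([(k + inputs x + (r + j), p), (k, x)] @ A)"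
    by (rule width_eq_right[OF width_eq_height])
  then have "width_eq n ((k, x) # [(k + outputs x + r + j, p)] @ A) ([(k + inputs x + r + j, p), (k, x)] @ A)"
    by (simp add: add.assoc)
  finally show ?case by (simp add: s a)
qed simp

text \<open>
  Diagrams drawn side by side can be drawn in either order of heights.
\<close>

lemma disjoint_commute:
  assumes "fit A a = Some b" shows "width_eq n (A @ shift b B) (shift a B @ A)"
proof (induction B arbitrary: n)
  case (Cons s B)
  obtain k x where s: "s = (k, x)" by force
  have "width_eq n ((A @ [(b + k, x)]) @ shift b B) (([(a + k, x)] @ A) @ shift b B)"
    by (intro width_eq_right slice_right_commute assms)
  also have "width_eq n ([(a + k, x)] @ A @ shift b B) ([(a + k, x)] @ shift a B @ A)"
    by (intro width_eq_append_left Cons.IH)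
  then have "width_eq n (([(a + k, x)] @ A) @ shift b B) ([(a + k, x)] @ shift a B @ A)" by simp
  finally show ?case by (simp add: s add.commute)
qed simp

text \<open>
  The strand at position \<open>a\<close> runs to position \<open>0\<close>, above the
  \<open>a\<close> strands that it meets.
\<close>

fun pass :: "nat \<Rightarrow> diagram" where
  "pass 0 = []"
| "pass (Suc a) = (a, Cross False) # pass a"

lemma pass_add: "pass (i + j) = shift i (pass j) @ pass i"
  by (induction j) auto

lemma fit_pass: "a < n \<Longrightarrow> fit (pass a) n = Some n"
  by (induction a) (auto simp: numeral_2_eq_2 Suc_diff_Suc)

lemma fit_shift: "fit (shift k A) (k + n) = map_option ((+) k) (fit A n)"
  by (induction A n rule: fit.induct) (auto simp: add.commute add.left_commute)

lemma fit_mono: "fit A n = Some m \<Longrightarrow> fit A (n + r) = Some (m + r)"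
  by (induction A n rule: fit.induct) (auto split: if_splits simp: algebra_simps)

lemma fit_shift_le: "fit A n = Some m \<Longrightarrow> fit (shift k A) (k + n + r) = Some (k + m + r)"
  using fit_mono[of "shift k A" "k + n" "k + m" r] by (simp add: fit_shift)

text \<open>
  For a crossing this is the third Reidemeister move, conjugated by the second one if the crossing
  has the other sign. For an extremum one of its legs is slid across the strand; the two crossings
  that remain cancel.
\<close>

lemma pass_slice:
  assumes "k + inputs p < n"
  shows "width_eq n (shift k (pass (inputs p)) @ [(Suc k, p)]) ((k, p) # shift k (pass (outputs p)))"
proof (cases p)
  case (Cross c)
  let ?T = "Cross True" and ?F = "Cross False"
  have n: "Suc (Suc k) < n" using assms Cross by simp
  have "width_eq n [(Suc k, ?F), (k, ?F), (Suc k, Cross c)] [(k, Cross c), (Suc k, ?F), (k, ?F)]"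
  proof (cases c)
    case False
    then show ?thesis using width_eq_sym[OF width_eq_R3] by simp
  next
    case True
    \<comment> \<open>a cancelling pair of crossings is inserted so that the third Reidemeister move applies\<close>
    have "width_eq n ([] @ [(Suc k, ?F), (k, ?F), (Suc k, ?T)]) ([(k, ?T), (k, ?F)] @ [(Suc k, ?F), (k, ?F), (Suc k, ?T)])"
      using width_eq_right[OF width_eq_sym[OF width_eq_R2[of k n True]]] n by simp
    also have "width_eq n ([(k, ?T)] @ [(k, ?F), (Suc k, ?F), (k, ?F)] @ [(Suc k, ?T)])
        ([(k, ?T)] @ [(Suc k, ?F), (k, ?F), (Suc k, ?F)] @ [(Suc k, ?T)])"
      by (rule width_eq_context[OF width_eq_R3]) (use n in simp)
    then have "width_eq n ([(k, ?T), (k, ?F)] @ [(Suc k, ?F), (k, ?F), (Suc k, ?T)])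
        ([(k, ?T), (Suc k, ?F), (k, ?F)] @ [(Suc k, ?F), (Suc k, ?T)])" by simp
    also have "width_eq n ([(k, ?T), (Suc k, ?F), (k, ?F)] @ [(Suc k, ?F), (Suc k, ?T)]) ([(k, ?T), (Suc k, ?F), (k, ?F)] @ [])"
      by (rule width_eq_left[of n]) (use n width_eq_R2[of "Suc k" n False] in \<open>simp_all add: numeral_2_eq_2 Suc_diff_Suc\<close>)
    finally show ?thesis using True by simp
  qed
  then show ?thesis using Cross by (simp add: numeral_2_eq_2)
next
  case (Cup b)
  have "width_eq n ([(k, Cup b), (Suc k, Cross (\<not> True))] @ [(k, Cross False)]) ([(Suc k, Cup b), (k, Cross True)] @ [(k, Cross False)])"
    by (rule width_eq_right[OF width_eq_sym[OF width_eq_slide_cup]])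
  also have "width_eq n ([(Suc k, Cup b)] @ [(k, Cross True), (k, Cross (\<not> True))]) ([(Suc k, Cup b)] @ [])"
    by (rule width_eq_left[OF width_eq_R2, of _ "n + 2"]) (use assms Cup in auto)
  then have "width_eq n ([(Suc k, Cup b), (k, Cross True)] @ [(k, Cross False)]) [(Suc k, Cup b)]" by simp
  finally show ?thesis using Cup by (simp add: numeral_2_eq_2 width_eq_sym)
next
  case Cap
  have "width_eq n ([(Suc k, Cross False)] @ [(k, Cross False), (Suc k, Cap)]) ([(Suc k, Cross False)] @ [(Suc k, Cross (\<not> False)), (k, Cap)])"
    by (rule width_eq_left[OF width_eq_slide_cap, of _ "n"]) (use assms Cap in auto)
  also have "width_eq n ([(Suc k, Cross False), (Suc k, Cross (\<not> False))] @ [(k, Cap)]) ([] @ [(k, Cap)])"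
    by (rule width_eq_right[OF width_eq_R2]) (use assms Cap in auto)
  then have "width_eq n ([(Suc k, Cross False)] @ [(Suc k, Cross (\<not> False)), (k, Cap)]) [(k, Cap)]" by simp
  finally show ?thesis using Cap by (simp add: numeral_2_eq_2)
qed

text \<open>
  One slice is crossed at a time. The strand is cut into the parts left of the slice, at the slice
  and right of it; the outer parts only change their height.
\<close>

lemma pass_natural:
  assumes "fit A a = Some b" "a < n"
  shows "width_eq n (pass a @ shift 1 A) (A @ pass b)"
  using assms
proof (induction A arbitrary: a n)
  case (Cons s A)
  obtain k x where s: "s = (k, x)" by force
  define r where "r = a - k - inputs x"
  from Cons.prems have a: "a = k + inputs x + r" and fit: "fit A (k + outputs x + r) = Some b"
    by (auto simp: s r_def algebra_simps split: if_splits)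
  let ?m = "n - inputs x + outputs x"
  have n: "k + inputs x + r < n" using Cons.prems a by simp
  let ?P = "shift (k + inputs x) (pass r)" and ?R = "shift (k + outputs x) (pass r)"
  have pa: "pass a = ?P @ shift k (pass (inputs x)) @ pass k"
    using pass_add[of k "inputs x + r"] pass_add[of "inputs x" r] by (simp add: a algebra_simps)
  have pb: "pass (k + outputs x + r) = ?R @ shift k (pass (outputs x)) @ pass k"
    using pass_add[of k "outputs x + r"] pass_add[of "outputs x" r] by (simp add: a algebra_simps)
  have fP: "fit ?P n = Some n"
    using fit_shift_le[OF fit_pass[of r "Suc r"], of "k + inputs x" "n - (k + inputs x + r + 1)"] n by simp
  have fQ: "fit (shift k (pass (inputs x))) n = Some n"
    using fit_shift_le[OF fit_pass[of "inputs x" "Suc (inputs x)"], of "k" "n - (k + inputs x + 1)"] n by simp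
  have 1: "width_eq n (pass a @ [(Suc k, x)]) ((k, x) # pass (k + outputs x + r))"
  proof -
    have "width_eq n ((?P @ shift k (pass (inputs x))) @ (pass k @ [(Suc k + 0, x)]))
        ((?P @ shift k (pass (inputs x))) @ ([(Suc k + 0, x)] @ pass k))"
      by (intro width_eq_append_left slice_right_commute) (simp add: fit_pass)
    also have "width_eq n (?P @ (shift k (pass (inputs x)) @ [(Suc k, x)]) @ pass k)
       (?P @ ((k, x) # shift k (pass (outputs x))) @ pass k)"
      by (rule width_eq_context[OF pass_slice fP]) (use n in simp)
    then have "width_eq n ((?P @ shift k (pass (inputs x))) @ ([(Suc k + 0, x)] @ pass k))
       ((?P @ [(k, x)]) @ shift k (pass (outputs x)) @ pass k)" by simp
    also have "width_eq n ((?P @ [(k, x)]) @ shift k (pass (outputs x)) @ pass k)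
        (([(k, x)] @ ?R) @ shift k (pass (outputs x)) @ pass k)"
      by (intro width_eq_right width_eq_sym[OF disjoint_commute]) simp
    finally show ?thesis by (simp add: pa pb)
  qed
  have "width_eq n ((pass a @ [(Suc k, x)]) @ shift 1 A) (((k, x) # pass (k + outputs x + r)) @ shift 1 A)"
    by (rule width_eq_right[OF 1])
  also have "width_eq n ([(k, x)] @ (pass (k + outputs x + r) @ shift 1 A)) ([(k, x)] @ (A @ pass b))"
    by (rule width_eq_left[of ?m]) (use Cons.IH[OF fit, of ?m] n in auto)
  then have "width_eq n (((k, x) # pass (k + outputs x + r)) @ shift 1 A) ((k, x) # A @ pass b)" by simp
  finally show ?case by (simp add: s)
qed simp

text \<open>
  Moves do not depend on the number of strands to the left, which allows an isotopy to be
  performed next to additional strands.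
\<close>

lemma local_move_shift: "local_move A B \<Longrightarrow> local_move (shift k A) (shift k B)"
proof (induction rule: local_move.induct)
  case (height l a j b)
  then show ?case using local_move.height[of "l + k" a j b] by (simp add: algebra_simps)
qed (auto intro: local_move.intros)

lemma slice_step_shift: "slice_step (Suc k, p) (x # st) = map_option ((#) x) (slice_step (k, p) st)"
  by (cases p) auto

lemma run_shift: "run (shift 1 A) (x # st) = map_option ((#) x) (run A st)"
proof (induction A arbitrary: st)
  case (Cons s A)
  obtain k p where s: "s = (k, p)" by force
  show ?case using Cons.IH by (simp add: s slice_step_shift option.map_comp map_option_bind bind_map_option comp_def del: slice_step.simps)
qed simp

lemma width_eq_shift1:
  assumes "width_eq n A B" shows "width_eq (Suc n) (shift 1 A) (shift 1 B)"
  unfolding width_eq_def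
proof safe
  fix st' :: "bool list" assume "length st' = Suc n"
  then obtain x st where st: "st' = x # st" "length st = n" by (cases st') auto
  have "tangle_eq st A B" using assms st by (simp add: width_eq_def)
  moreover have "valid_step (x # st) (shift 1 C) (shift 1 D)" if "valid_step st C D" for C D
    using that
  proof cases
    case (1 C' D' X Y u)
    have "run (shift 1 X @ shift 1 C' @ shift 1 Y) (x # st) = Some (x # u)"
         "run (shift 1 X @ shift 1 D' @ shift 1 Y) (x # st) = Some (x # u)"
      using run_shift[of "X @ C' @ Y" x st] run_shift[of "X @ D' @ Y" x st] 1 by simp_all
    from valid_step.intros[OF local_move_shift[OF 1(3)] this] show ?thesis using 1 by simp
  qed
  then have "equivclp (valid_step (x # st)) (shift 1 A) (shift 1 B)" if "equivclp (valid_step st) A B"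
    by (rule equivclp_map[OF that r_into_equivclp])
  ultimately show "tangle_eq st' (shift 1 A) (shift 1 B)"
    using run_shift[of A x st] run_shift[of B x st] by (auto simp: tangle_eq_def st simp del: One_nat_def)
qed

lemma width_eq_shift: "width_eq n A B \<Longrightarrow> width_eq (k + n) (shift k A) (shift k B)"
proof (induction k)
  case (Suc k)
  then show ?case using width_eq_shift1[of "k + n" "shift k A" "shift k B"] by simp
qed simp

text \<open>
  A closed diagram meets an adjacent strand in no point, so sliding the strand over it only
  exchanges left and right.
\<close>

lemma closed_shift: "fit A 0 = Some 0 \<Longrightarrow> j \<le> n \<Longrightarrow> width_eq n (shift j A) A"
proof (induction j)
  case (Suc j)
  have "width_eq (j + (n - j)) (shift j (pass 0 @ shift 1 A)) (shift j (A @ pass 0))"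
    by (rule width_eq_shift, rule pass_natural) (use Suc.prems in auto)
  then have "width_eq n (shift (Suc j) A) (shift j A)" using Suc.prems by simp
  then show ?case using Suc by (auto intro: width_eq_trans)
qed simp

section \<open>Upward crossings\<close>

text \<open>
  Bending the right strand around turns the crossing by a quarter: strands with orientations
  \<open>(a, b)\<close> now cross with orientations \<open>(\<not> b, a)\<close>. The
  straightening move creates the two new extrema.
\<close>

lemma tangle_eq_rotate:
  assumes "Suc k < length st" "b = st ! Suc k"
  shows "tangle_eq st [(k, Cross c)] [(k, Cup b), (Suc k, Cross (\<not> c)), (Suc (Suc k), Cap)]"
proof -
  have "tangle_eq st ([(k, Cross c)] @ []) ([(k, Cross c)] @ [(k, Cup b), (Suc k, Cap)])"
    by (intro tangle_eq_append_left tangle_eq_sym[OF tangle_eq_zigzag_right])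
       (use assms in \<open>auto simp: nth_append split: if_splits\<close>)
  also have "width_eq (length st) ([(k, Cross c), (k, Cup b)] @ [(Suc k, Cap)]) ([(k, Cup b), (Suc (Suc k), Cross c)] @ [(Suc k, Cap)])"
    using width_eq_right[OF width_eq_sym[OF width_eq_height[of _ k "Cup b" 0 "Cross c"]]] by simp
  then have "tangle_eq st ([(k, Cross c)] @ [(k, Cup b), (Suc k, Cap)]) ([(k, Cup b)] @ [(Suc (Suc k), Cross c), (Suc k, Cap)])"
    by (simp add: width_eq_def)
  also have "width_eq (length st) ([(k, Cup b)] @ [(Suc (Suc k), Cross c), (Suc k, Cap)])
      ([(k, Cup b)] @ [(Suc k, Cross (\<not> c)), (Suc (Suc k), Cap)])"
    using width_eq_append_left[OF width_eq_sym[OF width_eq_slide_cap[of _ "Suc k" "\<not> c"]], where P = "[(k, Cup b)]"] by simp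
  then have "tangle_eq st ([(k, Cup b)] @ [(Suc (Suc k), Cross c), (Suc k, Cap)])
      ([(k, Cup b)] @ [(Suc k, Cross (\<not> c)), (Suc (Suc k), Cap)])" by (simp add: width_eq_def)
  finally show ?thesis by simp
qed

text \<open>
  The middle part of the smoothed diagram of a Conway triple.
\<close>

definition smoothing :: "bool list \<Rightarrow> nat \<Rightarrow> diagram" where
  "smoothing st k = (if st ! k = st ! Suc k then [] else [(k, Cap), (k, Cup (st ! Suc k))])"

text \<open>
  A quarter turn exchanges the two shapes of an oriented smoothing.
\<close>

lemma tangle_eq_rotate_smoothing:
  assumes "Suc k < length st" "b = st ! Suc k" "slice_step (k, Cup b) st = Some v"
  shows "tangle_eq st (smoothing st k) ((k, Cup b) # smoothing v (Suc k) @ [(Suc (Suc k), Cap)])"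
proof -
  from assms(1) obtain xs a b' zs where st: "st = xs @ a # b' # zs" "length xs = k"
    by (rule length_ge_2_split)
  with assms have [simp]: "b' = b" by auto
  have v: "v = xs @ b # (\<not> b) # a # b # zs" using assms(3) st by auto
  have v1: "v ! Suc k = (\<not> b)" "v ! Suc (Suc k) = a" using st v by (auto simp: nth_append)
  show ?thesis
  proof (cases "a = b")
    case True
    have "tangle_eq st ([(k, Cup b), (Suc k, Cap)] @ [(Suc k, Cup a), (Suc (Suc k), Cap)]) ([] @ [(Suc k, Cup a), (Suc (Suc k), Cap)])"
      by (intro tangle_eq_append_right tangle_eq_zigzag_right) (use st True in \<open>auto simp: nth_append\<close>)
    also have "tangle_eq st [(Suc k, Cup a), (Suc (Suc k), Cap)] []"
      by (intro tangle_eq_zigzag_right) (use st True in \<open>auto simp: nth_append\<close>)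
    then have "tangle_eq st ([] @ [(Suc k, Cup a), (Suc (Suc k), Cap)]) []" by simp
    finally show ?thesis using st v1 True by (simp add: smoothing_def tangle_eq_sym nth_append)
  next
    case False
    have "width_eq (length st) [(k, Cap), (k, Cup b)] [(k, Cup b), (Suc (Suc k), Cap)]"
      using width_eq_sym[OF width_eq_height[of _ k "Cup b" 0 Cap]] 
       by simp
    then show ?thesis using st v1 False by (simp add: smoothing_def nth_append width_eq_def)
  qed
qed

text \<open>
  The crossing becomes upward inside surroundings \<open>U\<close> and \<open>V\<close> that are
  the same for both signs and for the smoothing. As \<open>Cross True\<close> is the positive
  crossing of upward strands, the sign is \<open>c\<close> on the right.
\<close>

definition up_crossing_form :: "bool list \<Rightarrow> nat \<Rightarrow> bool" where
  "up_crossing_form st k \<longleftrightarrow> (\<exists>U j V u. run U st = Some u \<and> Suc j < length u \<and> u ! j \<and> u ! Suc j \<and>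
     (\<forall>i c. (i, Cross c) \<notin> set (U @ V)) \<and>
     (\<forall>c. tangle_eq st [(k, Cross (c = (st ! k = st ! Suc k)))] (U @ [(j, Cross c)] @ V)) \<and>
     tangle_eq st (smoothing st k) (U @ V))"

lemma up_crossing_form_rotate:
  assumes "Suc k < length st" "b = st ! Suc k" "slice_step (k, Cup b) st = Some v" "up_crossing_form v (Suc k)"
  shows "up_crossing_form st k"
proof -
  from assms(1) obtain xs a b' zs where st: "st = xs @ a # b' # zs" "length xs = k"
    by (rule length_ge_2_split)
  with assms have [simp]: "b' = b" by auto
  have v: "v = xs @ b # (\<not> b) # a # b # zs" using assms(3) st by auto
  have v1: "v ! Suc k = (\<not> b)" "v ! Suc (Suc k) = a" using st v by (auto simp: nth_append)
  from assms(4) obtain U j V u where U: "run U v = Some u" "Suc j < length u" "u ! j" "u ! Suc j"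
    "\<And>i c. (i, Cross c) \<notin> set (U @ V)"
    "\<And>c. tangle_eq v [(Suc k, Cross (c = (v ! Suc k = v ! Suc (Suc k))))] (U @ [(j, Cross c)] @ V)"
    "tangle_eq v (smoothing v (Suc k)) (U @ V)"
    unfolding up_crossing_form_def by blast
  let ?U = "(k, Cup b) # U" and ?V = "V @ [(Suc (Suc k), Cap)]"
  have lift: "tangle_eq st ((k, Cup b) # A @ [(Suc (Suc k), Cap)]) ((k, Cup b) # B @ [(Suc (Suc k), Cap)])"
    if "tangle_eq v A B" for A B
    using tangle_eq_append_left[of "[(k, Cup b)]" st "A @ [(Suc (Suc k), Cap)]" "B @ [(Suc (Suc k), Cap)]"]
      tangle_eq_append_right[OF that] assms(3) by (simp del: slice_step.simps)
  have "tangle_eq st [(k, Cross (c = (st ! k = st ! Suc k)))] (?U @ [(j, Cross c)] @ ?V)" for c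
  proof -
    have "(\<not> (c = (st ! k = st ! Suc k))) = (c = (v ! Suc k = v ! Suc (Suc k)))"
      using st v1 by (auto simp: nth_append)
    then have "tangle_eq st [(k, Cross (c = (st ! k = st ! Suc k)))]
       ((k, Cup b) # [(Suc k, Cross (c = (v ! Suc k = v ! Suc (Suc k))))] @ [(Suc (Suc k), Cap)])"
      using tangle_eq_rotate[OF assms(1,2), of "c = (st ! k = st ! Suc k)"] by simp
    also have "tangle_eq st \<dots> ((k, Cup b) # (U @ [(j, Cross c)] @ V) @ [(Suc (Suc k), Cap)])"
      by (rule lift[OF U(6)])
    finally show ?thesis by simp
  qed
  moreover have "tangle_eq st (smoothing st k) (?U @ ?V)"
    using tangle_eq_trans[OF tangle_eq_rotate_smoothing[OF assms(1-3)] lift[OF U(7)]] by simp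
  moreover have "run ?U st = Some u" using U(1) assms(3) by (simp del: slice_step.simps)
  ultimately show ?thesis using U(2-5) unfolding up_crossing_form_def
    by (intro exI[of _ ?U] exI[of _ j] exI[of _ ?V] exI[of _ u]) auto
qed

text \<open>
  At most three quarter turns are needed: \<open>(False, True)\<close>, \<open>(False,
  False)\<close>, \<open>(True, False)\<close>, \<open>(True, True)\<close>.
\<close>

lemma up_crossing_form:
  assumes "Suc k < length st" shows "up_crossing_form st k"
proof -
  have TT: "up_crossing_form st k" if "Suc k < length st" "st ! k" "st ! Suc k" for st k
    unfolding up_crossing_form_def
    by (intro exI[of _ "[]"] exI[of _ k] exI[of _ st]) (use that in \<open>simp add: smoothing_def\<close>)
  have step: "up_crossing_form st k"
    if "Suc k < length st" "\<And>v k'. Suc k' < length v \<Longrightarrow> v ! k' = (\<not> st ! Suc k) \<Longrightarrow> v ! Suc k' = st ! k \<Longrightarrow> up_crossing_form v k'" for st k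
  proof -
    from that(1) obtain xs a b zs where st: "st = xs @ a # b # zs" "length xs = k"
      by (rule length_ge_2_split)
    have "up_crossing_form (xs @ b # (\<not> b) # a # b # zs) (Suc k)"
      by (rule that(2)) (use st in \<open>auto simp: nth_append\<close>)
    then show ?thesis
      by (intro up_crossing_form_rotate[OF that(1) refl, of "xs @ b # (\<not> b) # a # b # zs"]) (use st in auto)
  qed
  have TF: "up_crossing_form st k" if "Suc k < length st" "st ! k" "\<not> st ! Suc k" for st k
    by (rule step[OF that(1) TT]) (use that in auto)
  have FF: "up_crossing_form st k" if "Suc k < length st" "\<not> st ! k" "\<not> st ! Suc k" for st k
    by (rule step[OF that(1) TF]) (use that in auto)
  have FT: "up_crossing_form st k" if "Suc k < length st" "\<not> st ! k" "st ! Suc k" for st k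
    by (rule step[OF that(1) FF]) (use that in auto)
  show ?thesis using TT TF FF FT assms by metis
qed

fun up_crossings :: "diagram \<Rightarrow> bool list \<Rightarrow> bool" where
  "up_crossings [] st \<longleftrightarrow> True"
| "up_crossings ((k, p) # D) st \<longleftrightarrow>
     (\<forall>c. p = Cross c \<longrightarrow> st ! k \<and> st ! Suc k) \<and> (\<forall>u. slice_step (k, p) st = Some u \<longrightarrow> up_crossings D u)"

lemma up_crossings_append:
  "up_crossings (A @ B) st \<longleftrightarrow> up_crossings A st \<and> (\<forall>u. run A st = Some u \<longrightarrow> up_crossings B u)"
  by (induction A st rule: up_crossings.induct) (auto simp: bind_eq_Some_conv simp del: slice_step.simps)

lemma up_crossings_no_crossings: "(\<forall>i c. (i, Cross c) \<notin> set A) \<Longrightarrow> up_crossings A st"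
  by (induction A st rule: up_crossings.induct) auto

lemma exists_up_crossings:
  "run D st = Some u \<Longrightarrow> \<exists>D'. tangle_eq st D D' \<and> up_crossings D' st"
proof (induction D arbitrary: st)
  case Nil
  then show ?case by (intro exI[of _ "[]"]) simp
next
  case (Cons s D)
  then obtain v where v: "slice_step s st = Some v" "run D v = Some u" by (auto simp: bind_eq_Some_conv)
  from Cons.IH[OF this(2)] obtain D' where D': "tangle_eq v D D'" "up_crossings D' v" by blast
  have "\<exists>A. tangle_eq st [s] A \<and> up_crossings A st"
  proof (cases s)
    case (Pair k p)
    show ?thesis
    proof (cases p)
      case (Cross c)
      then have k: "Suc k < length st" using v Pair by (auto split: if_splits)
      obtain U j V u where U: "run U st = Some u" "Suc j < length u" "u ! j" "u ! Suc j"
        "\<And>i c. (i, Cross c) \<notin> set (U @ V)"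
        "\<And>c. tangle_eq st [(k, Cross (c = (st ! k = st ! Suc k)))] (U @ [(j, Cross c)] @ V)"
        using up_crossing_form[OF k] unfolding up_crossing_form_def by blast
      \<comment> \<open>\<open>e\<close> tells whether the given crossing is positive\<close>
      have "\<exists>e. (e = Q) = c" for Q :: bool by (cases Q) auto
      then obtain e where e: "(e = (st ! k = st ! Suc k)) = c" by blast
      with U(6)[of e] have "tangle_eq st [s] (U @ [(j, Cross e)] @ V)"
        unfolding Pair Cross by simp
      moreover have "up_crossings (U @ [(j, Cross e)] @ V) st"
        using U(1-5) by (auto simp: up_crossings_append intro!: up_crossings_no_crossings)
      ultimately show ?thesis by blast
    qed (auto simp: Pair intro!: exI[of _ "[s]"])
  qed
  then obtain A where A: "tangle_eq st [s] A" "up_crossings A st" by blast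
  have "run A st = Some v" using A(1) v(1) by (simp add: tangle_eq_def)
  then have "up_crossings (A @ D') st" using A D' by (simp add: up_crossings_append)
  moreover have "tangle_eq st (s # D) (A @ D')"
    using tangle_eq_trans[OF tangle_eq_append_left[of "[s]" st D D'] tangle_eq_append_right[OF A(1)]] v D'
    by simp
  ultimately show ?case by blast
qed

section \<open>Sorting the strands by orientation\<close>

definition ups :: "bool list \<Rightarrow> nat" where "ups st = length (filter id st)"
definition downs :: "bool list \<Rightarrow> nat" where "downs st = length (filter Not st)"

lemma ups_downs_simps [simp]:
  "ups [] = 0" "ups (True # st) = Suc (ups st)" "ups (False # st) = ups st"
  "downs [] = 0" "downs (False # st) = Suc (downs st)" "downs (True # st) = downs st"
  by (auto simp: ups_def downs_def)

lemma ups_plus_downs: "ups st + downs st = length st"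
  by (induction st) (auto simp: ups_def downs_def)

text \<open>
  A diagram from the sorted strands, first all upward and then all downward ones, to the strands
  \<open>st\<close>. Each downward strand travels from the far right to its place above all
  others.
\<close>

fun sorting :: "bool list \<Rightarrow> diagram" where
  "sorting [] = []"
| "sorting (True # st) = shift 1 (sorting st)"
| "sorting (False # st) = pass (length st) @ shift 1 (sorting st)"

text \<open>
  Diagrams between sorted strands, with \<open>m\<close> upward and \<open>p\<close> downward ones
  at the bottom: every crossing involves two strands of the same direction, and extrema occur only
  between the two groups.
\<close>

inductive central :: "nat \<Rightarrow> nat \<Rightarrow> diagram \<Rightarrow> nat \<Rightarrow> nat \<Rightarrow> bool" where
  Nil: "central m p [] m p"
| Cross: "Suc i < m \<or> m \<le> i \<and> Suc i < m + p \<Longrightarrow> central m p W m' p' \<Longrightarrow> central m p ((i, Cross c) # W) m' p'"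
| Cup: "central (Suc m) (Suc p) W m' p' \<Longrightarrow> central m p ((m, Cup True) # W) m' p'"
| Cap: "central m p W m' p' \<Longrightarrow> central (Suc m) (Suc p) ((m, Cap) # W) m' p'"

lemma central_append:
  "central m p V m' p' \<Longrightarrow> central m' p' W m'' p'' \<Longrightarrow> central m p (V @ W) m'' p''"
  by (induction rule: central.induct) (auto intro: central.intros)

lemma central_shift: "central m p W m' p' \<Longrightarrow> central (Suc m) p (shift 1 W) (Suc m') p'"
  by (induction rule: central.induct) (auto intro: central.intros)

lemma central_extend: "central m p W m' p' \<Longrightarrow> central m (Suc p) W m' (Suc p')"
  by (induction rule: central.induct) (auto intro: central.intros)

lemma central_fit: "central m p W m' p' \<Longrightarrow> fit W (m + p) = Some (m' + p')"
  by (induction rule: central.induct) (auto simp: numeral_2_eq_2 Suc_diff_Suc)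

text \<open>
  The inverse of \<open>pass\<close>.
\<close>

fun unpass :: "nat \<Rightarrow> diagram" where
  "unpass 0 = []"
| "unpass (Suc a) = unpass a @ [(a, Cross True)]"

lemma fit_unpass: "a < n \<Longrightarrow> fit (unpass a) n = Some n"
  by (induction a) (auto simp: fit_append)

lemma unpass_pass: "a < n \<Longrightarrow> width_eq n (unpass a @ pass a) []"
proof (induction a)
  case (Suc a)
  have "width_eq n (unpass a @ [(a, Cross True), (a, Cross False)] @ pass a) (unpass a @ [] @ pass a)"
    by (rule width_eq_context[OF width_eq_R2[of a n True, simplified] fit_unpass]) (use Suc in auto)
  then show ?case using Suc by (auto intro: width_eq_trans)
qed simp

text \<open>
  A minimum whose two legs both pass over \<open>m\<close> strands can be contracted to the left
  of them.
\<close>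

lemma cup_pass:
  "m \<le> n \<Longrightarrow> width_eq n ((m, Cup b) # pass m @ shift 1 (pass m)) [(0, Cup b)]"
proof (induction m)
  case (Suc m)
  let ?F = "Cross False"
  have "width_eq n ([(Suc m, Cup b), (m, ?F)] @ (pass m @ [(Suc m + 0, ?F)]) @ shift 1 (pass m))
     ([(Suc m, Cup b), (m, ?F)] @ ([(Suc m + 0, ?F)] @ pass m) @ shift 1 (pass m))"
    by (intro width_eq_context[of "n + 2"] slice_right_commute) (use Suc.prems in \<open>auto simp: fit_pass\<close>)
  also have "width_eq n ([(Suc m, Cup b), (m, ?F)] @ [(Suc m, ?F)] @ pass m @ shift 1 (pass m))
     ([(m, Cup b), (Suc m, Cross (\<not> False))] @ [(Suc m, ?F)] @ pass m @ shift 1 (pass m))"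
    by (intro width_eq_right width_eq_slide_cup)
  then have "width_eq n ([(Suc m, Cup b), (m, ?F)] @ ([(Suc m + 0, ?F)] @ pass m) @ shift 1 (pass m))
     ([(m, Cup b)] @ [(Suc m, Cross True), (Suc m, Cross (\<not> True))] @ (pass m @ shift 1 (pass m)))" by simp
  also have "width_eq n ([(m, Cup b)] @ [(Suc m, Cross True), (Suc m, Cross (\<not> True))] @ (pass m @ shift 1 (pass m)))
     ([(m, Cup b)] @ [] @ (pass m @ shift 1 (pass m)))"
    by (rule width_eq_context[OF width_eq_R2, where m = "n + 2"]) (use Suc.prems in auto)
  also have "width_eq n ([(m, Cup b)] @ [] @ (pass m @ shift 1 (pass m))) [(0, Cup b)]"
    using Suc by simp
  finally show ?case by simp
qed simp

lemma pass_cap: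
  "Suc m < n \<Longrightarrow> width_eq n (shift 1 (pass m) @ [(0, Cap)]) (unpass m @ [(m, Cap)])"
proof (induction m)
  case (Suc m)
  let ?F = "Cross False"
  have "width_eq n ([(Suc m, ?F)] @ (shift 1 (pass m) @ [(0, Cap)])) ([(Suc m, ?F)] @ (unpass m @ [(m, Cap)]))"
    by (rule width_eq_left[of n]) (use Suc in auto)
  also have "width_eq n (([(Suc m + 0, ?F)] @ unpass m) @ [(m, Cap)]) ((unpass m @ [(Suc m + 0, ?F)]) @ [(m, Cap)])"
    by (intro width_eq_right width_eq_sym[OF slice_right_commute]) (simp add: fit_unpass)
  then have "width_eq n ([(Suc m, ?F)] @ (unpass m @ [(m, Cap)])) (unpass m @ [(Suc m, Cross (\<not> True)), (m, Cap)])" by simp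
  also have "width_eq n (unpass m @ [(Suc m, Cross (\<not> True)), (m, Cap)]) (unpass m @ [(m, Cross True), (Suc m, Cap)])"
    by (intro width_eq_append_left width_eq_sym[OF width_eq_slide_cap])
  finally show ?case by simp
qed simp

lemma central_pass: "a < m \<Longrightarrow> central m p (pass a) m p"
  by (induction a) (auto intro: central.intros)
lemma central_unpass: "a < m \<Longrightarrow> central m p (unpass a) m p"
  by (induction a) (auto intro: central_append central.intros)
lemma central_pass_down: "a < p \<Longrightarrow> central m p (shift m (pass a)) m p"
  by (induction a) (auto intro: central.intros)
lemma central_unpass_down: "a < p \<Longrightarrow> central m p (shift m (unpass a)) m p"
  by (induction a) (auto intro!: central_append[of m p _ m p] intro: central.intros)

text \<open>
  The minimum is created in the middle; its left leg moves left over the upward strands and its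
  right leg moves right over the downward ones, where it cancels against the sorting.
\<close>

lemma central_cup:
  "\<exists>W. central m p W (Suc m) (Suc p) \<and> width_eq (m + p) (W @ shift 1 (pass (m + p))) [(0, Cup True)]"
proof -
  let ?W = "(m, Cup True) # pass m @ shift (Suc m) (unpass p)"
  have "central m p ?W (Suc m) (Suc p)"
    by (intro central.Cup central_append[OF central_pass central_unpass_down]) auto
  moreover have "width_eq (m + p) (((m, Cup True) # pass m) @ shift (Suc m) (unpass p @ pass p) @ shift 1 (pass m))
     (((m, Cup True) # pass m) @ shift (Suc m) [] @ shift 1 (pass m))"
    by (rule width_eq_context[OF width_eq_shift[OF unpass_pass[of p "Suc p"]]]) (auto simp: fit_pass)
  then have "width_eq (m + p) (?W @ shift 1 (pass (m + p))) ((m, Cup True) # pass m @ shift 1 (pass m))"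
    by (simp add: pass_add)
  then have "width_eq (m + p) (?W @ shift 1 (pass (m + p))) [(0, Cup True)]"
    by (rule width_eq_trans[OF _ cup_pass]) simp
  ultimately show ?thesis by blast
qed

lemma central_cap:
  "\<exists>W. central (Suc m) (Suc p) W m p \<and> width_eq (Suc (Suc (m + p))) (shift 1 (pass (m + p)) @ [(0, Cap)]) W"
proof -
  let ?W = "shift (Suc m) (pass p) @ unpass m @ [(m, Cap)]"
  have "central (Suc m) (Suc p) ?W m p"
    by (intro central_append[OF central_pass_down] central_append[OF central_unpass] central.Cap central.Nil) auto
  moreover have "width_eq (Suc (Suc (m + p))) (shift (Suc m) (pass p) @ shift 1 (pass m) @ [(0, Cap)]) ?W"
    by (intro width_eq_append_left pass_cap)
       (use fit_shift_le[OF fit_pass[of p "Suc p"], of "Suc m" 0] in auto)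
  ultimately show ?thesis by (auto simp: pass_add)
qed

lemma sorting_slice_True:
  assumes "width_eq (length st) (sorting st @ [(k, p)]) (W @ sorting st')"
  shows "width_eq (Suc (length st)) (sorting (True # st) @ [(Suc k, p)]) (shift 1 W @ sorting (True # st'))"
  using width_eq_shift1[OF assms] by simp

text \<open>
  The leading downward strand lies above the rest of the diagram and slides across
  \<open>W\<close>, which therefore remains unchanged.
\<close>

lemma sorting_slice_False:
  assumes "width_eq (length st) (sorting st @ [(k, p)]) (W @ sorting st')" "fit W (length st) = Some (length st')"
  shows "width_eq (Suc (length st)) (sorting (False # st) @ [(Suc k, p)]) (W @ sorting (False # st'))"
proof -
  let ?n = "length st"
  have "width_eq (Suc ?n) (pass ?n @ (shift 1 (sorting st @ [(k, p)]))) (pass ?n @ (shift 1 (W @ sorting st')))"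
    by (rule width_eq_left[OF width_eq_shift1[OF assms(1)]]) (simp add: fit_pass)
  also have "width_eq (Suc ?n) ((pass ?n @ shift 1 W) @ shift 1 (sorting st')) ((W @ pass (length st')) @ shift 1 (sorting st'))"
    by (intro width_eq_right pass_natural assms(2)) auto
  then have "width_eq (Suc ?n) (pass ?n @ (shift 1 (W @ sorting st'))) ((W @ pass (length st')) @ shift 1 (sorting st'))" by simp
  finally show ?thesis by simp
qed

text \<open>
  The number \<open>i\<close> of the crossing depends on neither its sign nor on what lies above,
  so that the diagrams of a Conway triple keep differing in one crossing only.
\<close>

lemma sorting_crossing:
  assumes "Suc k < length st" "st ! k" "st ! Suc k"
  shows "\<exists>i. Suc i < ups st \<and> (\<forall>c. width_eq (length st) (sorting st @ [(k, Cross c)]) ((i, Cross c) # sorting st))"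
  using assms
proof (induction st arbitrary: k)
  case (Cons x st)
  show ?case
  proof (cases k)
    case 0
    with Cons.prems obtain st0 where st: "x # st = True # True # st0" by (cases st) auto
    have "width_eq (length (x # st)) (sorting (x # st) @ [(k, Cross c)]) ((0, Cross c) # sorting (x # st))" for c
      using width_eq_sym[OF disjoint_commute[of "[(0, Cross c)]" 2 2 _ "sorting st0"]] by (simp add: st 0 numeral_2_eq_2)
    then show ?thesis using st by (intro exI[of _ 0]) auto
  next
    case (Suc k')
    with Cons obtain i where i: "Suc i < ups st"
      "\<And>c. width_eq (length st) (sorting st @ [(k', Cross c)]) ([(i, Cross c)] @ sorting st)" by fastforce
    show ?thesis
    proof (cases x)
      case True
      then show ?thesis using sorting_slice_True[OF i(2)] i(1) Suc by (intro exI[of _ "Suc i"]) auto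
    next
      case False
      have "fit [(i, Cross c)] (length st) = Some (length st)" for c
        using i(1) ups_plus_downs[of st] by auto
      then show ?thesis using sorting_slice_False[OF i(2)] i(1) Suc False by (intro exI[of _ "i"]) auto
    qed
  qed
qed simp

text \<open>
  Only slices at position \<open>0\<close> need work. Slices further right are reduced to them by
  removing the first strand, which is disjoint from the slice if it is upward and lies above it if
  it is downward.
\<close>

lemma sorting_slice:
  assumes "slice_step (k, p) st = Some st'" "\<And>c. p = Cross c \<Longrightarrow> st ! k \<and> st ! Suc k"
  shows "\<exists>W. central (ups st) (downs st) W (ups st') (downs st') \<and>
    width_eq (length st) (sorting st @ [(k, p)]) (W @ sorting st')"
  using assms
proof (induction k arbitrary: st st')
  case 0
  show ?case
  proof (cases p)
    case (Cross c)
    with 0 have k: "Suc 0 < length st" "st ! 0" "st ! Suc 0" by (auto split: if_splits)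
    from sorting_crossing[OF this] obtain i where i: "Suc i < ups st"
      "width_eq (length st) (sorting st @ [(0, Cross c)]) ([(i, Cross c)] @ sorting st)" by auto
    have "st' = st" using 0 Cross k 
      by (cases st; cases "tl st") (auto simp: numeral_2_eq_2)
    then show ?thesis using i Cross by (intro exI[of _ "[(i, Cross c)]"]) (auto intro: central.intros)
  next
    case (Cup b)
    let ?m = "ups st" and ?p = "downs st"
    have st': "st' = b # (\<not> b) # st" using 0 Cup by simp
    obtain W where W: "central ?m ?p W (Suc ?m) (Suc ?p)" "width_eq (length st) (W @ shift 1 (pass (length st))) [(0, Cup True)]"
      using central_cup[of ?m ?p] by (auto simp: ups_plus_downs)
    have 1: "width_eq (length st) (sorting st @ [(0, Cup b)]) ([(0, Cup b)] @ shift 2 (sorting st))"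
      using width_eq_sym[OF disjoint_commute[of "[(0, Cup b)]" 0 2 _ "sorting st"]] by simp
    have "width_eq (length st) ([(0, Cup b)] @ shift 2 (sorting st)) (W @ sorting st')"
    proof (cases b)
      case True
      have "width_eq (length st) ([(0, Cup b)] @ shift 2 (sorting st)) ((W @ shift 1 (pass (length st))) @ shift 2 (sorting st))"
        using width_eq_right[OF width_eq_sym[OF W(2)]] True by simp
      then show ?thesis by (simp add: st' True numeral_2_eq_2)
    next
      case False
      have "width_eq (length st) ([(0, Cup (\<not> True))] @ shift 2 (sorting st)) ([(0, Cup True), (0, Cross False)] @ shift 2 (sorting st))"
        by (rule width_eq_right[OF width_eq_sym[OF width_eq_R1_cup]])
      also have "width_eq (length st) ([(0, Cup True)] @ (0, Cross False) # shift 2 (sorting st))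
         ((W @ shift 1 (pass (length st))) @ (0, Cross False) # shift 2 (sorting st))"
        by (rule width_eq_right[OF width_eq_sym[OF W(2)]])
      then have "width_eq (length st) ([(0, Cup True), (0, Cross False)] @ shift 2 (sorting st))
         ((W @ shift 1 (pass (length st))) @ (0, Cross False) # shift 2 (sorting st))" by simp
      finally show ?thesis using False pass_add[of 1 "length st"] by (simp add: st' numeral_2_eq_2)
    qed
    with 1 W(1) show ?thesis using Cup st' by (cases b) (auto intro: width_eq_trans)
  next
    case Cap
    with 0 obtain b where st: "st = b # (\<not> b) # st'"
      by (cases st; cases "tl st") (auto split: if_splits simp: numeral_2_eq_2)
    let ?m = "ups st'" and ?p = "downs st'"
    obtain W where W: "central (Suc ?m) (Suc ?p) W ?m ?p" "width_eq (length st) (shift 1 (pass (length st')) @ [(0, Cap)]) W"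
      using central_cap[of ?m ?p] st by (auto simp: ups_plus_downs)
    have 1: "width_eq n (shift 2 (sorting st') @ [(0, Cap)]) ([(0, Cap)] @ sorting st')" for n
      using width_eq_sym[OF disjoint_commute[of "[(0, Cap)]" 2 0 _ "sorting st'"]] by simp
    have 2: "width_eq (length st) (shift 1 (pass (length st')) @ [(0, Cap)] @ sorting st') (W @ sorting st')"
      using width_eq_right[OF W(2)] by simp
    have "width_eq (length st) (sorting st @ [(0, Cap)]) (shift 1 (pass (length st')) @ [(0, Cap)] @ sorting st')"
    proof (cases b)
      case True
      then show ?thesis using width_eq_append_left[OF 1, where P = "shift 1 (pass (length st'))" and n = "length st"] 
        by (simp add: st numeral_2_eq_2)
    next
      case False
      have "width_eq (length st) ((shift 1 (pass (length st')) @ [(0, Cross False)]) @ shift 2 (sorting st') @ [(0, Cap)])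
        ((shift 1 (pass (length st')) @ [(0, Cross False)]) @ [(0, Cap)] @ sorting st')"
        by (rule width_eq_append_left[OF 1])
      also have "width_eq (length st) (shift 1 (pass (length st')) @ [(0, Cross False), (0, Cap)] @ sorting st')
         (shift 1 (pass (length st')) @ [(0, Cap)] @ sorting st')"
        by (intro width_eq_append_left width_eq_right width_eq_R1_cap)
      then have "width_eq (length st) ((shift 1 (pass (length st')) @ [(0, Cross False)]) @ [(0, Cap)] @ sorting st')
         (shift 1 (pass (length st')) @ [(0, Cap)] @ sorting st')" by simp
      finally show ?thesis using False pass_add[of 1 "length st'"] by (simp add: st numeral_2_eq_2)
    qed
    with 2 W(1) show ?thesis using Cap st by (cases b) (auto intro: width_eq_trans)
  qed
next
  case (Suc k)
  obtain x st0 where st: "st = x # st0" using Suc.prems(1) by (cases st; cases p) auto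
  from Suc.prems(1) obtain st0' where st': "st' = x # st0'" "slice_step (k, p) st0 = Some st0'"
    by (auto simp: st slice_step_shift simp del: slice_step.simps)
  have "st0 ! k \<and> st0 ! Suc k" if "p = Cross c" for c using Suc.prems(2)[OF that] st by simp
  then obtain W where W: "central (ups st0) (downs st0) W (ups st0') (downs st0')"
    "width_eq (length st0) (sorting st0 @ [(k, p)]) (W @ sorting st0')" using Suc.IH[OF st'(2)] by blast
  show ?case
  proof (cases x)
    case True
    then show ?thesis using sorting_slice_True[OF W(2)] central_shift[OF W(1)] st st'(1) by auto
  next
    case False
    then show ?thesis using sorting_slice_False[OF W(2)] central_fit[OF W(1)] central_extend[OF W(1)] st st'(1) 
      by (auto simp: ups_plus_downs)
  qed
qed

lemma sorting_diagram:
  assumes "run D st = Some st'" "up_crossings D st"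
  shows "\<exists>W. central (ups st) (downs st) W (ups st') (downs st') \<and>
    width_eq (length st) (sorting st @ D) (W @ sorting st')"
  using assms
proof (induction D arbitrary: st)
  case Nil
  then show ?case by (intro exI[of _ "[]"]) (auto intro: central.intros)
next
  case (Cons s D)
  obtain k p where s: "s = (k, p)" by force
  from Cons.prems obtain v where v: "slice_step (k, p) st = Some v" "run D v = Some st'" "up_crossings D v"
    by (auto simp: s bind_eq_Some_conv)
  from sorting_slice[OF v(1)] Cons.prems obtain W where W: "central (ups st) (downs st) W (ups v) (downs v)"
    "width_eq (length st) (sorting st @ [(k, p)]) (W @ sorting v)" by (auto simp: s)
  from Cons.IH[OF v(2,3)] obtain V where V: "central (ups v) (downs v) V (ups st') (downs st')"
    "width_eq (length v) (sorting v @ D) (V @ sorting st')" by blast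
  have "width_eq (length st) ((sorting st @ [(k, p)]) @ D) ((W @ sorting v) @ D)"
    by (rule width_eq_right[OF W(2)])
  also have "width_eq (length st) (W @ sorting v @ D) (W @ V @ sorting st')"
    by (rule width_eq_left[OF V(2)]) (use central_fit[OF W(1)] in \<open>simp add: ups_plus_downs\<close>)
  then have "width_eq (length st) ((W @ sorting v) @ D) (W @ V @ sorting st')" by simp
  finally show ?case using central_append[OF W(1) V(1)] by (auto simp: s)
qed

section \<open>Partially closed braids and Alexander's theorem\<close>

definition cups :: "nat \<Rightarrow> diagram" where "cups N = map (\<lambda>i. (i, Cup True)) [0..<N]"
definition caps :: "nat \<Rightarrow> nat \<Rightarrow> diagram" where "caps m N = map (\<lambda>i. (i, Cap)) (rev [m..<N])"
definition crossings :: "braid_word \<Rightarrow> diagram" where "crossings = map (\<lambda>(i, b). (i, Cross b))"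

lemma crossings_simps [simp]:
  "crossings [] = []" "crossings ((i, b) # w) = (i, Cross b) # crossings w"
  "crossings (v @ w) = crossings v @ crossings w"
  by (auto simp: crossings_def)

lemma closure_diagram_eq: "closure_diagram n w = cups n @ crossings w @ caps 0 n"
  by (simp add: closure_diagram_def cups_def caps_def crossings_def)

lemma braid_word_simps [simp]:
  "braid_word n []" "braid_word n ((i, b) # w) \<longleftrightarrow> Suc i < n \<and> braid_word n w"
  "braid_word n (v @ w) \<longleftrightarrow> braid_word n v \<and> braid_word n w"
  by (auto simp: braid_word_def)

lemma braid_word_mono: "braid_word n w \<Longrightarrow> n \<le> m \<Longrightarrow> braid_word m w"
  by (auto simp: braid_word_def)

lemma cups_0 [simp]: "cups 0 = []" and cups_Suc: "cups (Suc N) = cups N @ [(N, Cup True)]"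
  by (auto simp: cups_def)

lemma cups_add: "cups (M + N) = cups M @ shift M (cups N)"
  by (induction N) (auto simp: cups_Suc)

lemma caps_same [simp]: "caps m m = []" by (simp add: caps_def)
lemma caps_Suc: "m < N \<Longrightarrow> caps m N = caps (Suc m) N @ [(m, Cap)]"
  by (simp add: caps_def upt_rec[of m])
lemma caps_add: "m \<le> k \<Longrightarrow> k \<le> N \<Longrightarrow> caps m N = caps k N @ caps m k"
  using upt_add_eq_append[of m k "N - k"] by (simp add: caps_def)
lemma caps_0_Suc: "caps 0 (Suc n) = (n, Cap) # caps 0 n" by (simp add: caps_def)
lemma caps_shift: "caps (m + k) (N + k) = shift k (caps m N)"
proof -
  have "[m + k..<N + k] = map (\<lambda>i. i + k) [m..<N]" by (rule nth_equalityI) auto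
  then show ?thesis by (simp add: caps_def shift_def rev_map comp_def)
qed

lemma fit_cups: "fit (cups N) n = Some (n + 2 * N)"
proof (induction N)
  case (Suc N)
  then show ?case by (simp add: cups_Suc fit_append)
qed simp

lemma fit_crossings: "braid_word n w \<Longrightarrow> n \<le> r \<Longrightarrow> fit (crossings w) r = Some r"
  by (induction w) (auto simp: numeral_2_eq_2 Suc_diff_Suc)

lemma fit_caps: "m \<le> N \<Longrightarrow> fit (caps m N) (2 * N - m) = Some m"
proof (induction "N - m" arbitrary: m)
  case (Suc d)
  then have "m < N" "fit (caps (Suc m) N) (2 * N - Suc m) = Some (Suc m)" by simp_all
  then have "fit (caps (Suc m) N) (2 * N - Suc m + 1) = Some (Suc m + 1)" by (intro fit_mono)
  moreover have "2 * N - Suc m + 1 = 2 * N - m" using \<open>m < N\<close> by simp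
  ultimately have "fit (caps (Suc m) N) (2 * N - m) = Some (Suc m + 1)" by metis
  then show ?case using \<open>m < N\<close> by (simp add: caps_Suc fit_append)
qed simp

lemma fit_cups_crossings: "braid_word N w \<Longrightarrow> fit (cups N @ crossings w) 0 = Some (2 * N)"
  using fit_crossings[of N w "2 * N"] by (simp add: fit_append fit_cups)

lemma fit_closure: "braid_word N w \<Longrightarrow> fit (closure_diagram N w) 0 = Some 0"
  using fit_cups_crossings[of N w] fit_caps[of 0 N]
  unfolding closure_diagram_eq append_assoc[symmetric] fit_append[of "_ @ _"] by simp

lemma run_cups: "run (cups N) [] = Some (replicate N True @ replicate N False)"
proof (induction N)
  case (Suc N)
  then show ?case by (simp add: cups_Suc run_append replicate_append_same[symmetric])
qed simp

lemma run_crossings: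
  "braid_word N w \<Longrightarrow> run (crossings w) (replicate N True @ st) = Some (replicate N True @ st)"
proof (induction w)
  case (Cons a w)
  obtain i b where a: "a = (i, b)" by force
  with Cons.prems have i: "Suc i < N" by simp
  then have "replicate N True @ st = replicate i True @ [True, True] @ (replicate (N - i - 2) True @ st)"
    by (metis (no_types, lifting) add_2_eq_Suc' add_diff_cancel_left' append.assoc append_Cons append_Nil diff_diff_left le_add_diff_inverse less_eq_Suc_le replicate_Suc replicate_add replicate_empty numeral_2_eq_2)
  then have "slice_step (i, Cross b) (replicate N True @ st) = Some (replicate N True @ st)"
    using slice_step_split[of "replicate i True" i "[True, True]" "Cross b"] by simp
  then show ?case using Cons by (simp add: a del: slice_step.simps)
qed simp

lemma run_caps: "m \<le> N \<Longrightarrow> run (caps m N) (replicate N True @ replicate N False) = Some (replicate m True @ replicate m False)"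
proof (induction "N - m" arbitrary: m)
  case (Suc d)
  then have m: "m < N" "run (caps (Suc m) N) (replicate N True @ replicate N False) = Some (replicate (Suc m) True @ replicate (Suc m) False)" by simp_all
  have "replicate (Suc m) True @ replicate (Suc m) False = replicate m True @ [True, False] @ replicate m False"
    by (simp add: replicate_append_same)
  then have "slice_step (m, Cap) (replicate (Suc m) True @ replicate (Suc m) False) = Some (replicate m True @ replicate m False)"
    using slice_step_split[of "replicate m True" m "[True, False]" Cap] by simp
  then show ?case using m by (simp add: caps_Suc run_append del: slice_step.simps replicate_Suc)
qed simp

lemma link_diagram_closure: "braid_word N w \<Longrightarrow> link_diagram (closure_diagram N w)"
  using run_caps[of 0 N] by (simp add: link_diagram_def closure_diagram_eq run_append run_cups run_crossings)

text \<open>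
  The right legs of two nested minima cross: sliding the crossing through both minima makes it a
  crossing of the left legs.
\<close>

lemma cups_down_crossing:
  assumes "r + 2 \<le> N"
  shows "width_eq 0 (cups N @ [(N + r, Cross c)]) (cups N @ [(N - 2 - r, Cross c)])"
proof -
  define i where "i = N - 2 - r"
  have N: "N = i + 2 + r" using assms by (simp add: i_def)
  let ?S = "shift (i + 2) (cups r)" and ?C = "[(i, Cup True), (Suc i, Cup True)] :: diagram"
  have cN: "cups N = cups i @ ?C @ ?S"
    using cups_add[of "i + 2" r] by (simp add: N cups_Suc)
  have fit_S: "fit ?S (i + 2) = Some (i + 2 + 2 * r)"
    using fit_shift_le[OF fit_cups[of r 0], of "i + 2" 0] by simp
  have "width_eq 0 ((cups i @ ?C) @ (?S @ [(i + 2 + 2 * r + 0, Cross c)])) ((cups i @ ?C) @ ([(i + 2 + 0, Cross c)] @ ?S))"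
    by (intro width_eq_append_left slice_right_commute fit_S)
  also have "width_eq 0 (cups i @ [(i, Cup True), (Suc i, Cup True), (i + 2, Cross c)] @ ?S)
      (cups i @ [(i, Cup True), (Suc i, Cup True), (i, Cross c)] @ ?S)"
  proof (intro width_eq_append_left width_eq_right)
    fix n
    have slide: "width_eq l [(Suc i, Cup True), (i + 2, Cross c)] [(i + 2, Cup True), (Suc i, Cross (\<not> c))]" for l
      using width_eq_sym[OF width_eq_slide_cup[of l "Suc i" True "\<not> c"]] by simp
    have "width_eq n ([(i, Cup True)] @ [(Suc i, Cup True), (i + 2, Cross c)]) ([(i, Cup True)] @ [(i + 2, Cup True), (Suc i, Cross (\<not> c))])"
      by (intro width_eq_append_left slide)
    also have "width_eq n ([(i, Cup True), (i + 2 + 0, Cup True)] @ [(Suc i, Cross (\<not> c))]) ([(i + 0, Cup True), (i, Cup True)] @ [(Suc i, Cross (\<not> c))])"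
      using width_eq_right[OF width_eq_height[of n i "Cup True" 0 "Cup True"]] by simp
    then have "width_eq n ([(i, Cup True)] @ [(i + 2, Cup True), (Suc i, Cross (\<not> c))]) ([(i, Cup True)] @ [(i, Cup True), (Suc i, Cross (\<not> c))])" by simp
    also have "width_eq n ([(i, Cup True)] @ [(i, Cup True), (Suc i, Cross (\<not> c))]) ([(i, Cup True)] @ [(Suc i, Cup True), (i, Cross c)])"
      by (intro width_eq_append_left width_eq_sym[OF width_eq_slide_cup])
    finally show "width_eq n [(i, Cup True), (Suc i, Cup True), (i + 2, Cross c)] [(i, Cup True), (Suc i, Cup True), (i, Cross c)]" by simp
  qed
  then have "width_eq 0 ((cups i @ ?C) @ ([(i + 2 + 0, Cross c)] @ ?S)) ((cups i @ ?C) @ ([(i, Cross c)] @ ?S))" by simp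
  also have "width_eq 0 ((cups i @ ?C) @ ([(i, Cross c)] @ ?S)) ((cups i @ ?C) @ (?S @ [(i, Cross c)]))"
  proof (intro width_eq_append_left)
    fix n
    show "width_eq n ([(i, Cross c)] @ ?S) (?S @ [(i, Cross c)])"
      by (rule disjoint_commute[of _ "i + 2" "i + 2"]) simp
  qed
  finally have "width_eq 0 (cups N @ [(i + 2 + 2 * r, Cross c)]) (cups N @ [(i, Cross c)])"
    unfolding cN by simp
  moreover have "i + 2 + 2 * r = N + r" using N by simp
  ultimately show ?thesis by (simp only: i_def)
qed

lemma caps_down_crossing:
  assumes "r + 2 \<le> N"
  shows "width_eq n ([(N + r, Cross c)] @ caps 0 N) ([(N - 2 - r, Cross c)] @ caps 0 N)"
proof -
  define i where "i = N - 2 - r"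
  have N: "N = i + 2 + r" using assms by (simp add: i_def)
  let ?S = "shift (i + 2) (caps 0 r)" and ?C = "[(Suc i, Cap), (i, Cap)] :: diagram"
  have cN: "caps 0 N = ?S @ ?C @ caps 0 i"
    using caps_add[of 0 "i + 2" N] caps_shift[of 0 "i + 2" r] by (simp add: N add.commute caps_0_Suc)
  have fit_S: "fit ?S (i + 2 + 2 * r) = Some (i + 2)"
    using fit_shift_le[OF fit_caps[of 0 r], of "i + 2" 0] by simp
  have "width_eq n (([(i + 2 + 2 * r + 0, Cross c)] @ ?S) @ (?C @ caps 0 i)) ((?S @ [(i + 2 + 0, Cross c)]) @ (?C @ caps 0 i))"
    by (intro width_eq_right width_eq_sym[OF slice_right_commute] fit_S)
  also have "width_eq n (?S @ [(i + 2, Cross c), (Suc i, Cap), (i, Cap)] @ caps 0 i)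
      (?S @ [(i, Cross c), (Suc i, Cap), (i, Cap)] @ caps 0 i)"
  proof (intro width_eq_append_left width_eq_right)
    fix n
    have "width_eq n ([(i + 2, Cross c), (Suc i, Cap)] @ [(i, Cap)]) ([(Suc i, Cross (\<not> c)), (i + 2, Cap)] @ [(i, Cap)])"
      using width_eq_right[OF width_eq_sym[OF width_eq_slide_cap[of n "Suc i" "\<not> c"]]] by simp
    also have "width_eq n ([(Suc i, Cross (\<not> c))] @ [(i + 2 + 0, Cap), (i, Cap)]) ([(Suc i, Cross (\<not> c))] @ [(i, Cap), (i + 0, Cap)])"
      using width_eq_append_left[OF width_eq_sym[OF width_eq_height[of _ i Cap 0 Cap]], where P = "[(Suc i, Cross (\<not> c))]"] by simp
    then have "width_eq n ([(Suc i, Cross (\<not> c)), (i + 2, Cap)] @ [(i, Cap)]) ([(Suc i, Cross (\<not> c)), (i, Cap)] @ [(i, Cap)])" by simp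
    also have "width_eq n ([(Suc i, Cross (\<not> c)), (i, Cap)] @ [(i, Cap)]) ([(i, Cross c), (Suc i, Cap)] @ [(i, Cap)])"
      by (intro width_eq_right width_eq_sym[OF width_eq_slide_cap])
    finally show "width_eq n [(i + 2, Cross c), (Suc i, Cap), (i, Cap)] [(i, Cross c), (Suc i, Cap), (i, Cap)]" by simp
  qed
  then have "width_eq n ((?S @ [(i + 2 + 0, Cross c)]) @ (?C @ caps 0 i)) ((?S @ [(i, Cross c)]) @ (?C @ caps 0 i))" by simp
  also have "width_eq n ((?S @ [(i, Cross c)]) @ (?C @ caps 0 i)) (([(i, Cross c)] @ ?S) @ (?C @ caps 0 i))"
    by (intro width_eq_right width_eq_sym[OF disjoint_commute[of _ "i + 2" "i + 2"]]) simp
  finally have "width_eq n ([(i + 2 + 2 * r, Cross c)] @ caps 0 N) ([(i, Cross c)] @ caps 0 N)"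
    unfolding cN by simp
  moreover have "i + 2 + 2 * r = N + r" using N by simp
  ultimately show ?thesis by (simp only: i_def)
qed

text \<open>
  The first crossing of the braid travels around the closure: through the minima to the downward
  strands, up along these, and through the maxima.
\<close>

lemma closure_cycle_letter:
  assumes "braid_word N w" "Suc i < N"
  shows "width_eq 0 (closure_diagram N ((i, c) # w)) (closure_diagram N (w @ [(i, c)]))"
proof -
  define r where "r = N - 2 - i"
  have r: "r + 2 \<le> N" "N - 2 - r = i" using assms(2) by (auto simp: r_def)
  have "width_eq 0 ((cups N @ [(i, Cross c)]) @ crossings w @ caps 0 N) ((cups N @ [(N + r, Cross c)]) @ crossings w @ caps 0 N)"
    using width_eq_right[OF width_eq_sym[OF cups_down_crossing[OF r(1)]]] r(2) by simp
  also have "width_eq 0 (cups N @ ([(N + r, Cross c)] @ crossings w) @ caps 0 N) (cups N @ (crossings w @ [(N + r, Cross c)]) @ caps 0 N)"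
    by (intro width_eq_append_left width_eq_right width_eq_sym[OF slice_right_commute] fit_crossings[where n = N] assms) simp
  then have "width_eq 0 ((cups N @ [(N + r, Cross c)]) @ crossings w @ caps 0 N) ((cups N @ crossings w) @ [(N + r, Cross c)] @ caps 0 N)" by simp
  also have "width_eq 0 ((cups N @ crossings w) @ [(N + r, Cross c)] @ caps 0 N) ((cups N @ crossings w) @ [(i, Cross c)] @ caps 0 N)"
    using width_eq_append_left[OF caps_down_crossing[OF r(1)], where n = 0 and P = "cups N @ crossings w"] r(2) by simp
  finally show ?thesis by (simp add: closure_diagram_eq)
qed

lemma closure_cycle:
  "braid_word N (v @ w) \<Longrightarrow> width_eq 0 (closure_diagram N (v @ w)) (closure_diagram N (w @ v))"
proof (induction v arbitrary: w)
  case (Cons a v)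
  obtain i c where a: "a = (i, c)" by force
  have "width_eq 0 (closure_diagram N (a # v @ w)) (closure_diagram N (v @ w @ [a]))"
    using closure_cycle_letter[of N "v @ w" i c] Cons.prems by (simp add: a)
  also have "width_eq 0 \<dots> (closure_diagram N ((w @ [a]) @ v))"
    by (rule Cons.IH) (use Cons.prems a in auto)
  finally show ?case by simp
qed simp

text \<open>
  A braid on \<open>N\<close> strands of which the innermost \<open>N - m\<close> are closed.
\<close>

definition partial_closure :: "nat \<Rightarrow> braid_word \<Rightarrow> nat \<Rightarrow> diagram" where
  "partial_closure N w m = cups N @ crossings w @ caps m N"

lemma fit_partial_closure:
  assumes "m \<le> N" "braid_word N w" shows "fit (partial_closure N w m) 0 = Some (m + m)"
proof -
  have "fit (caps m N) (2 * N - m + m) = Some (m + m)"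
    by (rule fit_mono) (use assms(1) fit_caps in auto)
  then show ?thesis
    using assms fit_cups_crossings[OF assms(2)]
    unfolding partial_closure_def append_assoc[symmetric] fit_append[of "_ @ _"] by simp
qed

lemma partial_closure_0: "partial_closure N w 0 = closure_diagram N w"
  by (simp add: partial_closure_def closure_diagram_eq)

lemma partial_closure_up_crossing:
  assumes "Suc i < m" "m \<le> N"
  shows "width_eq 0 (partial_closure N w m @ [(i, Cross c)]) (partial_closure N (w @ [(i, c)]) m)"
proof -
  have "caps m N = shift m (caps 0 (N - m))" using caps_shift[of 0 m "N - m"] assms by simp
  moreover have "m - Suc (Suc i) + Suc (Suc i) = m" using assms by arith
  ultimately have c: "caps m N = shift (Suc (Suc i)) (shift (m - Suc (Suc i)) (caps 0 (N - m)))"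
    by (simp only: shift_shift)
  have "width_eq n (caps m N @ [(i, Cross c)]) ([(i, Cross c)] @ caps m N)" for n
    unfolding c by (intro width_eq_sym[OF disjoint_commute]) simp
  then have "width_eq 0 ((cups N @ crossings w) @ caps m N @ [(i, Cross c)]) ((cups N @ crossings w) @ [(i, Cross c)] @ caps m N)"
    by (intro width_eq_append_left)
  then show ?thesis by (simp add: partial_closure_def)
qed

text \<open>
  A crossing of downward strands slides down past the braid and through the minima; it becomes the
  first letter of the braid.
\<close>

lemma partial_closure_down_crossing:
  assumes "j + 2 \<le> m" "m \<le> N" "braid_word N w"
  shows "width_eq 0 (partial_closure N w m @ [(m + j, Cross c)]) (partial_closure N ((m - 2 - j, c) # w) m)"
proof -
  have "width_eq 0 ((cups N @ crossings w) @ (caps m N @ [(m + j, Cross c)])) ((cups N @ crossings w) @ ([((2 * N - m) + j, Cross c)] @ caps m N))"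
    by (intro width_eq_append_left slice_right_commute fit_caps assms)
  also have "width_eq 0 (cups N @ (crossings w @ [(N + (N - m + j), Cross c)]) @ caps m N) (cups N @ ([(N + (N - m + j), Cross c)] @ crossings w) @ caps m N)"
    by (intro width_eq_append_left width_eq_right slice_right_commute fit_crossings[where n = N] assms) simp
  then have "width_eq 0 ((cups N @ crossings w) @ ([((2 * N - m) + j, Cross c)] @ caps m N)) ((cups N @ [(N + (N - m + j), Cross c)]) @ crossings w @ caps m N)"
    using assms by (simp add: numeral_2_eq_2 add.assoc)
  also have "width_eq 0 ((cups N @ [(N + (N - m + j), Cross c)]) @ crossings w @ caps m N) ((cups N @ [(N - 2 - (N - m + j), Cross c)]) @ crossings w @ caps m N)"
    by (intro width_eq_right cups_down_crossing) (use assms in simp)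
  moreover have "N - 2 - (N - m + j) = m - 2 - j" using assms by simp
  ultimately show ?thesis by (auto simp: partial_closure_def intro: width_eq_trans)
qed

lemma partial_closure_cap:
  "m < N \<Longrightarrow> partial_closure N w (Suc m) @ [(m, Cap)] = partial_closure N w m"
  by (simp add: partial_closure_def caps_Suc)

text \<open>
  The minimum is pulled down in front of the maximum.
\<close>

lemma cap_cup:
  assumes "Suc m < n"
  shows "width_eq n [(m, Cap), (m, Cup b)] [(Suc m, Cup b), (m, Cross False), (m + 2, Cross True), (Suc m, Cap)]"
proof -
  have "width_eq n [(m, Cap), (m, Cup b)] [(m + 2, Cup b), (m, Cap)]"
    using width_eq_height[of n m Cap 0 "Cup b"] by simp
  also have "width_eq n ([(m + 2, Cup b)] @ [(m, Cap)]) ([(m + 2, Cup b)] @ [(Suc m, Cross False), (m, Cross False), (Suc m, Cap)])"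
    by (rule width_eq_left[of "n + 2"])
       (use assms width_eq_sym[OF pass_slice[of m Cap "n + 2"]] in \<open>auto simp: numeral_2_eq_2\<close>)
  then have "width_eq n [(m + 2, Cup b), (m, Cap)] ([(m + 2, Cup b), (Suc m, Cross False)] @ [(m, Cross False), (Suc m, Cap)])" by simp
  also have "width_eq n ([(m + 2, Cup b), (Suc m, Cross False)] @ [(m, Cross False), (Suc m, Cap)]) ([(Suc m, Cup b), (m + 2, Cross True)] @ [(m, Cross False), (Suc m, Cap)])"
    using width_eq_right[OF width_eq_slide_cup[of n "Suc m" b False]] by simp
  also have "width_eq n ([(Suc m, Cup b)] @ ([(m + 2 + 0, Cross True), (m, Cross False)]) @ [(Suc m, Cap)]) ([(Suc m, Cup b)] @ ([(m, Cross False), (m + 2 + 0, Cross True)]) @ [(Suc m, Cap)])"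
    using width_eq_sym[OF width_eq_height[of "n + 2" m "Cross False" 0 "Cross True"]]
    by (intro width_eq_append_left width_eq_right) (use width_eq_sym[OF width_eq_height[of _ m "Cross False" 0 "Cross True"]] in simp)
  then have "width_eq n ([(Suc m, Cup b), (m + 2, Cross True)] @ [(m, Cross False), (Suc m, Cap)]) [(Suc m, Cup b), (m, Cross False), (m + 2, Cross True), (Suc m, Cap)]" by simp
  finally show ?thesis .
qed

text \<open>
  The braid grows by words \<open>\<alpha>\<close> and \<open>\<beta>\<close> that do not depend
  on \<open>w\<close>. Thus diagrams that differ in one letter of \<open>w\<close>, as in a Conway
  triple, are closed by the same isotopy.
\<close>

definition absorbs :: "nat \<Rightarrow> nat \<Rightarrow> diagram \<Rightarrow> nat \<Rightarrow> bool" where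
  "absorbs N m W m' \<longleftrightarrow> (\<exists>N' \<alpha> \<beta>. N \<le> N' \<and> m' \<le> N' \<and> braid_word N' \<alpha> \<and> braid_word N' \<beta> \<and>
     (\<forall>w. braid_word N w \<longrightarrow> width_eq 0 (partial_closure N w m @ W) (partial_closure N' (\<alpha> @ w @ \<beta>) m')))"

lemma absorbs_append:
  assumes "absorbs N m V m'" "\<And>N. m' \<le> N \<Longrightarrow> absorbs N m' W m''"
  shows "absorbs N m (V @ W) m''"
proof -
  from assms(1) obtain N1 \<alpha> \<beta> where 1: "N \<le> N1" "m' \<le> N1" "braid_word N1 \<alpha>" "braid_word N1 \<beta>"
    "\<And>w. braid_word N w \<Longrightarrow> width_eq 0 (partial_closure N w m @ V) (partial_closure N1 (\<alpha> @ w @ \<beta>) m')"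
    unfolding absorbs_def by blast
  from assms(2)[OF 1(2)] obtain N2 \<gamma> \<delta> where 2: "N1 \<le> N2" "m'' \<le> N2" "braid_word N2 \<gamma>" "braid_word N2 \<delta>"
    "\<And>w. braid_word N1 w \<Longrightarrow> width_eq 0 (partial_closure N1 w m' @ W) (partial_closure N2 (\<gamma> @ w @ \<delta>) m'')"
    unfolding absorbs_def by blast
  have "width_eq 0 (partial_closure N w m @ V @ W) (partial_closure N2 ((\<gamma> @ \<alpha>) @ w @ (\<beta> @ \<delta>)) m'')" if "braid_word N w" for w
    using width_eq_trans[OF width_eq_right[OF 1(5)[OF that], of W] 2(5)[of "\<alpha> @ w @ \<beta>"]] 1 that
    by (simp add: braid_word_mono)
  then show ?thesis unfolding absorbs_def using 1 2
    by (intro exI[of _ N2] exI[of _ "\<gamma> @ \<alpha>"] exI[of _ "\<beta> @ \<delta>"]) (auto intro: braid_word_mono)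
qed

lemma absorbs_crossing:
  assumes "Suc i < m \<or> m \<le> i \<and> Suc i < m + m" "m \<le> N"
  shows "absorbs N m [(i, Cross c)] m"
  using assms(1)
proof
  assume "Suc i < m"
  then show ?thesis unfolding absorbs_def
    using assms(2) partial_closure_up_crossing[of i m N]
    by (intro exI[of _ N] exI[of _ "[]"] exI[of _ "[(i, c)]"]) auto
next
  assume i: "m \<le> i \<and> Suc i < m + m"
  have "width_eq 0 (partial_closure N w m @ [(m + (i - m), Cross c)]) (partial_closure N ((m - 2 - (i - m), c) # w) m)"
    if "braid_word N w" for w
    by (rule partial_closure_down_crossing) (use i assms(2) that in auto)
  then show ?thesis unfolding absorbs_def
    using assms(2) i
    by (intro exI[of _ N] exI[of _ "[(m - 2 - (i - m), c)]"] exI[of _ "[]"]) auto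
qed

lemma absorbs_cap: "m < N \<Longrightarrow> absorbs N (Suc m) [(m, Cap)] m"
  unfolding absorbs_def using partial_closure_cap[of m N]
  by (intro exI[of _ N] exI[of _ "[]"]) auto

text \<open>
  The minimum is pulled down in front of the maxima one after the other. Below all of them it
  starts a new strand of the braid.
\<close>

lemma absorbs_cup: "m \<le> N \<Longrightarrow> absorbs N m [(m, Cup True)] (Suc m)"
proof (induction "N - m" arbitrary: m)
  case 0
  then have [simp]: "m = N" by simp
  have "width_eq 0 (partial_closure N w N @ [(N, Cup True)]) (partial_closure (Suc N) w (Suc N))" if "braid_word N w" for w
  proof -
    have "width_eq 0 (cups N @ (crossings w @ [(N + 0, Cup True)])) (cups N @ ([(N + 0, Cup True)] @ crossings w))"
      by (intro width_eq_append_left slice_right_commute fit_crossings[where n = N] that) simp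
    then show ?thesis by (simp add: partial_closure_def cups_Suc)
  qed
  then show ?case unfolding absorbs_def
    by (intro exI[of _ "Suc N"] exI[of _ "[]"]) auto
next
  case (Suc d)
  then have m: "m < N" by simp
  have "absorbs N (Suc m) ([(Suc m, Cup True)] @ ([(m, Cross False)] @ [(m + 2, Cross True)] @ [(Suc m, Cap)])) (Suc m)"
    by (intro absorbs_append[where m' = "Suc (Suc m)"] absorbs_crossing absorbs_cap) (use Suc in auto)
  moreover have "width_eq 0 (partial_closure N w m @ [(m, Cup True)])
     (partial_closure N w (Suc m) @ ([(Suc m, Cup True)] @ ([(m, Cross False)] @ [(m + 2, Cross True)] @ [(Suc m, Cap)])))" if "braid_word N w" for w
  proof -
    have "fit (partial_closure N w (Suc m)) 0 = Some (Suc m + Suc m)"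
      using m that by (intro fit_partial_closure) auto
    then have "width_eq 0 (partial_closure N w (Suc m) @ [(m, Cap), (m, Cup True)])
      (partial_closure N w (Suc m) @ [(Suc m, Cup True), (m, Cross False), (m + 2, Cross True), (Suc m, Cap)])"
      by (intro width_eq_left[OF cap_cup, of _ "Suc m + Suc m"]) auto
    then show ?thesis using partial_closure_cap[OF m, of w, symmetric] by simp
  qed
  ultimately show ?case unfolding absorbs_def using m by (meson width_eq_trans)
qed

lemma absorbs_central: "central m p W m' p' \<Longrightarrow> p = m \<Longrightarrow> m \<le> N \<Longrightarrow> absorbs N m W m'"
proof (induction arbitrary: N rule: central.induct)
  case (Nil m p)
  then show ?case unfolding absorbs_def by (intro exI[of _ N] exI[of _ "[]"]) auto
next
  case (Cross i m p W m' p' c)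
  then show ?case using absorbs_append[OF absorbs_crossing[of i m N c], of W m'] by auto
next
  case (Cup m p W m' p')
  then show ?case using absorbs_append[OF absorbs_cup[of m N], of W m'] by auto
next
  case (Cap m p W m' p')
  then show ?case using absorbs_append[OF absorbs_cap[of m N], of W m'] by auto
qed

text \<open>
  Each piece creates or destroys strands in pairs of opposite orientation.
\<close>

lemma ups_eq_downs: "run D st = Some u \<Longrightarrow> int (ups u) - int (downs u) = int (ups st) - int (downs st)"
proof (induction D arbitrary: st)
  case (Cons s D)
  obtain k p where s: "s = (k, p)" by force
  from Cons.prems obtain v where v: "slice_step (k, p) st = Some v" "run D v = Some u" by (auto simp: s bind_eq_Some_conv)
  have app: "ups (xs @ ys) = ups xs + ups ys" "downs (xs @ ys) = downs xs + downs ys" for xs ys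
    by (auto simp: ups_def downs_def)
  have "k + inputs p \<le> length st" using slice_step_fit[OF v(1)] by simp
  then have "st = take k st @ take (inputs p) (drop k st) @ drop (inputs p) (drop k st)"
    "length (take k st) = k" "length (take (inputs p) (drop k st)) = inputs p"
    by (simp_all only: append_take_drop_id) auto
  then obtain xs ys zs where st: "st = xs @ ys @ zs" "length xs = k" "length ys = inputs p" by blast
  with v(1) obtain o' where o: "piece_output p ys = Some o'" "v = xs @ o' @ zs" by (auto simp: slice_step_split simp del: slice_step.simps)
  have "int (ups o') - int (downs o') = int (ups ys) - int (downs ys)"
    using o(1) by (cases "(p, ys)" rule: piece_output.cases) (auto simp: ups_def downs_def split: if_splits)
  then have "int (ups v) - int (downs v) = int (ups st) - int (downs st)" by (simp add: app o st)
  then show ?case using Cons.IH[OF v(2)] by simp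
qed simp

lemma prefix_normal_form:
  assumes "run X [] = Some st" "up_crossings X []"
  shows "\<exists>N w. ups st \<le> N \<and> braid_word N w \<and> downs st = ups st \<and> width_eq 0 X (partial_closure N w (ups st) @ sorting st)"
proof -
  obtain W where W: "central 0 0 W (ups st) (downs st)" "width_eq 0 X (W @ sorting st)"
    using sorting_diagram[OF assms] by auto
  have "downs st = ups st" using ups_eq_downs[OF assms(1)] by simp
  moreover obtain N \<alpha> \<beta> where N: "ups st \<le> N" "braid_word N \<alpha>" "braid_word N \<beta>"
    "width_eq 0 (partial_closure 0 [] 0 @ W) (partial_closure N (\<alpha> @ \<beta>) (ups st))"
  proof -
    have "absorbs 0 0 W (ups st)" using absorbs_central[OF W(1)] by simp
    then obtain N \<alpha> \<beta> where N: "ups st \<le> N" "braid_word N \<alpha>" "braid_word N \<beta>"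
      "\<And>w. braid_word 0 w \<Longrightarrow> width_eq 0 (partial_closure 0 w 0 @ W) (partial_closure N (\<alpha> @ w @ \<beta>) (ups st))"
      unfolding absorbs_def by blast
    from N(4)[of "[]"] show ?thesis using N by (intro that[of N \<alpha> \<beta>]) simp_all
  qed
  have "width_eq 0 X (partial_closure N (\<alpha> @ \<beta>) (ups st) @ sorting st)"
    using W(2) width_eq_right[OF N(4), of "sorting st"]
    by (auto simp: partial_closure_def intro: width_eq_trans)
  ultimately show ?thesis using N by (intro exI[of _ N] exI[of _ "\<alpha> @ \<beta>"]) auto
qed

lemma suffix_absorbed:
  assumes "run Y st = Some []" "up_crossings Y st" "downs st = ups st" "ups st \<le> N"
  shows "\<exists>N' \<alpha> \<beta>. N \<le> N' \<and> braid_word N' \<alpha> \<and> braid_word N' \<beta> \<and>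
     (\<forall>w. braid_word N w \<longrightarrow> width_eq 0 (partial_closure N w (ups st) @ sorting st @ Y) (closure_diagram N' (\<alpha> @ w @ \<beta>)))"
proof -
  obtain W where W: "central (ups st) (downs st) W 0 0" "width_eq (length st) (sorting st @ Y) W"
    using sorting_diagram[OF assms(1,2)] by auto
  obtain N' \<alpha> \<beta> where N': "N \<le> N'" "braid_word N' \<alpha>" "braid_word N' \<beta>"
    "\<And>w. braid_word N w \<Longrightarrow> width_eq 0 (partial_closure N w (ups st) @ W) (closure_diagram N' (\<alpha> @ w @ \<beta>))"
    using absorbs_central[OF W(1) assms(3,4)] unfolding absorbs_def partial_closure_0 by blast
  have "width_eq 0 (partial_closure N w (ups st) @ sorting st @ Y) (closure_diagram N' (\<alpha> @ w @ \<beta>))" if "braid_word N w" for w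
  proof -
    have "fit (partial_closure N w (ups st)) 0 = Some (length st)"
      using fit_partial_closure[OF assms(4) that] assms(3) ups_plus_downs[of st] by simp
    from width_eq_left[OF W(2) this] show ?thesis using N'(4)[OF that] by (rule width_eq_trans)
  qed
  then show ?thesis using N' by blast
qed

lemma link_of_tangle_eq:
  assumes "tangle_eq [] D D'" "link_diagram D" shows "link_diagram D' \<and> link_of D = link_of D'"
proof -
  have "link_diagram D'" using assms by (simp add: tangle_eq_def link_diagram_def)
  then show ?thesis using isotopic_if_tangle_eq[OF assms] link_of_eq_iff[OF assms(2)] by simp
qed

lemma link_of_width_eq:
  assumes "width_eq 0 D D'" "link_diagram D" shows "link_diagram D' \<and> link_of D = link_of D'"
  using assms by (intro link_of_tangle_eq) (auto simp: width_eq_def)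

theorem Alexander:
  assumes "link_diagram D" shows "\<exists>n w. braid_word n w \<and> link_of D = braid_closure n w"
proof -
  obtain D' where D': "tangle_eq [] D D'" "up_crossings D' []"
    using exists_up_crossings assms unfolding link_diagram_def by blast
  have l: "link_diagram D'" "link_of D = link_of D'" using link_of_tangle_eq[OF D'(1) assms] by auto
  then obtain N w where "braid_word N w" "width_eq 0 D' (closure_diagram N w)"
    using prefix_normal_form[of D' "[]"] D'(2) by (auto simp: link_diagram_def partial_closure_0)
  then show ?thesis using link_of_width_eq[OF _ l(1)] l(2) unfolding braid_closure_def by metis
qed

text \<open>
  The part below the crossing is brought into the form of a partially closed braid, to which the
  crossing is added as a letter; the part above is then absorbed independently of that letter.
\<close>

theorem Alexander_Conway_triple:
  assumes "link_diagram (pos_diagram X k Y)"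
  shows "\<exists>n i \<alpha> \<beta>. Suc i < n \<and> braid_word n \<alpha> \<and> braid_word n \<beta> \<and>
    link_diagram (neg_diagram X k Y) \<and> link_diagram (smooth_diagram X k Y) \<and>
    link_of (pos_diagram X k Y) = braid_closure n (\<alpha> @ [(i, True)] @ \<beta>) \<and>
    link_of (neg_diagram X k Y) = braid_closure n (\<alpha> @ [(i, False)] @ \<beta>) \<and>
    link_of (smooth_diagram X k Y) = braid_closure n (\<alpha> @ \<beta>)"
proof -
  from assms obtain st st' where st: "run X [] = Some st" "slice_step (k, Cross (parallel X k)) st = Some st'" "run Y st' = Some []"
    by (auto simp: link_diagram_def pos_diagram_def run_append bind_eq_Some_conv simp del: slice_step.simps)
  have k: "Suc k < length st" using st(2) by (auto split: if_splits)
  have strands: "strands X = st" using st(1) by (simp add: strands_def)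
  obtain U j V u where U: "run U st = Some u" "Suc j < length u" "u ! j" "u ! Suc j"
    "\<And>i c. (i, Cross c) \<notin> set (U @ V)"
    "\<And>c. tangle_eq st [(k, Cross (c = (st ! k = st ! Suc k)))] (U @ [(j, Cross c)] @ V)"
    "tangle_eq st (smoothing st k) (U @ V)"
    using up_crossing_form[OF k] unfolding up_crossing_form_def by blast
  obtain X' where X': "tangle_eq [] X X'" "up_crossings X' []" using exists_up_crossings[OF st(1)] by blast
  obtain Y' where Y': "tangle_eq st' Y Y'" "up_crossings Y' st'" using exists_up_crossings[OF st(3)] by blast
  have runX': "run X' [] = Some st" "run Y' st' = Some []" using X' Y' st by (auto simp: tangle_eq_def)
  have sw: "slice_step (j, Cross c) u = Some u" for c
  proof -
    obtain xs a b zs where "u = xs @ a # b # zs" "length xs = j" using length_ge_2_split[OF U(2)] .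
    then show ?thesis using U(3,4) by auto
  qed
  have sk: "slice_step (k, Cross c) st = Some st'" for c using st(2) by simp
  have runUV: "run (U @ [(j, Cross c)] @ V) st = Some st'" for c
    using U(6)[of c] sk by (simp add: tangle_eq_def del: slice_step.simps)
  from this[of True] have runV: "run V u = Some st'" using U(1) sw[of True] by (auto simp: run_append simp del: slice_step.simps)
  have tri: "tangle_eq [] (X @ A @ Y) (X' @ B @ Y')" if "tangle_eq st A B" "run B st = Some st'" for A B
  proof -
    have "tangle_eq [] (X @ (A @ Y)) (X @ (B @ Y'))"
    proof (rule tangle_eq_append_left)
      fix u' assume "run X [] = Some u'"
      then have [simp]: "u' = st" using st by simp
      show "tangle_eq u' (A @ Y) (B @ Y')"
        using tangle_eq_trans[OF tangle_eq_append_right[OF that(1)] tangle_eq_append_left[of B st Y Y']] Y'(1) that(2) by simp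
    qed
    also have "tangle_eq [] (X @ (B @ Y')) (X' @ (B @ Y'))" by (rule tangle_eq_append_right[OF X'(1)])
    finally show ?thesis .
  qed
  have run_u: "run (X' @ U) [] = Some u" by (simp add: run_append runX' U(1))
  have "up_crossings (X' @ U) []"
    using X'(2) U(5) by (auto simp: up_crossings_append intro!: up_crossings_no_crossings)
  then obtain N w where N: "ups u \<le> N" "braid_word N w" "downs u = ups u" "width_eq 0 (X' @ U) (partial_closure N w (ups u) @ sorting u)"
    using prefix_normal_form[OF run_u] by blast
  have "run (V @ Y') u = Some []" by (simp add: run_append runV runX')
  moreover have "up_crossings (V @ Y') u"
    using Y'(2) U(5) runV by (auto simp: up_crossings_append intro!: up_crossings_no_crossings)
  ultimately obtain N' \<alpha> \<beta> where N': "N \<le> N'" "braid_word N' \<alpha>" "braid_word N' \<beta>"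
    "\<And>w. braid_word N w \<Longrightarrow> width_eq 0 (partial_closure N w (ups u) @ sorting u @ (V @ Y')) (closure_diagram N' (\<alpha> @ w @ \<beta>))"
    using suffix_absorbed[of "V @ Y'" u N] N(1,3) by blast
  obtain i where i: "Suc i < ups u" "\<And>c. width_eq (length u) (sorting u @ [(j, Cross c)]) ((i, Cross c) # sorting u)"
    using sorting_crossing[OF U(2-4)] by blast
  have bw: "braid_word N' w" using N(2) N'(1) braid_word_mono by blast
  have cr: "width_eq 0 ((X' @ U) @ [(j, Cross c)] @ V @ Y') (closure_diagram N' (\<alpha> @ (w @ [(i, c)]) @ \<beta>))" for c
  proof -
    have "width_eq 0 ((X' @ U) @ ([(j, Cross c)] @ V @ Y')) ((partial_closure N w (ups u) @ sorting u) @ ([(j, Cross c)] @ V @ Y'))"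
      by (rule width_eq_right[OF N(4)])
    also have "width_eq 0 (partial_closure N w (ups u) @ (sorting u @ [(j, Cross c)]) @ (V @ Y')) (partial_closure N w (ups u) @ ((i, Cross c) # sorting u) @ (V @ Y'))"
      by (rule width_eq_context[OF i(2)])
         (use fit_partial_closure[OF N(1,2)] N(3) ups_plus_downs[of u] in simp)
    then have "width_eq 0 ((partial_closure N w (ups u) @ sorting u) @ ([(j, Cross c)] @ V @ Y')) ((partial_closure N w (ups u) @ [(i, Cross c)]) @ sorting u @ V @ Y')" by simp
    also have "width_eq 0 \<dots> (partial_closure N (w @ [(i, c)]) (ups u) @ sorting u @ V @ Y')"
      by (intro width_eq_right partial_closure_up_crossing i N)
    also have "width_eq 0 \<dots> (closure_diagram N' (\<alpha> @ (w @ [(i, c)]) @ \<beta>))"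
      by (rule N'(4)) (use N i in auto)
    finally show ?thesis by simp
  qed
  have sm: "width_eq 0 ((X' @ U) @ V @ Y') (closure_diagram N' (\<alpha> @ w @ \<beta>))"
    using width_eq_trans[OF width_eq_right[OF N(4), of "V @ Y'"]] N'(4)[OF N(2)] by simp
  have fin: "link_diagram (X @ A @ Y) \<and> link_of (X @ A @ Y) = braid_closure N' v"
    if "tangle_eq st A B" "run B st = Some st'" "width_eq 0 (X' @ B @ Y') (closure_diagram N' v)" for A B v
  proof -
    have "run (X @ A @ Y) [] = Some []" using that(1,2) st by (auto simp: run_append tangle_eq_def)
    then have l: "link_diagram (X @ A @ Y)" by (simp add: link_diagram_def)
    then show ?thesis using link_of_tangle_eq[OF tri[OF that(1,2)] l] link_of_width_eq[OF that(3)] by (simp add: braid_closure_def)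
  qed
  have "(True = (st ! k = st ! Suc k)) = parallel X k" "(False = (st ! k = st ! Suc k)) = (\<not> parallel X k)" "smoothing st k = (if parallel X k then [] else [(k, Cap), (k, Cup (strands X ! Suc k))])"
    by (auto simp: parallel_def strands smoothing_def)
  then have "link_diagram (pos_diagram X k Y) \<and> link_of (pos_diagram X k Y) = braid_closure N' ((\<alpha> @ w) @ [(i, True)] @ \<beta>)"
    "link_diagram (neg_diagram X k Y) \<and> link_of (neg_diagram X k Y) = braid_closure N' ((\<alpha> @ w) @ [(i, False)] @ \<beta>)"
    "link_diagram (smooth_diagram X k Y) \<and> link_of (smooth_diagram X k Y) = braid_closure N' ((\<alpha> @ w) @ \<beta>)"
    using fin[OF U(6)[of True] runUV, of "(\<alpha> @ w) @ [(i, True)] @ \<beta>"] fin[OF U(6)[of False] runUV, of "(\<alpha> @ w) @ [(i, False)] @ \<beta>"] cr[of True] cr[of False]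
      fin[OF U(7), of "(\<alpha> @ w) @ \<beta>"] sm runV U(1)
    unfolding pos_diagram_def neg_diagram_def smooth_diagram_def by (simp_all add: run_append)
  moreover have "Suc i < N'" using i(1) N(1) N'(1) by simp
  ultimately show ?thesis using N'(2,3) bw by (intro exI[of _ N'] exI[of _ i] exI[of _ "\<alpha> @ w"] exI[of _ \<beta>]) simp
qed

section \<open>Moves on closed braids\<close>

lemma braid_closure_eqI:
  assumes "width_eq (2 * n) (crossings a) (crossings b)" "braid_word n (u @ a @ v)" "braid_word n (u @ b @ v)"
  shows "braid_closure n (u @ a @ v) = braid_closure n (u @ b @ v)"
proof -
  have "width_eq 0 ((cups n @ crossings u) @ crossings a @ (crossings v @ caps 0 n)) ((cups n @ crossings u) @ crossings b @ (crossings v @ caps 0 n))"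
    by (rule width_eq_context[OF assms(1) fit_cups_crossings]) (use assms in auto)
  then have "width_eq 0 (closure_diagram n (u @ a @ v)) (closure_diagram n (u @ b @ v))"
    by (simp add: closure_diagram_eq)
  from link_of_width_eq[OF this link_diagram_closure[OF assms(2)]] show ?thesis by (simp add: braid_closure_def)
qed

lemma braid_closure_cancel:
  assumes "Suc i < n" "braid_word n (u @ v)"
  shows "braid_closure n (u @ [(i, c), (i, \<not> c)] @ v) = braid_closure n (u @ v)"
  using braid_closure_eqI[of n "[(i, c), (i, \<not> c)]" "[]" u v] width_eq_R2[of i "2 * n" c] assms by simp

lemma braid_closure_braid_relation:
  assumes "Suc (Suc i) < n" "braid_word n (u @ v)"
  shows "braid_closure n (u @ [(i, c), (Suc i, c), (i, c)] @ v) = braid_closure n (u @ [(Suc i, c), (i, c), (Suc i, c)] @ v)"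
  using braid_closure_eqI[of n "[(i, c), (Suc i, c), (i, c)]" "[(Suc i, c), (i, c), (Suc i, c)]" u v] width_eq_R3[of "2 * n" i c] assms by simp

lemma width_eq_far:
  assumes "Suc i < j"
  shows "width_eq n [(i, Cross b), (j, Cross c)] [(j, Cross c), (i, Cross b)]"
proof -
  obtain k where "j = i + 2 + k" using assms less_iff_Suc_add[of "Suc i" j] by auto
  then show ?thesis using width_eq_height[of n i "Cross b" k "Cross c"] by simp
qed

lemma braid_closure_far:
  assumes "Suc i < n" "Suc j < n" "\<bar>int i - int j\<bar> > 1" "braid_word n (u @ v)"
  shows "braid_closure n (u @ [(i, b), (j, c)] @ v) = braid_closure n (u @ [(j, c), (i, b)] @ v)"
proof (rule braid_closure_eqI)
  have "Suc i < j \<or> Suc j < i" using assms(3) by arith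
  then show "width_eq (2 * n) (crossings [(i, b), (j, c)]) (crossings [(j, c), (i, b)])"
    using width_eq_far[of i j "2 * n" b c] width_eq_sym[OF width_eq_far[of j i "2 * n" c b]] by auto
qed (use assms in auto)

lemma braid_closure_cycle:
  "braid_word n (u @ v) \<Longrightarrow> braid_closure n (u @ v) = braid_closure n (v @ u)"
  using link_of_width_eq[OF closure_cycle link_diagram_closure] by (simp add: braid_closure_def)

text \<open>
  The new strand is a curl: after sliding the crossing across its maximum, the first Reidemeister
  move and a straightening remove it.
\<close>

lemma braid_closure_stabilise:
  assumes "braid_word (Suc n) w"
  shows "braid_closure (Suc (Suc n)) (w @ [(n, c)]) = braid_closure (Suc n) w"
proof -
  let ?P = "cups (Suc n) @ crossings w"
  have "width_eq 0 (cups (Suc n) @ ([(Suc n + 0, Cup True)] @ crossings w) @ (n, Cross c) # caps 0 (Suc (Suc n)))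
     (cups (Suc n) @ (crossings w @ [(Suc n + 0, Cup True)]) @ (n, Cross c) # caps 0 (Suc (Suc n)))"
    by (intro width_eq_append_left width_eq_right width_eq_sym[OF slice_right_commute] fit_crossings[where n = "Suc n"] assms) simp
  then have "width_eq 0 (closure_diagram (Suc (Suc n)) (w @ [(n, c)])) (?P @ [(Suc n, Cup True), (n, Cross c), (Suc n, Cap)] @ caps 0 (Suc n))"
    by (simp add: closure_diagram_eq cups_Suc caps_0_Suc)
  also have "width_eq m [(Suc n, Cup True), (n, Cross c), (Suc n, Cap)] [(Suc n, Cup False), (n, Cap)]" for m
  proof -
    have "width_eq m ([(Suc n, Cup True)] @ [(n, Cross c), (Suc n, Cap)]) ([(Suc n, Cup True)] @ [(Suc n, Cross (\<not> c)), (n, Cap)])"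
      by (intro width_eq_append_left width_eq_slide_cap)
    also have "width_eq m ([(Suc n, Cup True), (Suc n, Cross (\<not> c))] @ [(n, Cap)]) ([(Suc n, Cup (\<not> True))] @ [(n, Cap)])"
      by (intro width_eq_right width_eq_R1_cup)
    then have "width_eq m ([(Suc n, Cup True)] @ [(Suc n, Cross (\<not> c)), (n, Cap)]) [(Suc n, Cup False), (n, Cap)]" by simp
    finally show ?thesis by simp
  qed
  then have "width_eq 0 (?P @ [(Suc n, Cup True), (n, Cross c), (Suc n, Cap)] @ caps 0 (Suc n)) (?P @ [(Suc n, Cup False), (n, Cap)] @ caps 0 (Suc n))"
    by (intro width_eq_append_left width_eq_right)
  finally have "tangle_eq [] (closure_diagram (Suc (Suc n)) (w @ [(n, c)])) (?P @ [(Suc n, Cup False), (n, Cap)] @ caps 0 (Suc n))"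
    by (simp add: width_eq_def)
  also have "tangle_eq [] (?P @ [(Suc n, Cup False), (n, Cap)] @ caps 0 (Suc n)) (?P @ [] @ caps 0 (Suc n))"
  proof (intro tangle_eq_append_left tangle_eq_append_right tangle_eq_zigzag_left)
    fix v assume "run ?P [] = Some v"
    then have "v = replicate (Suc n) True @ replicate (Suc n) False"
      using run_crossings[OF assms, of "replicate (Suc n) False"] by (simp add: run_append run_cups del: replicate_Suc)
    then show "n < length v" "v ! n = (\<not> False)" by (auto simp: nth_append simp del: replicate_Suc)
  qed
  finally have "tangle_eq [] (closure_diagram (Suc (Suc n)) (w @ [(n, c)])) (closure_diagram (Suc n) w)"
    by (simp add: closure_diagram_eq)
  then show ?thesis
    using link_of_tangle_eq[OF _ link_diagram_closure] assms braid_word_mono[OF assms, of "Suc (Suc n)"]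
    by (simp add: braid_closure_def)
qed

definition shift_word :: "nat \<Rightarrow> braid_word \<Rightarrow> braid_word" where
  "shift_word n = map (\<lambda>(i, c). (i + n, c))"

lemma braid_word_shift: "braid_word m v \<Longrightarrow> braid_word (n + m) (shift_word n v)"
  by (auto simp: braid_word_def shift_word_def)

lemma crossings_shift_word: "crossings (shift_word n v) = shift n (crossings v)"
  by (auto simp: crossings_def shift_word_def shift_def)

text \<open>
  The second closed braid lies outside the first. Being closed, it can be moved through the
  closing arcs of the first one to their inside, where both together are a single closed braid.
\<close>

lemma closure_disjoint_union:
  assumes "braid_word n w" "braid_word m v"
  shows "width_eq 0 (closure_diagram n w @ closure_diagram m v) (closure_diagram (n + m) (w @ shift_word n v))"
proof -
  let ?D = "closure_diagram m v" and ?P = "cups n @ crossings w"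
  have caps: "caps n (n + m) = shift n (caps 0 m)" using caps_shift[of 0 n m] by (simp add: add.commute)
  have "width_eq l (caps 0 n @ ?D) (?D @ caps 0 n)" for l
    using width_eq_sym[OF disjoint_commute[OF fit_closure[OF assms(2)], of l "caps 0 n"]] by simp
  then have "width_eq 0 (?P @ caps 0 n @ ?D) (?P @ ?D @ caps 0 n)"
    by (intro width_eq_append_left)
  also have "width_eq 0 (?P @ ?D @ caps 0 n) (?P @ shift n ?D @ caps 0 n)"
    by (rule width_eq_context[OF width_eq_sym[OF closed_shift] fit_cups_crossings]) (use assms fit_closure in auto)
  also have "width_eq 0 (cups n @ (crossings w @ shift n (cups m)) @ (shift n (crossings v @ caps 0 m) @ caps 0 n))
     (cups n @ (shift n (cups m) @ crossings w) @ (shift n (crossings v @ caps 0 m) @ caps 0 n))"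
    by (intro width_eq_append_left width_eq_right disjoint_commute fit_crossings[where n = n] assms) simp
  then have "width_eq 0 (?P @ shift n ?D @ caps 0 n) (closure_diagram (n + m) (w @ shift_word n v))"
    using caps_add[of 0 n "n + m"] caps
    by (simp add: closure_diagram_eq cups_add crossings_shift_word)
  finally show ?thesis by (simp add: closure_diagram_eq)
qed

lemma link_diagram_append: "link_diagram A \<Longrightarrow> link_diagram B \<Longrightarrow> link_diagram (A @ B)"
  by (simp add: link_diagram_def run_append)

lemma isotopic_append:
  assumes "isotopic A A'" "isotopic B B'" shows "isotopic (A @ B) (A' @ B')"
proof -
  have *: "move (U @ x @ V) (U @ y @ V)" if "move x y" "link_diagram U" "link_diagram V" for x y U V
    using that(1)
  proof cases
    case (1 C C' X Y)
    have "link_diagram (U @ (X @ C @ Y) @ V)" "link_diagram (U @ (X @ C' @ Y) @ V)"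
      by (intro link_diagram_append that 1)+
    then show ?thesis using move.intros[of C C' "U @ X" "Y @ V"] 1 by simp
  qed
  have l: "link_diagram A" "link_diagram A'" "link_diagram B" "link_diagram B'" "equivclp move A A'" "equivclp move B B'"
    using assms by (auto simp: isotopic_def)
  have "equivclp move (A @ B) (A' @ B)"
    by (rule equivclp_map[OF l(5)]) (use *[of _ _ "[]" B] l in \<open>auto simp: link_diagram_def intro: r_into_equivclp\<close>)
  also have "equivclp move (A' @ B) (A' @ B')"
    by (rule equivclp_map[OF l(6)]) (use *[of _ _ A' "[]"] l in \<open>auto simp: link_diagram_def intro: r_into_equivclp\<close>)
  finally (equivclp_trans) show ?thesis using l link_diagram_append by (simp add: isotopic_def)
qed

lemma link_of_append_closures:
  assumes "braid_word n w" "braid_word m v" "link_diagram A" "link_diagram B"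
    "link_of A = braid_closure n w" "link_of B = braid_closure m v"
  shows "link_of (A @ B) = braid_closure (n + m) (w @ shift_word n v)"
proof -
  have "isotopic A (closure_diagram n w)" "isotopic B (closure_diagram m v)"
    using assms link_of_eq_iff link_diagram_closure by (auto simp: braid_closure_def)
  from isotopic_append[OF this] have "isotopic (A @ B) (closure_diagram n w @ closure_diagram m v)" .
  then have "link_of (A @ B) = link_of (closure_diagram n w @ closure_diagram m v)"
    using link_of_eq_iff by (auto simp: isotopic_def)
  then show ?thesis
    using link_of_width_eq[OF closure_disjoint_union[OF assms(1,2)] link_diagram_append[OF link_diagram_closure link_diagram_closure]] assms
    by (simp add: braid_closure_def)
qed

section \<open>Two-colourings and components\<close>

fun local_colours :: "piece \<Rightarrow> bool list \<Rightarrow> bool list set" where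
  "local_colours (Cross c) [a, b] = {[b, a]}"
| "local_colours (Cup b) [] = {[True, True], [False, False]}"
| "local_colours Cap [a, b] = (if a = b then {[]} else {})"
| "local_colours _ _ = {}"

fun colour_step :: "slice \<Rightarrow> bool list \<Rightarrow> bool list set" where
  "colour_step (k, p) cs = (\<lambda>v. take k cs @ v @ drop (k + inputs p) cs) ` local_colours p (take (inputs p) (drop k cs))"

text \<open>
  The number of ways to colour the strands of \<open>D\<close> consistently with two colours,
  starting from the colours \<open>cs\<close> at the bottom. For closed diagrams it is a power of
  \<open>2\<close> with the number of components as exponent.
\<close>

fun colourings :: "diagram \<Rightarrow> bool list \<Rightarrow> nat" where
  "colourings [] cs = (if cs = [] then 1 else 0)"
| "colourings (s # D) cs = (\<Sum>ds\<in>colour_step s cs. colourings D ds)"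

lemma finite_local_colours [simp]: "finite (local_colours p ys)"
  by (cases "(p, ys)" rule: local_colours.cases) auto

lemma finite_colour_step [simp]: "finite (colour_step s cs)"
  by (cases s) auto

lemma colour_step_append:
  assumes "length xs = k" "length ys = inputs p"
  shows "colour_step (k, p) (xs @ ys @ zs) = (\<lambda>v. xs @ v @ zs) ` local_colours p ys"
  using assms by simp

lemma length_local_colours: "v \<in> local_colours p ys \<Longrightarrow> length v = outputs p"
  by (cases "(p, ys)" rule: local_colours.cases) (auto split: if_splits)

lemma colour_stepE:
  assumes "ds \<in> colour_step (k, p) cs" "k + inputs p \<le> length cs"
  obtains xs ys zs v where "cs = xs @ ys @ zs" "ds = xs @ v @ zs" "length xs = k" "length ys = inputs p"
    "v \<in> local_colours p ys" "length v = outputs p"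
proof -
  obtain xs r where 1: "cs = xs @ r" "length xs = k" using assms(2) by (metis add_leD1 length_split)
  moreover from this assms(2) obtain ys zs where 2: "r = ys @ zs" "length ys = inputs p"
    by (metis add_le_cancel_left length_append length_split)
  ultimately show ?thesis using that[of xs ys zs] assms(1) length_local_colours by (fastforce simp del: colour_step.simps simp: colour_step_append)
qed

lemma colourings_Cons_append:
  assumes "length xs = k" "length ys = inputs p"
  shows "colourings ((k, p) # D) (xs @ ys @ zs) = (\<Sum>v\<in>local_colours p ys. colourings D (xs @ v @ zs))"
  unfolding colourings.simps colour_step_append[OF assms]
  by (subst sum.reindex) (auto simp: inj_on_def)

lemma colourings_Cross [simp]:
  "length xs = k \<Longrightarrow> colourings ((k, Cross c) # D) (xs @ a # b # zs) = colourings D (xs @ b # a # zs)"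
  using colourings_Cons_append[of xs k "[a, b]" "Cross c" D zs] by (simp del: colourings.simps)

lemma colourings_Cup [simp]:
  "length xs = k \<Longrightarrow> colourings ((k, Cup b) # D) (xs @ zs) =
     colourings D (xs @ True # True # zs) + colourings D (xs @ False # False # zs)"
  using colourings_Cons_append[of xs k "[]" "Cup b" D zs] by (simp del: colourings.simps)

lemma colourings_Cap [simp]:
  "length xs = k \<Longrightarrow> colourings ((k, Cap) # D) (xs @ a # b # zs) = (if a = b then colourings D (xs @ zs) else 0)"
  using colourings_Cons_append[of xs k "[a, b]" "Cap" D zs] by (simp del: colourings.simps)

lemma colourings_Suc [simp]:
  assumes "length xs = k"
  shows "colourings ((Suc k, Cross c) # D) (xs @ x # a # b # zs) = colourings D (xs @ x # b # a # zs)"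
    "colourings ((Suc k, Cup b') # D) (xs @ x # zs) =
     colourings D (xs @ x # True # True # zs) + colourings D (xs @ x # False # False # zs)"
    "colourings ((Suc k, Cap) # D) (xs @ x # a # b # zs) = (if a = b then colourings D (xs @ x # zs) else 0)"
  using colourings_Cross[of "xs @ [x]" "Suc k" c D a b zs] colourings_Cup[of "xs @ [x]" "Suc k" b' D zs]
    colourings_Cap[of "xs @ [x]" "Suc k" D a b zs] assms by (simp_all del: colourings.simps)

text \<open>
  Changes of the upper part of a diagram can be examined one colouring of its bottom strands at a
  time.
\<close>

lemma colourings_prefix_cong:
  assumes "fit X (length cs) = Some m" "\<And>ds. length ds = m \<Longrightarrow> colourings Z ds = colourings Z' ds"
  shows "colourings (X @ Z) cs = colourings (X @ Z') cs"
  using assms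
proof (induction X arbitrary: cs)
  case (Cons s X)
  obtain k p where s: "s = (k, p)" by force
  have "colourings (X @ Z) ds = colourings (X @ Z') ds" if "ds \<in> colour_step s cs" for ds
  proof -
    have "k + inputs p \<le> length cs" "fit X (length cs - inputs p + outputs p) = Some m"
      using Cons.prems(1) by (auto simp: s split: if_splits)
    moreover from this that[unfolded s] have "length ds = length cs - inputs p + outputs p"
      by (elim colour_stepE) auto
    ultimately show ?thesis using Cons by simp
  qed
  then show ?case by (simp cong: sum.cong)
qed simp

lemma colourings_local_move:
  assumes "local_move A B" "fit A (length cs) \<noteq> None" "fit B (length cs) \<noteq> None"
  shows "colourings (A @ Y) cs = colourings (B @ Y) cs"
  using assms
proof (induction rule: local_move.induct)
  case (height k a j b)
  then have "k + inputs a + j + inputs b \<le> length cs" by (auto split: if_splits)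
  moreover define xs where "xs = take k cs"
  moreover define ys where "ys = take (inputs a) (drop k cs)"
  moreover define zs where "zs = take j (drop (k + inputs a) cs)"
  moreover define us where "us = take (inputs b) (drop (k + inputs a + j) cs)"
  moreover define vs where "vs = drop (k + inputs a + j + inputs b) cs"
  ultimately have cs: "cs = xs @ ys @ zs @ us @ vs" and
    len: "length xs = k" "length ys = inputs a" "length zs = j" "length us = inputs b"
    by (simp_all, metis add.commute append_take_drop_id drop_drop)
  have "colourings ([(k, a), (k + outputs a + j, b)] @ Y) cs
      = (\<Sum>v\<in>local_colours a ys. colourings ((k + outputs a + j, b) # Y) ((xs @ v @ zs) @ us @ vs))"
    using colourings_Cons_append[of xs k ys a _ "zs @ us @ vs"] len by (simp add: cs del: colourings.simps)
  also have "\<dots> = (\<Sum>v\<in>local_colours a ys. \<Sum>w\<in>local_colours b us. colourings Y ((xs @ v @ zs) @ w @ vs))"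
    by (intro sum.cong refl colourings_Cons_append) (use len length_local_colours in auto)
  also have "\<dots> = (\<Sum>w\<in>local_colours b us. \<Sum>v\<in>local_colours a ys. colourings Y ((xs @ v @ zs) @ w @ vs))"
    by (rule sum.swap)
  also have "\<dots> = (\<Sum>w\<in>local_colours b us. \<Sum>v\<in>local_colours a ys. colourings Y (xs @ v @ (zs @ w @ vs)))" by simp
  also have "\<dots> = (\<Sum>w\<in>local_colours b us. colourings ((k, a) # Y) (xs @ ys @ (zs @ w @ vs)))"
    by (intro sum.cong refl colourings_Cons_append[symmetric]) (use len in auto)
  also have "\<dots> = (\<Sum>w\<in>local_colours b us. colourings ((k, a) # Y) ((xs @ ys @ zs) @ w @ vs))" by simp
  also have "\<dots> = colourings ([(k + inputs a + j, b), (k, a)] @ Y) cs"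
    using colourings_Cons_append[of "xs @ ys @ zs" "k + inputs a + j" us b _ "vs"] len by (simp add: cs del: colourings.simps)
  finally show ?case .
next
  case (zigzag_left k b)
  then have "k < length cs" by (auto split: if_splits)
  then obtain xs a zs where "cs = xs @ a # zs" "length xs = k" using id_take_nth_drop[of k cs] by (metis length_take min.absorb2 less_imp_le)
  then show ?case by (cases a) (simp_all del: colourings.simps)
next
  case (zigzag_right k b)
  then have "k < length cs" by (auto split: if_splits)
  then obtain xs a zs where "cs = xs @ a # zs" "length xs = k" using id_take_nth_drop[of k cs] by (metis length_take min.absorb2 less_imp_le)
  then show ?case by (cases a) (simp_all del: colourings.simps)
next
  case (slide_cup k b c)
  then have "k < length cs" by (auto split: if_splits)
  then obtain xs a zs where "cs = xs @ a # zs" "length xs = k" using id_take_nth_drop[of k cs] by (metis length_take min.absorb2 less_imp_le)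
  then show ?case by (simp del: colourings.simps)
next
  case (slide_cap k c)
  then have "Suc (Suc k) < length cs" by (auto split: if_splits)
  then show ?case by (elim length_ge_3_split) (simp del: colourings.simps)
next
  case (R1_cup k b c)
  then have "k \<le> length cs" by (auto split: if_splits)
  then show ?case by (elim length_split) (simp del: colourings.simps)
next
  case (R1_cap k c)
  then have "Suc k < length cs" by (auto split: if_splits)
  then show ?case by (elim length_ge_2_split) (auto simp del: colourings.simps)
next
  case (R2 k c)
  then have "Suc k < length cs" by (auto split: if_splits)
  then show ?case by (elim length_ge_2_split) (simp del: colourings.simps)
next
  case (R3 k c)
  then have "Suc (Suc k) < length cs" by (auto split: if_splits)
  then show ?case by (elim length_ge_3_split) (simp del: colourings.simps)
qed

lemma colourings_move: "move A B \<Longrightarrow> colourings A [] = colourings B []"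
proof (induction rule: move.induct)
  case (1 A B X Y)
  then obtain u v where u: "run X [] = Some u" "run (A @ Y) u = Some []" "run (B @ Y) u = Some []"
    by (auto simp: link_diagram_def run_append bind_eq_Some_conv)
  show ?case
  proof (rule colourings_prefix_cong)
    show "fit X (length []) = Some (length u)" using run_fit[OF u(1)] by simp
    show "colourings (A @ Y) ds = colourings (B @ Y) ds" if "length ds = length u" for ds
      by (rule colourings_local_move[OF 1(1)])
         (use run_fit[OF u(2)] run_fit[OF u(3)] that in \<open>auto simp: fit_append bind_eq_Some_conv\<close>)
  qed
qed

lemma colourings_link_of:
  assumes "link_of A = link_of B" "link_diagram A" "link_diagram B" shows "colourings A [] = colourings B []"
proof -
  have "equivclp move A B" using assms link_of_eq_iff by (simp add: isotopic_def)
  then show ?thesis by (rule equivclp_invariant) (rule colourings_move)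
qed

lemma colourings_append_closed:
  "fit A (length cs) = Some 0 \<Longrightarrow> colourings (A @ B) cs = colourings A cs * colourings B []"
proof (induction A arbitrary: cs)
  case (Cons s A)
  obtain k p where s: "s = (k, p)" by force
  have "colourings (A @ B) ds = colourings A ds * colourings B []" if "ds \<in> colour_step s cs" for ds
  proof -
    have "k + inputs p \<le> length cs" "fit A (length cs - inputs p + outputs p) = Some 0"
      using Cons.prems(1) by (auto simp: s split: if_splits)
    moreover from this that[unfolded s] have "length ds = length cs - inputs p + outputs p"
      by (elim colour_stepE) auto
    ultimately show ?thesis using Cons by simp
  qed
  then show ?case by (simp add: sum_distrib_right cong: sum.cong)
qed simp

definition swap_at :: "nat \<Rightarrow> 'a list \<Rightarrow> 'a list" where
  "swap_at i cs = cs[i := cs ! Suc i, Suc i := cs ! i]"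

fun permute :: "braid_word \<Rightarrow> 'a list \<Rightarrow> 'a list" where
  "permute [] cs = cs"
| "permute ((i, b) # w) cs = permute w (swap_at i cs)"

lemma length_swap_at [simp]: "length (swap_at i cs) = length cs" by (simp add: swap_at_def)
lemma length_permute [simp]: "length (permute w cs) = length cs"
  by (induction w cs rule: permute.induct) auto
lemma permute_append: "permute (v @ w) cs = permute w (permute v cs)"
  by (induction v cs rule: permute.induct) auto

lemma swap_at_append: "swap_at (length xs) (xs @ a # b # zs) = xs @ b # a # zs"
  by (simp add: swap_at_def list_update_append)

lemma colourings_crossings:
  "braid_word (length cs) w \<Longrightarrow> colourings (crossings w @ Y) (cs @ es) = colourings Y (permute w cs @ es)"
proof (induction w arbitrary: cs)
  case (Cons a w)
  obtain i b where a: "a = (i, b)" by force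
  with Cons.prems have i: "Suc i < length cs" by simp
  then obtain xs x y zs where cs: "cs = xs @ x # y # zs" "length xs = i" by (rule length_ge_2_split)
  have "colourings ((i, Cross b) # crossings w @ Y) (xs @ x # y # zs @ es) = colourings (crossings w @ Y) ((xs @ y # x # zs) @ es)"
    using cs by (simp del: colourings.simps)
  also have "\<dots> = colourings Y (permute w (xs @ y # x # zs) @ es)"
    by (rule Cons.IH) (use Cons.prems cs a in auto)
  finally show ?case using cs swap_at_append[of xs x y zs] by (simp add: a del: colourings.simps)
qed simp

lemma colourings_caps:
  "length cs = n \<Longrightarrow> length ds = n \<Longrightarrow> colourings (caps 0 n) (cs @ rev ds) = (if cs = ds then 1 else 0)"
proof (induction n arbitrary: cs ds)
  case (Suc n)
  then obtain cs' a ds' b where cs: "cs = cs' @ [a]" "ds = ds' @ [b]" "length cs' = n" "length ds' = n"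
    using length_Suc_conv_rev[of cs n] length_Suc_conv_rev[of ds n] by auto
  have "colourings ((n, Cap) # caps 0 n) (cs' @ a # b # rev ds') = (if a = b then colourings (caps 0 n) (cs' @ rev ds') else 0)"
    using cs by (simp del: colourings.simps)
  then show ?case using Suc.IH[OF cs(3,4)] cs by (auto simp: caps_0_Suc simp del: colourings.simps)
qed simp

lemma lists_Suc: "{cs :: bool list. length cs = Suc n} = (\<lambda>cs. cs @ [True]) ` {cs. length cs = n} \<union> (\<lambda>cs. cs @ [False]) ` {cs. length cs = n}"
proof (intro equalityI subsetI)
  fix cs :: "bool list" assume "cs \<in> {cs. length cs = Suc n}"
  then obtain ds x where "cs = ds @ [x]" "length ds = n" using length_Suc_conv_rev[of cs n] by auto
  then show "cs \<in> (\<lambda>cs. cs @ [True]) ` {cs. length cs = n} \<union> (\<lambda>cs. cs @ [False]) ` {cs. length cs = n}"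
    by (cases x) auto
qed auto

lemma finite_lists_length: "finite {cs :: bool list. length cs = n}"
  using finite_lists_length_eq[of "UNIV :: bool set" n] by simp

lemma colourings_cups:
  "colourings (cups n @ Y) [] = (\<Sum>cs | length cs = n. colourings Y (cs @ rev cs))"
proof (induction n arbitrary: Y)
  case (Suc n)
  have "colourings (cups (Suc n) @ Y) [] = (\<Sum>cs | length cs = n. colourings ((n, Cup True) # Y) (cs @ rev cs))"
    using Suc.IH[of "(n, Cup True) # Y"] by (simp add: cups_Suc)
  also have "\<dots> = (\<Sum>cs | length cs = n. colourings Y (cs @ True # True # rev cs) + colourings Y (cs @ False # False # rev cs))"
    by (intro sum.cong refl colourings_Cup) simp
  also have "\<dots> = (\<Sum>cs | length cs = Suc n. colourings Y (cs @ rev cs))"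
    unfolding lists_Suc
    by (subst sum.union_disjoint)
       (auto simp: finite_lists_length sum.reindex inj_on_def sum.distrib)
  finally show ?case .
qed simp

text \<open>
  A colouring of a closed braid is a colouring of the strands at its bottom that the braid
  reproduces at its top.
\<close>

lemma colourings_closure:
  assumes "braid_word n w"
  shows "colourings (closure_diagram n w) [] = card {cs :: bool list. length cs = n \<and> permute w cs = cs}"
proof -
  have "colourings (closure_diagram n w) [] = (\<Sum>cs | length cs = n. colourings (caps 0 n) (permute w cs @ rev cs))"
    unfolding closure_diagram_eq colourings_cups
    by (intro sum.cong refl colourings_crossings) (use assms in simp)
  also have "\<dots> = (\<Sum>cs :: bool list | length cs = n. if permute w cs = cs then 1 else 0)"
    by (intro sum.cong refl colourings_caps) auto
  also have "\<dots> = card {cs :: bool list. length cs = n \<and> permute w cs = cs}"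
    by (subst sum.inter_filter[symmetric]) (auto simp: finite_lists_length)
  finally show ?thesis .
qed

text \<open>
  For two colourings of a diagram the parity of this number is the same at all heights, because
  extrema create or destroy strands in pairs of equal colour.
\<close>

definition overlap :: "bool list \<Rightarrow> bool list \<Rightarrow> nat" where
  "overlap f h = length (filter (\<lambda>(a, b). a \<and> b) (zip f h))"

lemma overlap_simps [simp]:
  "overlap [] h = 0" "overlap (a # f) (b # h) = (if a \<and> b then Suc (overlap f h) else overlap f h)"
  "length f = length h \<Longrightarrow> overlap (f @ f') (h @ h') = overlap f h + overlap f' h'"
  by (auto simp: overlap_def)

lemma overlap_step:
  assumes "f' \<in> colour_step s f" "h' \<in> colour_step s h" "length f = length h" "fit [s] (length f) \<noteq> None"
  shows "length f' = length h' \<and> even (overlap f' h') = even (overlap f h)"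
proof -
  obtain k p where s: "s = (k, p)" by force
  have k: "k + inputs p \<le> length f" "k + inputs p \<le> length h" using assms by (auto simp: s split: if_splits)
  obtain xs ys zs v where f: "f = xs @ ys @ zs" "f' = xs @ v @ zs" "length xs = k" "length ys = inputs p"
    "v \<in> local_colours p ys" "length v = outputs p" using assms(1) k unfolding s by (elim colour_stepE)
  obtain xs' ys' zs' v' where h: "h = xs' @ ys' @ zs'" "h' = xs' @ v' @ zs'" "length xs' = k" "length ys' = inputs p"
    "v' \<in> local_colours p ys'" "length v' = outputs p" using assms(2) k unfolding s by (elim colour_stepE)
  have "even (overlap v v') = even (overlap ys ys')"
    using f(5) h(5) by (cases "(p, ys)" rule: local_colours.cases; cases "(p, ys')" rule: local_colours.cases) (auto split: if_splits)
  then show ?thesis using f h assms(3) by auto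
qed

fun colour_path :: "diagram \<Rightarrow> bool list \<Rightarrow> bool list \<Rightarrow> bool" where
  "colour_path [] cs es \<longleftrightarrow> cs = es"
| "colour_path (s # D) cs es \<longleftrightarrow> (\<exists>ds\<in>colour_step s cs. colour_path D ds es)"

lemma colour_path_append: "colour_path (A @ B) cs es \<longleftrightarrow> (\<exists>ds. colour_path A cs ds \<and> colour_path B ds es)"
  by (induction A arbitrary: cs) auto

lemma overlap_path:
  assumes "colour_path D f f'" "colour_path D h h'" "length f = length h" "fit D (length f) = Some m"
  shows "length f' = length h' \<and> length f' = m \<and> even (overlap f' h') = even (overlap f h)"
  using assms
proof (induction D arbitrary: f h)
  case (Cons s D)
  obtain k p where s: "s = (k, p)" by force
  obtain g i where g: "g \<in> colour_step s f" "colour_path D g f'" "i \<in> colour_step s h" "colour_path D i h'"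
    using Cons.prems by auto
  have fit: "k + inputs p \<le> length f" "fit D (length f - inputs p + outputs p) = Some m"
    using Cons.prems(4) by (auto simp: s split: if_splits)
  have "length g = length i \<and> even (overlap g i) = even (overlap f h)"
    by (rule overlap_step[OF g(1,3) Cons.prems(3)]) (use fit s in auto)
  moreover have "length g = length f - inputs p + outputs p"
    using g(1) fit(1) unfolding s by (elim colour_stepE) auto
  ultimately show ?case using Cons.IH[OF g(2,4)] fit by auto
qed simp

lemma colourings_pos_iff: "colourings D cs > 0 \<longleftrightarrow> colour_path D cs []"
  by (induction D arbitrary: cs) (auto simp: sum_nonneg_eq_0_iff simp flip: neq0_conv simp del: colour_step.simps)

lemma colourings_prefix_mono:
  assumes "\<And>v. colour_path X cs v \<Longrightarrow> colourings Z' v \<le> colourings Z v"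
  shows "colourings (X @ Z') cs \<le> colourings (X @ Z) cs"
  using assms
proof (induction X arbitrary: cs)
  case (Cons s X)
  then show ?case by (auto intro!: sum_mono simp del: colour_step.simps)
qed auto

lemma colourings_prefix_strict_mono:
  assumes "\<And>v. colour_path X cs v \<Longrightarrow> colourings Z' v \<le> colourings Z v"
    "colour_path X cs u" "colourings Z' u < colourings Z u"
  shows "colourings (X @ Z') cs < colourings (X @ Z) cs"
  using assms
proof (induction X arbitrary: cs)
  case (Cons s X)
  then obtain ds where ds: "ds \<in> colour_step s cs" "colour_path X ds u" by auto
  have "colourings (X @ Z') ds < colourings (X @ Z) ds" using Cons ds by (auto simp del: colour_step.simps)
  moreover have "colourings (X @ Z') es \<le> colourings (X @ Z) es" if "es \<in> colour_step s cs" for es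
    by (rule colourings_prefix_mono) (use Cons.prems that in \<open>auto simp del: colour_step.simps\<close>)
  ultimately show ?case using ds by (auto intro!: sum_strict_mono_ex1 simp del: colour_step.simps)
qed simp

lemma link_diagram_slice:
  assumes "link_diagram D" "i < length D" "D ! i = (k, a)"
  shows "run (take i D) [] = Some (strands (take i D))" "run (take (Suc i) D) [] = Some (strands (take (Suc i) D))"
    "slice_step (k, a) (strands (take i D)) = Some (strands (take (Suc i) D))"
    "k + inputs a \<le> length (strands (take i D))"
    "length (strands (take (Suc i) D)) = length (strands (take i D)) - inputs a + outputs a"
proof -
  have *: "run (take j D) [] = Some (strands (take j D))" for j
    using assms(1) run_append[of "take j D" "drop j D" "[]"]
    by (auto simp: link_diagram_def strands_def bind_eq_Some_conv dest!: sym[of "Some []"])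
  show "run (take i D) [] = Some (strands (take i D))" "run (take (Suc i) D) [] = Some (strands (take (Suc i) D))"
    by (rule *)+
  show step: "slice_step (k, a) (strands (take i D)) = Some (strands (take (Suc i) D))"
    using *[of "Suc i"] *[of i] assms(2,3)
    by (simp add: take_Suc_conv_app_nth run_append bind_eq_Some_conv del: slice_step.simps)
  from slice_step_fit[OF step] show "k + inputs a \<le> length (strands (take i D))"
    "length (strands (take (Suc i) D)) = length (strands (take i D)) - inputs a + outputs a" by auto
qed

lemma adjacent_points:
  assumes "link_diagram D" "adjacent D x y"
  shows "x \<in> points D \<longleftrightarrow> y \<in> points D"
  using assms(2)
proof cases
  case (left i k a p)
  then show ?thesis using link_diagram_slice[OF assms(1) left(3,4)] by (auto simp: points_def)
next
  case (right i k a p)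
  then show ?thesis using link_diagram_slice[OF assms(1) right(3,4)] by (auto simp: points_def)
next
  case (cross1 i k c)
  then show ?thesis using link_diagram_slice[OF assms(1) cross1(3,4)] by (auto simp: points_def)
next
  case (cross2 i k c)
  then show ?thesis using link_diagram_slice[OF assms(1) cross2(3,4)] by (auto simp: points_def)
next
  case (cup i k b)
  then show ?thesis using link_diagram_slice[OF assms(1) cup(3,4)] by (auto simp: points_def)
next
  case (cap i k)
  then show ?thesis using link_diagram_slice[OF assms(1) cap(3,4)] by (auto simp: points_def)
qed

definition row :: "diagram \<Rightarrow> (nat \<times> nat \<Rightarrow> bool) \<Rightarrow> nat \<Rightarrow> bool list" where
  "row D f i = map (\<lambda>p. f (i, p)) [0..<length (strands (take i D))]"

lemma row_step:
  assumes "link_diagram D" "i < length D"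
    "\<And>x y. adjacent D x y \<Longrightarrow> x \<in> points D \<Longrightarrow> f x = f y"
  shows "row D f (Suc i) \<in> colour_step (D ! i) (row D f i)"
proof -
  obtain k a where s: "D ! i = (k, a)" by force
  note sl = link_diagram_slice[OF assms(1,2) s]
  let ?l = "length (strands (take i D))"
  let ?v = "map (\<lambda>p. f (Suc i, k + p)) [0..<outputs a]"
  have pt: "(i, p) \<in> points D" if "p < ?l" for p using that assms(2) by (simp add: points_def)
  have "row D f (Suc i) = take k (row D f i) @ ?v @ drop (k + inputs a) (row D f i)"
  proof (rule nth_equalityI)
    fix p assume p: "p < length (row D f (Suc i))"
    consider "p < k" | "k \<le> p" "p < k + outputs a" | "k + outputs a \<le> p" by linarith
    then show "row D f (Suc i) ! p = (take k (row D f i) @ ?v @ drop (k + inputs a) (row D f i)) ! p"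
    proof cases
      case 1
      then show ?thesis using p sl(4) assms(3)[OF adjacent.left[OF assms(2) s 1] pt]
        by (simp add: row_def nth_append)
    next
      case 2
      then show ?thesis using p sl(4) by (auto simp add: row_def nth_append)
    next
      case 3
      then obtain q where q: "p = k + outputs a + q" using le_iff_add by blast
      have "f (i, k + inputs a + q) = f (Suc i, k + outputs a + q)"
        by (rule assms(3)[OF adjacent.right[OF assms(2) s] pt]) (use p q sl(4,5) in \<open>simp add: row_def\<close>)
      moreover have "k + inputs a + q < ?l" using p q sl(4,5) by (simp add: row_def)
      ultimately show ?thesis using p q sl(4,5) by (simp add: row_def nth_append)
    qed
  qed (use sl(4,5) in \<open>simp add: row_def\<close>)
  moreover have "?v \<in> local_colours a (take (inputs a) (drop k (row D f i)))"
  proof (cases a)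
    case (Cross c)
    have "take 2 (drop k (row D f i)) = [f (i, k), f (i, Suc k)]"
      using sl(4) Cross by (intro nth_equalityI) (auto simp: row_def less_Suc_eq numeral_2_eq_2)
    moreover have "f (i, k) = f (Suc i, Suc k)" "f (i, Suc k) = f (Suc i, k)"
      using assms(3)[OF adjacent.cross1[OF assms(2)] pt] assms(3)[OF adjacent.cross2[OF assms(2)] pt] s Cross sl(4) by auto
    ultimately show ?thesis using Cross by (simp add: numeral_2_eq_2)
  next
    case (Cup b)
    have "f (Suc i, k) = f (Suc i, Suc k)"
      using assms(3)[OF adjacent.cup[OF assms(2)]] s Cup sl(4,5) assms(2) by (auto simp: points_def)
    then show ?thesis using Cup by (simp add: numeral_2_eq_2)
  next
    case Cap
    have "take 2 (drop k (row D f i)) = [f (i, k), f (i, Suc k)]"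
      using sl(4) Cap by (intro nth_equalityI) (auto simp: row_def less_Suc_eq numeral_2_eq_2)
    moreover have "f (i, k) = f (i, Suc k)"
      using assms(3)[OF adjacent.cap[OF assms(2)] pt] s Cap sl(4) by auto
    ultimately show ?thesis using Cap by simp
  qed
  ultimately show ?thesis unfolding s colour_step.simps by blast
qed

lemma row_path:
  assumes "link_diagram D" "\<And>x y. adjacent D x y \<Longrightarrow> x \<in> points D \<Longrightarrow> f x = f y" "i \<le> length D"
  shows "colour_path (take i D) [] (row D f i)" "colour_path (drop i D) (row D f i) []"
proof -
  have step: "row D f (Suc i) \<in> colour_step (D ! i) (row D f i)" if "i < length D" for i
    by (rule row_step[OF assms(1) that assms(2)])
  show "colour_path (take i D) [] (row D f i)" using assms(3)
  proof (induction i)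
    case (Suc i)
    then show ?case using step[of i]
      by (auto simp: take_Suc_conv_app_nth colour_path_append simp del: colour_step.simps)
  qed (simp add: row_def strands_def)
  show "colour_path (drop i D) (row D f i) []" using assms(3)
  proof (induction "length D - i" arbitrary: i)
    case 0
    then show ?case using assms(1) by (simp add: row_def strands_def link_diagram_def)
  next
    case (Suc d)
    then have "i < length D" by simp
    moreover have "colour_path (drop (Suc i) D) (row D f (Suc i)) []" using Suc by simp
    ultimately show ?case using step[of i]
      by (auto simp: Cons_nth_drop_Suc[symmetric] simp del: colour_step.simps)
  qed
qed

text \<open>
  Let \<open>u\<close> be the colours below the crossing when one of the two components is
  coloured \<open>True\<close>. Comparing the parity of the overlap with \<open>u\<close> below
  and above the crossing shows that any colouring of the smoothing gives the two strands the same
  colour: smoothing joins the components. So every colouring of the smoothing gives one of the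
  diagram with the crossing, and the colouring that continues \<open>u\<close> is not among them.
\<close>

lemma colourings_mixed:
  assumes "link_diagram (pos_diagram X k Y)"
    "\<not> same_component (pos_diagram X k Y) (length X, k) (length X, Suc k)"
  shows "colourings (smooth_diagram X k Y) [] < colourings (pos_diagram X k Y) []"
proof -
  let ?D = "pos_diagram X k Y"
  \<comment> \<open>the colouring by the component of the left strand at the crossing\<close>
  define f where "f = same_component ?D (length X, k)"
  obtain st st' where st: "run X [] = Some st" "slice_step (k, Cross (parallel X k)) st = Some st'" "run Y st' = Some []"
    using assms(1) by (auto simp: link_diagram_def pos_diagram_def run_append bind_eq_Some_conv simp del: slice_step.simps)
  have k: "Suc k < length st" using st(2) by (auto split: if_splits)
  have st'_len: "length st' = length st" using slice_step_fit[OF st(2)] k by auto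
  have fadj: "f x = f y" if "adjacent ?D x y" "x \<in> points ?D" for x y
    unfolding f_def same_component_def
    using that adjacent_points[OF assms(1) that(1)] 
    by (meson equivclp_sym equivclp_trans r_into_equivclp)
  have tk: "take (length X) ?D = X" "drop (length X) ?D = (k, Cross (parallel X k)) # Y" by (simp_all add: pos_diagram_def)
  have strands: "strands X = st" using st(1) by (simp add: strands_def)
  define u where "u = row ?D f (length X)"
  have lu: "length u = length st" by (simp add: u_def row_def tk strands)
  have "(length X, k) \<in> points ?D" using k by (simp add: points_def tk strands, simp add: pos_diagram_def)
  then have "f (length X, k)" by (simp add: f_def same_component_def)
  moreover have "\<not> f (length X, Suc k)" using assms(2) by (simp add: f_def)
  ultimately have uk: "u ! k" "\<not> u ! Suc k" using k by (simp_all add: u_def row_def tk strands)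
  have path: "colour_path X [] u" "colour_path ((k, Cross (parallel X k)) # Y) u []"
    using row_path[of ?D f "length X", OF assms(1) fadj] tk by (simp_all add: u_def pos_diagram_def)
  obtain xs a b zs where "u = xs @ a # b # zs" "length xs = k"
    by (rule length_ge_2_split[of k u]) (use k lu in auto)
  then have u: "u = xs @ True # False # zs" "length xs = k"
    using uk by auto
  have pathY: "colour_path Y (xs @ False # True # zs) []"
    using path(2) u colour_step_append[of xs k "[True, False]" "Cross (parallel X k)" zs] by (simp del: colour_step.simps)
  have fitX: "fit X 0 = Some (length st)" using run_fit[OF st(1)] by simp
  have fitY: "fit Y (length st) = Some 0" using run_fit[OF st(3)] st'_len by simp
  have len: "length v = length st" if "colour_path X [] v" for v
    using overlap_path[OF that path(1)] fitX by simp
  have ov: "even (overlap u v)" if "colour_path X [] v" for v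
    using overlap_path[OF path(1) that] fitX by simp
  have ov': "even (overlap (xs @ False # True # zs) v)" if "colour_path Y v []" "length v = length st" for v
    using overlap_path[OF pathY that(1)] that(2) u lu fitY by auto
  have smooth: "smooth_diagram X k Y = X @ (if parallel X k then Y else (k, Cap) # (k, Cup (strands X ! Suc k)) # Y)"
    by (simp add: smooth_diagram_def)
  have pos: "?D = X @ ((k, Cross (parallel X k)) # Y)" by (simp add: pos_diagram_def)
  let ?Z = "if parallel X k then Y else (k, Cap) # (k, Cup (strands X ! Suc k)) # Y"
  have val: "colourings ?Z v = (if a = b then colourings Y v else 0)"
    if v: "colour_path X [] v" "v = ys @ a # b # ws" "length ys = k" for v ys a b ws
  proof -
    have l: "length ys = length xs" "length ws = length zs" using len[OF v(1)] v lu u by auto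
    have *: "a = c" if "colour_path Y (ys @ d # c # ws) []" "a = b \<and> c = d \<or> a = d \<and> b = c" for c d
      using ov[OF v(1)] ov'[OF that(1)] that(2) len[OF v(1)] l by (auto simp: u(1) v(2) split: if_splits)
    show ?thesis
    proof (cases "parallel X k")
      case True
      then show ?thesis using *[of a b] colourings_pos_iff[of Y v] v(2) by auto
    next
      case False
      have "colourings Y (ys @ (\<not> a) # (\<not> a) # ws) = 0" if "a = b"
        using *[of "\<not> a" "\<not> a"] that colourings_pos_iff[of Y "ys @ (\<not> a) # (\<not> a) # ws"] by auto
      then show ?thesis using False v by (cases a; cases b) (simp_all del: colourings.simps)
    qed
  qed
  have val': "colourings ((k, Cross (parallel X k)) # Y) (ys @ a # b # ws) = colourings Y (ys @ b # a # ws)"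
    if "length ys = k" for ys a b ws using that by (simp del: colourings.simps)
  show ?thesis unfolding smooth pos
  proof (rule colourings_prefix_strict_mono)
    fix v assume v: "colour_path X [] v"
    obtain ys a b ws where v': "v = ys @ a # b # ws" "length ys = k"
      using length_ge_2_split[of k v] len[OF v] k by metis
    show "colourings ?Z v \<le> colourings ((k, Cross (parallel X k)) # Y) v"
      unfolding val[OF v v'] unfolding v' val'[OF v'(2)] by simp
  next
    show "colour_path X [] u" by (rule path)
    show "colourings ?Z u < colourings ((k, Cross (parallel X k)) # Y) u"
      unfolding val[OF path(1) u] unfolding u(1) val'[OF u(2)] using pathY colourings_pos_iff by simp
  qed
qed

text \<open>
  The colourings themselves, listed height by height above the bottom line.
\<close>

fun colour_rows :: "diagram \<Rightarrow> bool list \<Rightarrow> bool list list set" where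
  "colour_rows [] cs = (if cs = [] then {[]} else {})"
| "colour_rows (s # D) cs = (\<Union>ds\<in>colour_step s cs. (#) ds ` colour_rows D ds)"

lemma card_colour_rows: "finite (colour_rows D cs) \<and> card (colour_rows D cs) = colourings D cs"
proof (induction D arbitrary: cs)
  case (Cons s D)
  have "card (colour_rows (s # D) cs) = (\<Sum>ds\<in>colour_step s cs. card ((#) ds ` colour_rows D ds))"
    unfolding colour_rows.simps by (rule card_UN_disjoint) (use Cons in \<open>auto simp del: colour_step.simps\<close>)
  also have "\<dots> = colourings (s # D) cs"
    unfolding colourings.simps by (intro sum.cong refl) (simp add: card_image Cons)
  finally show ?case using Cons by (auto simp del: colour_step.simps)
qed auto

lemma colour_rows_iff:
  "r \<in> colour_rows D cs \<longleftrightarrow> length r = length D \<and> last (cs # r) = [] \<and> (\<forall>i<length D. r ! i \<in> colour_step (D ! i) ((cs # r) ! i))"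
proof (induction D arbitrary: cs r)
  case (Cons s D)
  show ?case
  proof (cases r)
    case (Cons d r')
    have "r \<in> colour_rows (s # D) cs \<longleftrightarrow> d \<in> colour_step s cs \<and> r' \<in> colour_rows D d"
      by (auto simp: Cons simp del: colour_step.simps)
    also have "\<dots> \<longleftrightarrow> length r = length (s # D) \<and> last (cs # r) = [] \<and> (\<forall>i<length (s # D). r ! i \<in> colour_step ((s # D) ! i) ((cs # r) ! i))"
      unfolding Cons.IH[of r' d] by (auto simp: Cons All_less_Suc2 simp del: colour_step.simps)
    finally show ?thesis .
  qed auto
qed (auto split: if_splits)

lemma same_component_const:
  assumes "link_diagram D" "\<And>x y. adjacent D x y \<Longrightarrow> x \<in> points D \<Longrightarrow> f x = f y" "same_component D x y"
  shows "f x = f y"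
proof -
  have "equivclp (adjacent D) x y" "x \<in> points D" using assms(3) by (auto simp: same_component_def)
  then have "y \<in> points D \<and> f x = f y"
  proof (induction rule: equivclp_induct)
    case (step y z)
    then show ?case using adjacent_points[OF assms(1)] assms(2) by metis
  qed simp
  then show ?thesis by simp
qed

text \<open>
  A colouring is constant on components, so that a knot has just the two constant ones.
\<close>

lemma colourings_knot:
  assumes "knot_diagram D" shows "colourings D [] = 2"
proof -
  have D: "link_diagram D" "card (components D) = 1" using assms by (auto simp: knot_diagram_def)
  have refl: "same_component D x x" if "x \<in> points D" for x using that by (simp add: same_component_def)
  obtain c where c: "components D = {c}" using D(2) card_1_singletonE by blast
  have same: "same_component D x y" if "x \<in> points D" "y \<in> points D" for x y
  proof -
    have "{(x, y). same_component D x y} `` {z} = c" if "z \<in> points D" for z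
      using quotientI[OF that, of "{(x, y). same_component D x y}"] c by (simp add: components_def)
    from this[OF that(1)] this[OF that(2)] show ?thesis using refl[OF that(2)] by blast
  qed
  obtain x0 where x0: "x0 \<in> points D"
  proof -
    from c have "components D \<noteq> {}" by simp
    then have "points D \<noteq> {}" by (auto simp: components_def)
    then show ?thesis using that by blast
  qed
  define R where "R b = map (\<lambda>i. row D (\<lambda>_. b) (Suc i)) [0..<length D]" for b :: bool
  have R_nth: "([] # R b) ! i = row D (\<lambda>_. b) i" if "i \<le> length D" for b i
    using that by (cases i) (auto simp: R_def row_def strands_def)
  have strands_last: "strands D = []" using D by (simp add: strands_def link_diagram_def)
  have "R b \<in> colour_rows D []" for b
    unfolding colour_rows_iff
  proof (intro conjI allI impI)
    show "length (R b) = length D" by (simp add: R_def)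
    moreover have "last ([] # R b) = ([] # R b) ! length (R b)"
      using last_conv_nth[of "[] # R b"] by simp
    ultimately show "last ([] # R b) = []" using R_nth[of "length D" b] strands_last
      by (simp add: row_def)
    fix i assume i: "i < length D"
    then have "R b ! i = row D (\<lambda>_. b) (Suc i)" by (simp add: R_def)
    then show "R b ! i \<in> colour_step (D ! i) (([] # R b) ! i)"
      using row_step[OF D(1) i, of "\<lambda>_. b"] R_nth[of i b] i by (simp del: colour_step.simps)
  qed
  moreover have "r \<in> {R True, R False}" if r: "r \<in> colour_rows D []" for r
  proof -
    have lr: "length r = length D" "\<And>i. i < length D \<Longrightarrow> r ! i \<in> colour_step (D ! i) (([] # r) ! i)"
      using r unfolding colour_rows_iff by auto
    define f where "f = (\<lambda>(i, p). ([] # r) ! i ! p)"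
    have lens: "length (([] # r) ! i) = length (strands (take i D))" if "i \<le> length D" for i
      using that
    proof (induction i)
      case (Suc i)
      obtain k a where s: "D ! i = (k, a)" by force
      have i: "i < length D" using Suc by simp
      note sl = link_diagram_slice[OF D(1) i s]
      have "length (r ! i) = length (([] # r) ! i) - inputs a + outputs a"
        using lr(2)[OF i] Suc.IH i sl(4) unfolding s by (elim colour_stepE) auto
      then show ?case using Suc sl(5) by simp
    qed (simp add: strands_def)
    have f: "f x = f y" if "adjacent D x y" "x \<in> points D" for x y
    proof -
      have split: "\<exists>xs ys zs v. ([] # r) ! i = xs @ ys @ zs \<and> r ! i = xs @ v @ zs \<and> length xs = k \<and> length ys = inputs a \<and>
          v \<in> local_colours a ys \<and> length v = outputs a" if i: "i < length D" and s: "D ! i = (k, a)" for i k a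
      proof -
        have "k + inputs a \<le> length (([] # r) ! i)" using link_diagram_slice(4)[OF D(1) i s] lens[of i] i by simp
        with lr(2)[OF i] show ?thesis unfolding s by (elim colour_stepE) blast+
      qed
      show ?thesis using that(1)
      proof cases
        case (left i k a p)
        then show ?thesis using split[OF left(3,4)] by (auto simp: f_def nth_append)
      next
        case (right i k a p)
        then show ?thesis using split[OF right(3,4)] by (auto simp: f_def nth_append)
      next
        case (cross1 i k c)
        obtain xs ys zs v where "([] # r) ! i = xs @ ys @ zs" "r ! i = xs @ v @ zs" "length xs = k" "v \<in> local_colours (Cross c) ys"
          using split[OF cross1(3,4)] by blast
        then show ?thesis using cross1 by (cases "(Cross c, ys)" rule: local_colours.cases) (auto simp: f_def nth_append)
      next
        case (cross2 i k c)
        obtain xs ys zs v where "([] # r) ! i = xs @ ys @ zs" "r ! i = xs @ v @ zs" "length xs = k" "v \<in> local_colours (Cross c) ys"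
          using split[OF cross2(3,4)] by blast
        then show ?thesis using cross2 by (cases "(Cross c, ys)" rule: local_colours.cases) (auto simp: f_def nth_append)
      next
        case (cup i k b)
        obtain xs ys zs v where "([] # r) ! i = xs @ ys @ zs" "r ! i = xs @ v @ zs" "length xs = k" "v \<in> local_colours (Cup b) ys"
          using split[OF cup(3,4)] by blast
        then show ?thesis using cup by (cases "(Cup b, ys)" rule: local_colours.cases) (auto simp: f_def nth_append)
      next
        case (cap i k)
        obtain xs ys zs v where "([] # r) ! i = xs @ ys @ zs" "r ! i = xs @ v @ zs" "length xs = k" "v \<in> local_colours Cap ys"
          using split[OF cap(3,4)] by blast
        then show ?thesis using cap by (cases "(Cap, ys)" rule: local_colours.cases) (auto simp: f_def nth_append split: if_splits)
      qed
    qed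
    have const: "f x = f x0" if "x \<in> points D" for x
      by (rule same_component_const[where f = f, OF D(1) f same[OF that x0]])
    have "r = R (f x0)"
    proof (rule nth_equalityI)
      fix i assume "i < length r"
      then have i: "i < length D" using lr by simp
      show "r ! i = R (f x0) ! i"
      proof (rule nth_equalityI)
        show len: "length (r ! i) = length (R (f x0) ! i)" using lens[of "Suc i"] i by (simp add: R_def row_def)
        fix p assume p: "p < length (r ! i)"
        then have "(Suc i, p) \<in> points D" using i lens[of "Suc i"] by (simp add: points_def)
        from const[OF this] have "r ! i ! p = f x0" by (simp add: f_def)
        moreover have "R (f x0) ! i = row D (\<lambda>_. f x0) (Suc i)" using i by (simp add: R_def)
        moreover have "row D (\<lambda>_. f x0) (Suc i) ! p = f x0"
          using p len calculation(2) by (simp add: row_def)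
        ultimately show "r ! i ! p = R (f x0) ! i ! p" by simp
      qed
    qed (simp add: lr R_def)
    then show ?thesis by (cases "f x0") auto
  qed
  ultimately have "colour_rows D [] = {R True, R False}" by blast
  moreover have "R True \<noteq> R False"
  proof
    assume eq: "R True = R False"
    obtain i p where ip: "x0 = (i, p)" by force
    have "row D (\<lambda>_. True) i = row D (\<lambda>_. False) i" using R_nth[of i True] R_nth[of i False] x0 eq ip by (auto simp: points_def)
    then have "row D (\<lambda>_. True) i ! p = row D (\<lambda>_. False) i ! p" by simp
    then show False using x0 ip by (simp add: row_def points_def)
  qed
  ultimately show ?thesis using card_colour_rows[of D "[]"] by simp
qed

abbreviation word_monomial :: "yh_gen list \<Rightarrow> yh_free" where
  "word_monomial l \<equiv> Poly_Mapping.single (Word l) 1"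

section \<open>Congruence modulo the Yokonuma-Hecke relations\<close>

lemma poly_mapping_sum_single: "x = (\<Sum>w\<in>Poly_Mapping.keys x. Poly_Mapping.single w (Poly_Mapping.lookup x w))"
  by (rule poly_mapping_eqI) (auto simp: lookup_sum lookup_single when_def sum.delta in_keys_iff)

lemma sum_keys_add:
  fixes f :: "'a \<Rightarrow> 'b :: comm_monoid_add \<Rightarrow> 'c :: comm_monoid_add"
  assumes "\<And>w. f w 0 = 0" "\<And>w a b. f w (a + b) = f w a + f w b"
  shows "(\<Sum>w\<in>Poly_Mapping.keys (x + y). f w (Poly_Mapping.lookup (x + y) w)) =
    (\<Sum>w\<in>Poly_Mapping.keys x. f w (Poly_Mapping.lookup x w)) + (\<Sum>w\<in>Poly_Mapping.keys y. f w (Poly_Mapping.lookup y w))"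
proof -
  have *: "(\<Sum>w\<in>Poly_Mapping.keys u. f w (Poly_Mapping.lookup u w)) =
      (\<Sum>w\<in>Poly_Mapping.keys x \<union> Poly_Mapping.keys y. f w (Poly_Mapping.lookup u w))"
    if "Poly_Mapping.keys u \<subseteq> Poly_Mapping.keys x \<union> Poly_Mapping.keys y" for u
    by (rule sum.mono_neutral_left) (use that assms(1) in \<open>auto simp: in_keys_iff\<close>)
  show ?thesis
    unfolding *[OF Poly_Mapping.keys_add] *[of x, OF Un_upper1] *[of y, OF Un_upper2]
    by (simp add: lookup_add assms(2) sum.distrib)
qed

lemma word_monomial_Nil: "word_monomial [] = 1"
  by (simp flip: zero_yh_word_def single_one)

lemma word_monomial_mult: "word_monomial l * word_monomial m = word_monomial (l @ m)"
  by (simp add: mult_single plus_yh_word_def)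

lemma scal_single: "scal c * Poly_Mapping.single w a = Poly_Mapping.single w (c * a)"
  by (simp add: scal_def mult_single)

lemma single_scal: "Poly_Mapping.single w a * scal c = Poly_Mapping.single w (c * a)"
  by (simp add: scal_def mult_single mult.commute)

lemma scal_0 [simp]: "scal 0 = 0" and scal_1 [simp]: "scal 1 = 1"
  by (simp_all add: scal_def)

lemma scal_add: "scal (a + b) = scal a + scal b" and scal_mult: "scal (a * b) = scal a * scal b"
  and scal_uminus: "scal (- a) = - scal a"
  by (simp_all add: scal_def single_add mult_single single_uminus)

text \<open>
  Scalars are central although the free algebra is not commutative.
\<close>

lemma scal_commute: "scal c * x = x * scal c"
proof -
  have "scal c * (\<Sum>w\<in>Poly_Mapping.keys x. Poly_Mapping.single w (Poly_Mapping.lookup x w)) =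
        (\<Sum>w\<in>Poly_Mapping.keys x. Poly_Mapping.single w (Poly_Mapping.lookup x w)) * scal c"
    by (simp add: sum_distrib_left sum_distrib_right scal_single single_scal)
  then show ?thesis by (simp flip: poly_mapping_sum_single)
qed

lemma scal_left_commute: "x * (scal c * y) = scal c * (x * y)"
  by (metis mult.assoc scal_commute)

lemma yh_g_eq: "yh_g i = word_monomial [G i]" and yh_t_eq: "yh_t i = word_monomial [T i]"
  by (simp_all add: yh_g_def yh_t_def)

lemma free_on_mult: 
  assumes "x \<in> yh_free_on n" "y \<in> yh_free_on n" shows "x * y \<in> yh_free_on n"
  unfolding yh_free_on_def
proof safe
  fix w a assume "w \<in> Poly_Mapping.keys (x * y)" and a: "a \<in> set (letters w)"
  then obtain u v where "w = u + v" "u \<in> Poly_Mapping.keys x" "v \<in> Poly_Mapping.keys y"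
    using keys_mult[of x y] by blast
  then show "a \<in> yh_gens n" using a assms by (auto simp: yh_free_on_def plus_yh_word_def)
qed

lemma free_on_add: 
  assumes "x \<in> yh_free_on n" "y \<in> yh_free_on n" shows "x + y \<in> yh_free_on n"
  using assms Poly_Mapping.keys_add[of x y] by (auto simp: yh_free_on_def)

lemma free_on_single: "set l \<subseteq> yh_gens n \<Longrightarrow> Poly_Mapping.single (Word l) c \<in> yh_free_on n"
  by (auto simp: yh_free_on_def)

lemma free_on_scal [simp]: "scal c \<in> yh_free_on n"
  using free_on_single[of "[]" n c] by (simp add: scal_def zero_yh_word_def)

lemma free_on_0 [simp]: "0 \<in> yh_free_on n" by (simp add: yh_free_on_def)
lemma free_on_1 [simp]: "1 \<in> yh_free_on n" using free_on_scal[of 1 n] by simp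

lemma free_on_uminus: "x \<in> yh_free_on n \<Longrightarrow> - x \<in> yh_free_on n"
  using free_on_mult[OF free_on_scal[of "-1"], of x n] by (simp add: scal_uminus)

lemma free_on_diff: "x \<in> yh_free_on n \<Longrightarrow> y \<in> yh_free_on n \<Longrightarrow> x - y \<in> yh_free_on n"
  using free_on_add[OF _ free_on_uminus, of x n y] by simp

lemma free_on_power: "x \<in> yh_free_on n \<Longrightarrow> x ^ k \<in> yh_free_on n"
  by (induction k) (auto intro: free_on_mult)

lemma free_on_sum: "(\<And>i. i \<in> A \<Longrightarrow> f i \<in> yh_free_on n) \<Longrightarrow> sum f A \<in> yh_free_on n"
  by (induction A rule: infinite_finite_induct) (auto intro: free_on_add)

lemma gens_mono: "n \<le> m \<Longrightarrow> yh_gens n \<subseteq> yh_gens m" by (auto simp: yh_gens_def)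
lemma free_on_mono: "x \<in> yh_free_on n \<Longrightarrow> n \<le> m \<Longrightarrow> x \<in> yh_free_on m"
  using gens_mono by (fastforce simp: yh_free_on_def)

lemma free_on_g: "Suc i < n \<Longrightarrow> yh_g i \<in> yh_free_on n"
  unfolding yh_g_eq by (rule free_on_single) (auto simp: yh_gens_def)
lemma free_on_t: "j < n \<Longrightarrow> yh_t j \<in> yh_free_on n"
  unfolding yh_t_eq by (rule free_on_single) (auto simp: yh_gens_def)

lemmas free_on_intros = free_on_mult free_on_add free_on_diff free_on_uminus free_on_power free_on_sum
  free_on_g free_on_t

lemma free_on_e: "Suc i < n \<Longrightarrow> yh_e d i \<in> yh_free_on n"
  unfolding yh_e_def by (intro free_on_intros free_on_scal) auto
lemma free_on_ginv: "Suc i < n \<Longrightarrow> yh_ginv d q i \<in> yh_free_on n"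
  unfolding yh_ginv_def by (intro free_on_intros free_on_scal free_on_e) auto

text \<open>
  Linear statements need only be checked on words.
\<close>

lemma free_on_induct [consumes 1, case_names monomial add]:
  assumes "x \<in> yh_free_on n"
    and "\<And>c l. set l \<subseteq> yh_gens n \<Longrightarrow> Q (scal c * word_monomial l)"
    and "\<And>x y. x \<in> yh_free_on n \<Longrightarrow> y \<in> yh_free_on n \<Longrightarrow> Q x \<Longrightarrow> Q y \<Longrightarrow> Q (x + y)"
  shows "Q x"
proof -
  have *: "(\<Sum>w\<in>A. Poly_Mapping.single w (Poly_Mapping.lookup x w)) \<in> yh_free_on n \<and> Q (\<Sum>w\<in>A. Poly_Mapping.single w (Poly_Mapping.lookup x w))"
    if "finite A" "A \<subseteq> Poly_Mapping.keys x" for A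
    using that
  proof (induction A)
    case empty
    then show ?case using assms(2)[of "[]" 0] by simp
  next
    case (insert w A)
    obtain l where w: "w = Word l" by (cases w)
    have "w \<in> Poly_Mapping.keys x" using insert by simp
    from bspec[OF assms(1)[unfolded yh_free_on_def mem_Collect_eq] this] have "set l \<subseteq> yh_gens n" by (simp add: w)
    then show ?case using insert assms(2)[of l "Poly_Mapping.lookup x w"] assms(3) free_on_single[of l n "Poly_Mapping.lookup x w"]
      by (simp add: w scal_single free_on_add)
  qed
  show ?thesis using *[of "Poly_Mapping.keys x"] by (simp flip: poly_mapping_sum_single)
qed

lemma ideal_uminus: "x \<in> yh_ideal d q n \<Longrightarrow> - x \<in> yh_ideal d q n"
proof (induction rule: yh_ideal.induct)
  case (add x y)
  then show ?case using yh_ideal.add[of "- x" d q n "- y"] by simp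
next
  case (gen a r b)
  then show ?case using yh_ideal.gen[of "- a" n r d q b] free_on_uminus by simp
qed (auto intro: yh_ideal.zero)

lemma ideal_left: "x \<in> yh_ideal d q n \<Longrightarrow> c \<in> yh_free_on n \<Longrightarrow> c * x \<in> yh_ideal d q n"
proof (induction rule: yh_ideal.induct)
  case (gen a r b)
  then show ?case using yh_ideal.gen[of "c * a" n r d q b] free_on_mult by (simp add: mult.assoc)
qed (auto intro: yh_ideal.intros simp: algebra_simps)

lemma ideal_right: "x \<in> yh_ideal d q n \<Longrightarrow> c \<in> yh_free_on n \<Longrightarrow> x * c \<in> yh_ideal d q n"
proof (induction rule: yh_ideal.induct)
  case (gen a r b)
  then show ?case using yh_ideal.gen[of "a" n r d q "b * c"] free_on_mult by (simp add: mult.assoc)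
qed (auto intro: yh_ideal.intros simp: algebra_simps)

lemma relators_mono: "r \<in> yh_relators d q n \<Longrightarrow> n \<le> m \<Longrightarrow> r \<in> yh_relators d q m"
  by (induction rule: yh_relators.induct) (auto intro: yh_relators.intros)

lemma ideal_mono: "x \<in> yh_ideal d q n \<Longrightarrow> n \<le> m \<Longrightarrow> x \<in> yh_ideal d q m"
  by (induction rule: yh_ideal.induct) (auto intro: yh_ideal.intros relators_mono free_on_mono)

lemma relator_ideal: "r \<in> yh_relators d q n \<Longrightarrow> r \<in> yh_ideal d q n"
  using yh_ideal.gen[of 1 n r d q 1] by simp

definition yh_cong :: "nat \<Rightarrow> complex \<Rightarrow> nat \<Rightarrow> yh_free \<Rightarrow> yh_free \<Rightarrow> bool" where
  "yh_cong d q n x y \<longleftrightarrow> x - y \<in> yh_ideal d q n"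

context fixes d :: nat and q :: complex
begin

abbreviation cong_modulo_ideal ("(_ \<equiv>\<^bsub>_\<^esub> _)" [51, 0, 51] 50) where "x \<equiv>\<^bsub>n\<^esub> y \<equiv> yh_cong d q n x y"

lemma cong_refl [simp]: "x \<equiv>\<^bsub>n\<^esub> x" by (simp add: yh_cong_def yh_ideal.zero)
lemma cong_sym: "x \<equiv>\<^bsub>n\<^esub> y \<Longrightarrow> y \<equiv>\<^bsub>n\<^esub> x" using ideal_uminus[of "x - y"] by (simp add: yh_cong_def)
lemma cong_trans [trans]: "x \<equiv>\<^bsub>n\<^esub> y \<Longrightarrow> y \<equiv>\<^bsub>n\<^esub> z \<Longrightarrow> x \<equiv>\<^bsub>n\<^esub> z"
  using yh_ideal.add[of "x - y" d q n "y - z"] by (simp add: yh_cong_def)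
lemma cong_add: "x \<equiv>\<^bsub>n\<^esub> y \<Longrightarrow> x' \<equiv>\<^bsub>n\<^esub> y' \<Longrightarrow> x + x' \<equiv>\<^bsub>n\<^esub> y + y'"
  using yh_ideal.add[of "x - y" d q n "x' - y'"] by (simp add: yh_cong_def algebra_simps)
lemma cong_left: "x \<equiv>\<^bsub>n\<^esub> y \<Longrightarrow> a \<in> yh_free_on n \<Longrightarrow> a * x \<equiv>\<^bsub>n\<^esub> a * y"
  using ideal_left[of "x - y" d q n a] by (simp add: yh_cong_def algebra_simps)
lemma cong_right: "x \<equiv>\<^bsub>n\<^esub> y \<Longrightarrow> a \<in> yh_free_on n \<Longrightarrow> x * a \<equiv>\<^bsub>n\<^esub> y * a"
  using ideal_right[of "x - y" d q n a] by (simp add: yh_cong_def algebra_simps)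
lemma cong_context: "x \<equiv>\<^bsub>n\<^esub> y \<Longrightarrow> a \<in> yh_free_on n \<Longrightarrow> b \<in> yh_free_on n \<Longrightarrow> a * x * b \<equiv>\<^bsub>n\<^esub> a * y * b"
  by (intro cong_left cong_right)
lemma cong_mult: "x \<equiv>\<^bsub>n\<^esub> y \<Longrightarrow> x' \<equiv>\<^bsub>n\<^esub> y' \<Longrightarrow> x' \<in> yh_free_on n \<Longrightarrow> y \<in> yh_free_on n \<Longrightarrow> x * x' \<equiv>\<^bsub>n\<^esub> y * y'"
  by (rule cong_trans[OF cong_right cong_left])
lemma cong_diff: "x \<equiv>\<^bsub>n\<^esub> y \<Longrightarrow> x' \<equiv>\<^bsub>n\<^esub> y' \<Longrightarrow> x - x' \<equiv>\<^bsub>n\<^esub> y - y'"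
  using yh_ideal.add[of "x - y" d q n "- (x' - y')"] ideal_uminus[of "x' - y'"] by (simp add: yh_cong_def algebra_simps)
lemma cong_scal: "x \<equiv>\<^bsub>n\<^esub> y \<Longrightarrow> scal c * x \<equiv>\<^bsub>n\<^esub> scal c * y" by (rule cong_left) auto
lemma cong_sum: "(\<And>i. i \<in> A \<Longrightarrow> f i \<equiv>\<^bsub>n\<^esub> g i) \<Longrightarrow> sum f A \<equiv>\<^bsub>n\<^esub> sum g A"
  by (induction A rule: infinite_finite_induct) (auto intro: cong_add)
lemma cong_mono: "x \<equiv>\<^bsub>n\<^esub> y \<Longrightarrow> n \<le> m \<Longrightarrow> x \<equiv>\<^bsub>m\<^esub> y" by (simp add: yh_cong_def ideal_mono)

lemma relation_braid: "i + 2 < n \<Longrightarrow> yh_g i * yh_g (Suc i) * yh_g i \<equiv>\<^bsub>n\<^esub> yh_g (Suc i) * yh_g i * yh_g (Suc i)"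
  unfolding yh_cong_def by (intro relator_ideal yh_relators.braid)
lemma relation_far: "Suc i < n \<Longrightarrow> Suc j < n \<Longrightarrow> \<bar>int i - int j\<bar> > 1 \<Longrightarrow> yh_g i * yh_g j \<equiv>\<^bsub>n\<^esub> yh_g j * yh_g i"
  unfolding yh_cong_def by (intro relator_ideal yh_relators.far)
lemma relation_comm: "i < n \<Longrightarrow> j < n \<Longrightarrow> yh_t i * yh_t j \<equiv>\<^bsub>n\<^esub> yh_t j * yh_t i"
  unfolding yh_cong_def by (intro relator_ideal yh_relators.comm)
lemma relation_swap: "Suc i < n \<Longrightarrow> j < n \<Longrightarrow> yh_t j * yh_g i \<equiv>\<^bsub>n\<^esub> yh_g i * yh_t (transpose i (Suc i) j)"
  unfolding yh_cong_def by (intro relator_ideal yh_relators.swap)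
lemma relation_torsion: "j < n \<Longrightarrow> yh_t j ^ d \<equiv>\<^bsub>n\<^esub> 1"
  unfolding yh_cong_def by (intro relator_ideal yh_relators.torsion)
lemma relation_quadratic: "Suc i < n \<Longrightarrow> yh_g i * yh_g i \<equiv>\<^bsub>n\<^esub> 1 + scal (q - inverse q) * yh_e d i * yh_g i"
  unfolding yh_cong_def using relator_ideal[OF yh_relators.quadratic[of i n q d]] by (simp add: power2_eq_square)

text \<open>
  The rule for moving \<open>x\<close> through \<open>y\<close>, which turns it into
  \<open>x'\<close>. Most computations consist of moving framings through braids and commuting
  elements past each other, and such rules compose along products of the \<open>y\<close> and of
  the \<open>x\<close>.
\<close>

definition intertwines :: "nat \<Rightarrow> yh_free \<Rightarrow> yh_free \<Rightarrow> yh_free \<Rightarrow> bool" where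
  "intertwines n x y x' \<longleftrightarrow> x \<in> yh_free_on n \<and> y \<in> yh_free_on n \<and> x' \<in> yh_free_on n \<and> x * y \<equiv>\<^bsub>n\<^esub> y * x'"

lemma intertwines_mult_right: "intertwines n x y x' \<Longrightarrow> intertwines n x' z x'' \<Longrightarrow> intertwines n x (y * z) x''"
proof -
  assume a: "intertwines n x y x'" "intertwines n x' z x''"
  have "(x * y) * z \<equiv>\<^bsub>n\<^esub> (y * x') * z" using a by (intro cong_right) (auto simp: intertwines_def)
  also have "(y * x') * z = y * (x' * z)" by (rule mult.assoc)
  also have "y * (x' * z) \<equiv>\<^bsub>n\<^esub> y * (z * x'')" using a by (intro cong_left) (auto simp: intertwines_def)
  finally show ?thesis using a by (auto simp: intertwines_def mult.assoc intro: free_on_mult)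
qed

lemma intertwines_mult_left: "intertwines n x y x' \<Longrightarrow> intertwines n z y z' \<Longrightarrow> intertwines n (x * z) y (x' * z')"
proof -
  assume a: "intertwines n x y x'" "intertwines n z y z'"
  have "x * (z * y) \<equiv>\<^bsub>n\<^esub> x * (y * z')" using a by (intro cong_left) (auto simp: intertwines_def)
  also have "x * (y * z') = (x * y) * z'" by (rule mult.assoc[symmetric])
  also have "(x * y) * z' \<equiv>\<^bsub>n\<^esub> (y * x') * z'" using a by (intro cong_right) (auto simp: intertwines_def)
  finally show ?thesis using a by (auto simp: intertwines_def mult.assoc intro: free_on_mult)
qed

lemma intertwines_add_left: "intertwines n x y x' \<Longrightarrow> intertwines n z y z' \<Longrightarrow> intertwines n (x + z) y (x' + z')"
  by (auto simp: intertwines_def distrib_left distrib_right intro: free_on_add cong_add)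
lemma intertwines_add_right: "intertwines n x y x' \<Longrightarrow> intertwines n x z x' \<Longrightarrow> intertwines n x (y + z) x'"
  by (auto simp: intertwines_def distrib_left distrib_right intro: free_on_add cong_add)
lemma intertwines_diff_right: "intertwines n x y x' \<Longrightarrow> intertwines n x z x' \<Longrightarrow> intertwines n x (y - z) x'"
  by (auto simp: intertwines_def left_diff_distrib right_diff_distrib intro: free_on_diff cong_diff)
lemma intertwines_scal_middle: "x \<in> yh_free_on n \<Longrightarrow> intertwines n x (scal c) x"
  by (simp add: intertwines_def scal_commute)
lemma intertwines_scal_left: "x \<in> yh_free_on n \<Longrightarrow> intertwines n (scal c) x (scal c)"
  by (simp add: intertwines_def scal_commute)
lemma intertwines_1: "x \<in> yh_free_on n \<Longrightarrow> intertwines n x 1 x" "x \<in> yh_free_on n \<Longrightarrow> intertwines n 1 x 1"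
  using intertwines_scal_middle[of x n 1] intertwines_scal_left[of x n 1] by simp_all
lemma intertwines_power_left: "intertwines n x y x' \<Longrightarrow> intertwines n (x ^ k) y (x' ^ k)"
proof (induction k)
  case 0
  then show ?case by (auto simp: intertwines_def)
qed (auto intro: intertwines_mult_left)
lemma intertwines_power_right: "intertwines n x y x \<Longrightarrow> intertwines n x (y ^ k) x"
proof (induction k)
  case 0
  then show ?case by (auto simp: intertwines_def)
qed (auto intro: intertwines_mult_right)
lemma intertwines_sum_left: "(\<And>i. i \<in> A \<Longrightarrow> intertwines n (f i) y (f' i)) \<Longrightarrow> y \<in> yh_free_on n \<Longrightarrow> intertwines n (sum f A) y (sum f' A)"
proof (induction A rule: infinite_finite_induct)
  case (insert i A)
  then show ?case by (simp add: intertwines_add_left)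
qed (simp_all add: intertwines_def)
lemma intertwines_sum_right: "(\<And>i. i \<in> A \<Longrightarrow> intertwines n x (f i) x') \<Longrightarrow> x \<in> yh_free_on n \<Longrightarrow> x' \<in> yh_free_on n \<Longrightarrow> intertwines n x (sum f A) x'"
proof (induction A rule: infinite_finite_induct)
  case (insert i A)
  then show ?case by (simp add: intertwines_add_right)
qed (simp_all add: intertwines_def)
lemma intertwines_sym: "intertwines n x y x \<Longrightarrow> intertwines n y x y"
  by (auto simp: intertwines_def intro: cong_sym)
lemma intertwinesD: "intertwines n x y x' \<Longrightarrow> x * y \<equiv>\<^bsub>n\<^esub> y * x'" by (simp add: intertwines_def)

lemma intertwines_t_t: "i < n \<Longrightarrow> j < n \<Longrightarrow> intertwines n (yh_t i) (yh_t j) (yh_t i)"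
  by (auto simp: intertwines_def intro: free_on_t relation_comm)
lemma transpose_less: "Suc i < n \<Longrightarrow> j < n \<Longrightarrow> transpose i (Suc i) j < n"
  by (auto simp: transpose_def)
lemma intertwines_t_g: "Suc i < n \<Longrightarrow> j < n \<Longrightarrow> intertwines n (yh_t j) (yh_g i) (yh_t (transpose i (Suc i) j))"
  by (auto simp: intertwines_def intro: free_on_t free_on_g relation_swap transpose_less)

lemma intertwines_free_on:
  assumes "x \<in> yh_free_on m" "m \<le> n" "y \<in> yh_free_on n"
    "\<And>i. Suc i < m \<Longrightarrow> intertwines n (yh_g i) y (yh_g i)" "\<And>j. j < m \<Longrightarrow> intertwines n (yh_t j) y (yh_t j)"
  shows "intertwines n x y x"
  using assms(1)
proof (induction rule: free_on_induct)
  case (monomial c l)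
  have "intertwines n (word_monomial l) y (word_monomial l)"
    using monomial
  proof (induction l)
    case Nil
    then show ?case using assms(3) by (simp add: word_monomial_Nil intertwines_1)
  next
    case (Cons a l)
    have "intertwines n (word_monomial [a]) y (word_monomial [a])"
      using Cons.prems assms(4,5) by (auto simp: yh_gens_def yh_g_eq yh_t_eq)
    moreover have "intertwines n (word_monomial l) y (word_monomial l)" using Cons by simp
    ultimately show ?case using intertwines_mult_left[of n "word_monomial [a]" y "word_monomial [a]" "word_monomial l" "word_monomial l"]
      by (simp add: word_monomial_mult)
  qed
  then show ?case by (intro intertwines_mult_left intertwines_scal_left assms(3))
qed (rule intertwines_add_left)

lemma intertwines_free_on_g: "x \<in> yh_free_on m \<Longrightarrow> Suc m < n \<Longrightarrow> intertwines n x (yh_g m) x"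
proof (rule intertwines_free_on)
  assume m: "Suc m < n"
  show "intertwines n (yh_g i) (yh_g m) (yh_g i)" if "Suc i < m" for i
    unfolding intertwines_def using that m by (auto intro!: free_on_g relation_far)
  show "intertwines n (yh_t j) (yh_g m) (yh_t j)" if "j < m" for j
    using intertwines_t_g[of m n j] that m by (simp add: transpose_def)
qed (auto intro: free_on_g)

lemma intertwines_free_on_t: "x \<in> yh_free_on m \<Longrightarrow> m < n \<Longrightarrow> intertwines n x (yh_t m) x"
proof (rule intertwines_free_on)
  assume m: "m < n"
  show "intertwines n (yh_g i) (yh_t m) (yh_g i)" if "Suc i < m" for i
  proof (rule intertwines_sym)
    show "intertwines n (yh_t m) (yh_g i) (yh_t m)"
      using intertwines_t_g[of i n m] that m by (simp add: transpose_def)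
  qed
  show "intertwines n (yh_t j) (yh_t m) (yh_t j)" if "j < m" for j
    using intertwines_t_t that m by simp
qed (auto intro: free_on_t)

section \<open>Spanning sets and uniqueness of Markov traces\<close>

text \<open>
  Elements on strands \<open>0, ..., n\<close> that are, modulo the relations, sums of elements on
  the first \<open>n\<close> strands multiplied by a framing of the last strand, or joined by a
  single generator involving it.
\<close>

inductive_set yh_span :: "nat \<Rightarrow> yh_free set" for n where
  zero: "0 \<in> yh_span n"
| add: "x \<in> yh_span n \<Longrightarrow> y \<in> yh_span n \<Longrightarrow> x + y \<in> yh_span n"
| framing: "a \<in> yh_free_on n \<Longrightarrow> a * yh_t n ^ k \<in> yh_span n"
| braiding: "n = Suc m \<Longrightarrow> a \<in> yh_free_on n \<Longrightarrow> b \<in> yh_free_on n \<Longrightarrow> a * yh_g m * b \<in> yh_span n"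
| cong: "x \<in> yh_span n \<Longrightarrow> x \<equiv>\<^bsub>Suc n\<^esub> y \<Longrightarrow> y \<in> yh_span n"

lemma span_scal: "x \<in> yh_span n \<Longrightarrow> scal c * x \<in> yh_span n"
proof (induction rule: yh_span.induct)
  case (framing a k)
  then show ?case using yh_span.framing[of "scal c * a" n k] by (simp add: mult.assoc free_on_mult)
next
  case (braiding m a b)
  then show ?case using yh_span.braiding[of n m "scal c * a" b] by (simp add: mult.assoc free_on_mult)
next
  case (cong x y)
  then show ?case using yh_span.cong cong_scal by blast
qed (auto intro: yh_span.zero yh_span.add simp: distrib_left)

lemma span_sum: "(\<And>i. i \<in> A \<Longrightarrow> f i \<in> yh_span n) \<Longrightarrow> sum f A \<in> yh_span n"
  by (induction A rule: infinite_finite_induct) (auto intro: yh_span.zero yh_span.add)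

lemma span_right_t:
  assumes "x \<in> yh_span n" "j < Suc n" shows "x * yh_t j \<in> yh_span n"
  using assms(1)
proof (induction rule: yh_span.induct)
  case (framing a k)
  show ?case
  proof (cases "j = n")
    case True
    then show ?thesis using yh_span.framing[OF framing, of "Suc k"] by (simp add: mult.assoc power_commutes)
  next
    case False
    then have "j < n" using assms by simp
    have 1: "a * (yh_t j * yh_t n ^ k) \<equiv>\<^bsub>Suc n\<^esub> a * (yh_t n ^ k * yh_t j)"
      by (intro cong_left intertwinesD intertwines_power_right intertwines_t_t) (use framing \<open>j < n\<close> free_on_mono in auto)
    have 2: "a * yh_t j * yh_t n ^ k \<in> yh_span n"
      by (intro yh_span.framing free_on_intros framing \<open>j < n\<close>)
    from yh_span.cong[OF 2[unfolded mult.assoc] 1[unfolded mult.assoc]] show ?thesis by (simp add: mult.assoc)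
  qed
next
  case (braiding m a b)
  show ?case
  proof (cases "j = n")
    case True
    have a: "a \<in> yh_free_on (Suc n)" "b \<in> yh_free_on (Suc n)" using braiding free_on_mono by auto
    have 1: "a * yh_t m * yh_g m * b \<in> yh_span n"
      by (intro yh_span.braiding braiding free_on_intros) (use braiding in auto)
    have 2: "a * (yh_t m * yh_g m) * b \<equiv>\<^bsub>Suc n\<^esub> a * (yh_g m * yh_t n) * b"
      using intertwinesD[OF intertwines_t_g[of m "Suc n" m]] braiding(1) a by (intro cong_context) (auto simp: transpose_def)
    have 3: "(a * yh_g m) * (yh_t n * b) \<equiv>\<^bsub>Suc n\<^esub> (a * yh_g m) * (b * yh_t n)"
      using braiding(1) a by (intro cong_left cong_sym[OF intertwinesD[OF intertwines_free_on_t[OF braiding(3)]]] free_on_intros) auto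
    from yh_span.cong[OF yh_span.cong[OF 1[unfolded mult.assoc] 2[unfolded mult.assoc]] 3[unfolded mult.assoc]]
    show ?thesis using True by (simp add: mult.assoc)
  next
    case False
    then have "b * yh_t j \<in> yh_free_on n" using assms by (intro free_on_mult braiding free_on_t) simp
    from yh_span.braiding[OF braiding(1,2) this] show ?thesis by (simp add: mult.assoc)
  qed
next
  case (cong x y)
  then show ?case using yh_span.cong cong_right[OF cong(2) free_on_t[OF assms(2)]] by blast
qed (auto intro: yh_span.zero yh_span.add simp: distrib_right)

lemma span_right_t_power: "x \<in> yh_span n \<Longrightarrow> j < Suc n \<Longrightarrow> x * yh_t j ^ k \<in> yh_span n"
proof (induction k)
  case (Suc k)
  then have "(x * yh_t j ^ k) * yh_t j \<in> yh_span n" by (intro span_right_t) auto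
  then show ?case by (simp add: mult.assoc power_commutes)
qed simp

text \<open>
  The quadratic relation gives one term without \<open>g\<^sub>m\<close> and terms with
  \<open>g\<^sub>m\<close> once, in which the framings of the last strand are moved to strand
  \<open>m\<close> behind \<open>g\<^sub>m\<close>.
\<close>

lemma span_g_square:
  assumes "n = Suc m" "a \<in> yh_free_on n"
  shows "a * (yh_g m * yh_g m) \<in> yh_span n"
proof -
  have aS: "a \<in> yh_free_on (Suc n)" using assms free_on_mono by auto
  have "a * (yh_t m ^ s * yh_t n ^ (d - s)) * yh_g m \<in> yh_span n" for s
  proof (rule yh_span.cong)
    show "a * yh_t m ^ s * yh_g m * yh_t m ^ (d - s) \<in> yh_span n"
      by (intro yh_span.braiding free_on_intros) (use assms in auto)
    have "(a * yh_t m ^ s) * (yh_t n ^ (d - s) * yh_g m) \<equiv>\<^bsub>Suc n\<^esub> (a * yh_t m ^ s) * (yh_g m * yh_t m ^ (d - s))"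
      using intertwinesD[OF intertwines_power_left[OF intertwines_t_g[of m "Suc n" n]]] assms aS
      by (intro cong_left) (auto simp: transpose_def intro!: free_on_intros)
    then show "a * yh_t m ^ s * yh_g m * yh_t m ^ (d - s) \<equiv>\<^bsub>Suc n\<^esub> a * (yh_t m ^ s * yh_t n ^ (d - s)) * yh_g m"
      by (simp add: mult.assoc cong_sym)
  qed
  then have "scal (q - inverse q) * (scal (1 / of_nat d) * (\<Sum>s<d. a * (yh_t m ^ s * yh_t n ^ (d - s)) * yh_g m)) \<in> yh_span n"
    by (intro span_scal span_sum)
  moreover have "a * (1 + scal (q - inverse q) * yh_e d m * yh_g m) = a * yh_t n ^ 0 +
     scal (q - inverse q) * (scal (1 / of_nat d) * (\<Sum>s<d. a * (yh_t m ^ s * yh_t n ^ (d - s)) * yh_g m))"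
  proof -
    let ?S = "\<Sum>s<d. yh_t m ^ s * yh_t n ^ (d - s)"
    have "a * (scal (q - inverse q) * (scal (1 / of_nat d) * ?S) * yh_g m) =
        scal (q - inverse q) * (scal (1 / of_nat d) * (a * ?S * yh_g m))"
      by (simp only: mult.assoc scal_left_commute[of a])
    also have "a * ?S * yh_g m = (\<Sum>s<d. a * (yh_t m ^ s * yh_t n ^ (d - s)) * yh_g m)"
      by (simp only: sum_distrib_left sum_distrib_right)
    finally show ?thesis by (simp add: yh_e_def assms(1) distrib_left)
  qed
  ultimately have "a * (1 + scal (q - inverse q) * yh_e d m * yh_g m) \<in> yh_span n"
    using yh_span.framing[OF assms(2), of 0] by (auto intro: yh_span.add)
  then show ?thesis
    by (rule yh_span.cong) (intro cong_left cong_sym[OF relation_quadratic] aS, use assms in simp)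
qed

text \<open>
  The critical product is \<open>a g\<^sub>m b g\<^sub>m\<close>. By the result for one strand
  less, \<open>b\<close> is a framing of its last strand, which leads to
  \<open>g\<^sub>m\<^sup>2\<close>, or contains \<open>g\<^sub>m\<^sub>-\<^sub>1\<close> once,
  where the braid relation applies.
\<close>

lemma span_right_g:
  assumes "x \<in> yh_span n" "i < n" "\<And>m. n = Suc m \<Longrightarrow> yh_free_on n \<subseteq> yh_span m"
  shows "x * yh_g i \<in> yh_span n"
  using assms(1)
proof (induction rule: yh_span.induct)
  case (framing a k)
  then have aS: "a \<in> yh_free_on (Suc n)" using free_on_mono by auto
  show ?case
  proof (cases "Suc i = n")
    case True
    have 1: "a * yh_g i * yh_t i ^ k \<in> yh_span n"
      by (intro yh_span.braiding free_on_intros) (use True framing in auto)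
    have 2: "a * (yh_g i * yh_t i ^ k) \<equiv>\<^bsub>Suc n\<^esub> a * (yh_t n ^ k * yh_g i)"
      using intertwinesD[OF intertwines_power_left[OF intertwines_t_g[of i "Suc n" n]]] True aS
      by - (rule cong_left[OF cong_sym], auto simp: transpose_def)
    from yh_span.cong[OF 1[unfolded mult.assoc] 2[unfolded mult.assoc]] show ?thesis by (simp add: mult.assoc)
  next
    case False
    then have i: "Suc i < n" using assms by simp
    have 1: "a * (yh_g i * yh_t n ^ k) \<equiv>\<^bsub>Suc n\<^esub> a * (yh_t n ^ k * yh_g i)"
      by (intro cong_left intertwinesD intertwines_power_right intertwines_free_on_t aS free_on_g i) simp
    have 2: "a * yh_g i * yh_t n ^ k \<in> yh_span n"
      by (intro yh_span.framing free_on_intros framing i)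
    from yh_span.cong[OF 2[unfolded mult.assoc] 1[unfolded mult.assoc]] show ?thesis by (simp add: mult.assoc)
  qed
next
  case (braiding m a b)
  show ?case
  proof (cases "i = m")
    case False
    then have "Suc i < n" using assms braiding by simp
    then have "b * yh_g i \<in> yh_free_on n" by (intro free_on_mult braiding free_on_g)
    from yh_span.braiding[OF braiding(1,2) this] show ?thesis by (simp add: mult.assoc)
  next
    case True
    have "b \<in> yh_span m" using assms(3)[OF braiding(1)] braiding(3) by blast
    then have "\<forall>a\<in>yh_free_on n. a * yh_g m * b * yh_g m \<in> yh_span n"
    proof (induction rule: yh_span.induct)
      case zero
      then show ?case by (auto intro: yh_span.zero)
    next
      case (add x y)
      then show ?case by (auto intro: yh_span.add simp: distrib_left distrib_right)
    next
      case (cong x y)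
      show ?case
      proof
        fix a assume a: "a \<in> yh_free_on n"
        have aS: "a \<in> yh_free_on (Suc n)" using a free_on_mono by auto
        have "(a * yh_g m) * x * yh_g m \<equiv>\<^bsub>Suc n\<^esub> (a * yh_g m) * y * yh_g m"
          using cong(2) aS braiding(1) by (intro cong_context cong_mono[OF cong(2)] free_on_intros) auto
        then show "a * yh_g m * y * yh_g m \<in> yh_span n" using cong.IH a yh_span.cong by blast
      qed
    next
      case (framing a' k)
      show ?case
      proof
        fix a assume a: "a \<in> yh_free_on n"
        have aS: "a \<in> yh_free_on (Suc n)" "a' \<in> yh_free_on (Suc n)" "a' \<in> yh_free_on n"
          using a framing braiding(1) free_on_mono by auto
        have 1: "(a * a') * (yh_g m * yh_g m) * yh_t n ^ k \<in> yh_span n"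
          by (intro span_right_t_power span_g_square braiding(1) free_on_mult a aS) simp
        have 2: "(a * a' * yh_g m) * (yh_g m * yh_t n ^ k) \<equiv>\<^bsub>Suc n\<^esub> (a * a' * yh_g m) * (yh_t m ^ k * yh_g m)"
          using intertwinesD[OF intertwines_power_left[OF intertwines_t_g[of m "Suc n" m]]] braiding(1) aS
          by - (rule cong_left[OF cong_sym], auto simp: transpose_def intro!: free_on_intros)
        have 3: "a * (a' * yh_g m) * (yh_t m ^ k * yh_g m) \<equiv>\<^bsub>Suc n\<^esub> a * (yh_g m * a') * (yh_t m ^ k * yh_g m)"
          using intertwinesD[OF intertwines_free_on_g[OF framing, of "Suc n"]] braiding(1) aS
          by (intro cong_context) (auto intro!: free_on_intros)
        from yh_span.cong[OF yh_span.cong[OF 1[unfolded mult.assoc] 2[unfolded mult.assoc]] 3[unfolded mult.assoc]]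
        show "a * yh_g m * (a' * yh_t m ^ k) * yh_g m \<in> yh_span n" by (simp add: mult.assoc)
      qed
    next
      case (braiding l a' b')
      show ?case
      proof
        fix a assume a: "a \<in> yh_free_on n"
        have n: "n = Suc m" by fact
        have aS: "a \<in> yh_free_on (Suc n)" "a' \<in> yh_free_on (Suc n)" "a' \<in> yh_free_on n" "b' \<in> yh_free_on (Suc n)" "b' \<in> yh_free_on n"
          using a braiding n free_on_mono by auto
        have 1: "(a * a' * yh_g l) * yh_g m * (yh_g l * b') \<in> yh_span n"
          by (intro yh_span.braiding free_on_mult a aS free_on_g) (use braiding n in auto)
        have 2: "(a * a') * (yh_g l * yh_g m * yh_g l) * b' \<equiv>\<^bsub>Suc n\<^esub> (a * a') * (yh_g m * yh_g l * yh_g m) * b'"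
          using relation_braid[of l "Suc n"] braiding(1) n aS by (intro cong_context free_on_mult) auto
        have 3: "(a * a' * yh_g m * yh_g l) * (yh_g m * b') \<equiv>\<^bsub>Suc n\<^esub> (a * a' * yh_g m * yh_g l) * (b' * yh_g m)"
          using intertwinesD[OF intertwines_free_on_g[OF braiding(3), of "Suc n"]] braiding(1) n aS
          by - (rule cong_left[OF cong_sym], auto intro!: free_on_intros)
        have 4: "a * (a' * yh_g m) * (yh_g l * b' * yh_g m) \<equiv>\<^bsub>Suc n\<^esub> a * (yh_g m * a') * (yh_g l * b' * yh_g m)"
          using intertwinesD[OF intertwines_free_on_g[OF braiding(2), of "Suc n"]] braiding(1) n aS
          by (intro cong_context) (auto intro!: free_on_intros)
        from yh_span.cong[OF yh_span.cong[OF yh_span.cong[OF 1[unfolded mult.assoc] 2[unfolded mult.assoc]] 3[unfolded mult.assoc]] 4[unfolded mult.assoc]]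
        show "a * yh_g m * (a' * yh_g l * b') * yh_g m \<in> yh_span n" by (simp add: mult.assoc)
      qed
    qed
    then show ?thesis using braiding True by blast
  qed
next
  case (cong x y)
  then show ?case using yh_span.cong cong_right[OF cong(2) free_on_g[of i "Suc n"]] assms(2) by simp
qed (auto intro: yh_span.zero yh_span.add simp: distrib_right)

text \<open>
  Modulo the relations every element on one more strand is a sum of elements to which the Markov
  property or the vanishing on framings applies.
\<close>

theorem free_on_subset_span: "yh_free_on (Suc n) \<subseteq> yh_span n"
proof (induction n)
  have *: "yh_free_on (Suc n) \<subseteq> yh_span n" if IH: "\<And>m. n = Suc m \<Longrightarrow> yh_free_on n \<subseteq> yh_span m" for n
  proof
    fix x assume "x \<in> yh_free_on (Suc n)"
    then show "x \<in> yh_span n"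
    proof (induction rule: free_on_induct)
      case (monomial c l)
      then have "word_monomial l \<in> yh_span n"
      proof (induction l rule: rev_induct)
        case Nil
        then show ?case using yh_span.framing[of 1 n 0] by (simp add: word_monomial_Nil)
      next
        case (snoc a l)
        then have l: "word_monomial l \<in> yh_span n" "a \<in> yh_gens (Suc n)" by auto
        have "word_monomial l * word_monomial [a] \<in> yh_span n"
        proof (cases a)
          case (G i)
          then show ?thesis using span_right_g[OF l(1) _ IH, of i] l(2) by (auto simp: yh_gens_def yh_g_eq)
        next
          case (T j)
          then show ?thesis using span_right_t[OF l(1), of j] l(2) by (auto simp: yh_gens_def yh_t_eq)
        qed
        then show ?case by (simp add: word_monomial_mult)
      qed
      then show ?case by (rule span_scal)
    qed (rule yh_span.add)
  qed
  { case 0 show ?case by (rule *) simp }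
  { case (Suc n) then show ?case by (intro *) auto }
qed

end

text \<open>
  The defining properties of the trace except its normalisation, for functionals \<open>h
  n\<close> that may depend on the number \<open>n\<close> of strands. The dependence on
  \<open>n\<close> accommodates values of link invariants on closures of braids with
  \<open>n\<close> strands; for \<open>d = 1\<close> these are the Markov traces on Hecke
  algebras.
\<close>

definition markov_family :: "nat \<Rightarrow> complex \<Rightarrow> complex \<Rightarrow> (nat \<Rightarrow> yh_free \<Rightarrow> complex) \<Rightarrow> bool" where
  "markov_family d q z h \<longleftrightarrow>
     (\<forall>n x y. h n (x + y) = h n x + h n y) \<and>
     (\<forall>n c x. h n (scal c * x) = c * h n x) \<and>
     (\<forall>n. \<forall>x \<in> yh_ideal d q n. h n x = 0) \<and>
     (\<forall>n. \<forall>a \<in> yh_free_on n. \<forall>b \<in> yh_free_on n. h n (a * b) = h n (b * a)) \<and>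
     (\<forall>n. \<forall>a \<in> yh_free_on n. h (Suc n) a = h n a) \<and>
     (\<forall>n. \<forall>a \<in> yh_free_on (Suc n). h (Suc (Suc n)) (a * yh_g n) = z * h (Suc n) a) \<and>
     (\<forall>n. \<forall>a \<in> yh_free_on n. \<forall>k. 1 \<le> k \<and> k \<le> d - 1 \<longrightarrow> h (Suc n) (a * yh_t n ^ k) = 0)"

lemma markov_familyD:
  assumes "markov_family d q z h"
  shows "h n (x + y) = h n x + h n y" "h n (scal c * x) = c * h n x" "x \<in> yh_ideal d q n \<Longrightarrow> h n x = 0"
    "a \<in> yh_free_on n \<Longrightarrow> b \<in> yh_free_on n \<Longrightarrow> h n (a * b) = h n (b * a)"
    "a \<in> yh_free_on n \<Longrightarrow> h (Suc n) a = h n a"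
    "a \<in> yh_free_on (Suc n) \<Longrightarrow> h (Suc (Suc n)) (a * yh_g n) = z * h (Suc n) a"
    "a \<in> yh_free_on n \<Longrightarrow> 1 \<le> k \<Longrightarrow> k \<le> d - 1 \<Longrightarrow> h (Suc n) (a * yh_t n ^ k) = 0"
  using assms unfolding markov_family_def by blast+

lemma markov_family_0: assumes "markov_family d q z h" shows "h n 0 = 0"
  using markov_familyD(1)[OF assms, of n 0 0] by simp

lemma markov_family_sum:
  assumes "markov_family d q z h" shows "h n (sum f A) = (\<Sum>a\<in>A. h n (f a))"
  by (induction A rule: infinite_finite_induct)
     (simp_all add: markov_familyD(1)[OF assms] markov_family_0[OF assms])

lemma markov_family_cong:
  assumes "markov_family d q z h" "yh_cong d q n x y" shows "h n x = h n y"
proof -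
  have "h n x = h n ((x - y) + y)" by simp
  also have "\<dots> = h n (x - y) + h n y" by (rule markov_familyD(1)[OF assms(1)])
  also have "h n (x - y) = 0" using assms(2) by (intro markov_familyD(3)[OF assms(1)]) (simp add: yh_cong_def)
  finally show ?thesis by simp
qed

lemma markov_family_eq_0:
  assumes h: "markov_family d q z h" and "h 0 1 = 0" "1 \<le> d"
  shows "x \<in> yh_free_on n \<Longrightarrow> h n x = 0"
proof (induction n arbitrary: x)
  case 0
  then show ?case
  proof (induction rule: free_on_induct)
    case (monomial c l)
    then have "l = []" by (auto simp: yh_gens_def)
    then show ?case using assms(2) by (simp add: word_monomial_Nil markov_familyD[OF h] del: mult_1_right)
  next
    case (add x y)
    then show ?case by (simp add: markov_familyD[OF h])
  qed
next
  case (Suc n)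
  have "x \<in> yh_span d q n" using free_on_subset_span Suc.prems by blast
  then show ?case
  proof (induction rule: yh_span.induct)
    case zero
    then show ?case by (rule markov_family_0[OF h])
  next
    case (add x y)
    then show ?case by (simp add: markov_familyD[OF h])
  next
    case (framing a k)
    have tn: "yh_t n \<in> yh_free_on (Suc n)" by (simp add: free_on_t)
    have aS: "a \<in> yh_free_on (Suc n)" using framing free_on_mono by auto
    have "yh_cong d q (Suc n) (yh_t n ^ k) (yh_t n ^ (k mod d))"
    proof -
      have "yh_cong d q (Suc n) ((yh_t n ^ d) ^ m) 1" for m
      proof (induction m)
        case (Suc m)
        then show ?case using cong_mult[OF relation_torsion[of n "Suc n" d q] Suc] tn by (simp add: free_on_power)
      qed simp
      from cong_left[OF this[of "k div d"], of "yh_t n ^ (k mod d)"] tn show ?thesis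
        by (simp add: free_on_power flip: power_mult power_add)
    qed
    then have "h (Suc n) (a * yh_t n ^ k) = h (Suc n) (a * yh_t n ^ (k mod d))"
      by (intro markov_family_cong[OF h] cong_left aS)
    also have "\<dots> = 0"
    proof (cases "k mod d = 0")
      case True
      then show ?thesis using Suc.IH[OF framing] markov_familyD(5)[OF h framing] by simp
    next
      case False
      have "k mod d < d" using assms(3) by simp
      with False show ?thesis by (intro markov_familyD(7)[OF h framing]) auto
    qed
    finally show ?case .
  next
    case (braiding m a b)
    have "h (Suc n) (a * yh_g m * b) = h (Suc n) (b * (a * yh_g m))"
      using braiding free_on_mono by (intro markov_familyD(4)[OF h] free_on_intros) auto
    also have "\<dots> = h (Suc (Suc m)) ((b * a) * yh_g m)" using braiding by (simp add: mult.assoc)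
    also have "\<dots> = z * h (Suc m) (b * a)" using braiding by (intro markov_familyD(6)[OF h] free_on_mult) auto
    also have "\<dots> = 0" using Suc.IH[of "b * a"] braiding free_on_mult by simp
    finally show ?case .
  next
    case (cong x y)
    then show ?case using markov_family_cong[OF h] by metis
  qed
qed

text \<open>
  The combination \<open>k 0 1 h - h 0 1 k\<close> is again a Markov family and vanishes on
  \<open>0\<close> strands. By the spanning property it vanishes on all numbers of strands.
\<close>

theorem markov_family_unique:
  assumes "markov_family d q z h" "markov_family d q z k" "1 \<le> d" "x \<in> yh_free_on n"
  shows "k 0 1 * h n x = h 0 1 * k n x"
proof -
  define m where "m = (\<lambda>n x. k 0 1 * h n x - h 0 1 * k n x)"
  have "markov_family d q z m"
    unfolding markov_family_def m_def
    by (auto simp: markov_familyD[OF assms(1)] markov_familyD[OF assms(2)] algebra_simps)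
  moreover have "m 0 1 = 0" by (simp add: m_def)
  ultimately have "m n x = 0" using markov_family_eq_0 assms(3,4) by blast
  then show ?thesis by (simp add: m_def)
qed

section \<open>Multiplicativity and twisting of the trace\<close>

lemma poly_mapping_single_induct [case_names single add]:
  assumes "\<And>w c. Q (Poly_Mapping.single w c)" "\<And>x y. Q x \<Longrightarrow> Q y \<Longrightarrow> Q (x + y)"
  shows "Q (x :: 'a \<Rightarrow>\<^sub>0 'b :: comm_monoid_add)"
proof -
  have "Q (\<Sum>w\<in>A. Poly_Mapping.single w (Poly_Mapping.lookup x w))" if "finite A" for A
    using that
  proof (induction A)
    case empty
    then show ?case using assms(1)[of undefined 0] by simp
  qed (simp add: assms)
  from this[of "Poly_Mapping.keys x"] show ?thesis by (simp flip: poly_mapping_sum_single)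
qed

text \<open>
  Excluding scalars \<open>x\<close> makes this a terminating rewrite rule.
\<close>

lemma scal_pull: "NO_MATCH (scal b) x \<Longrightarrow> x * (scal c * y) = scal c * (x * y)"
  by (rule scal_left_commute)

lemma scal_scal: "scal b * (scal c * y) = scal (b * c) * y"
  by (simp add: scal_mult mult.assoc)

text \<open>
  The algebra homomorphism with prescribed images of the generators.
\<close>

definition subst :: "(yh_gen \<Rightarrow> yh_free) \<Rightarrow> yh_free \<Rightarrow> yh_free" where
  "subst \<sigma> x = (\<Sum>w\<in>Poly_Mapping.keys x. scal (Poly_Mapping.lookup x w) * prod_list (map \<sigma> (letters w)))"

lemma subst_single: "subst \<sigma> (Poly_Mapping.single w c) = scal c * prod_list (map \<sigma> (letters w))"
  by (cases "c = 0") (simp_all add: subst_def)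

lemma subst_add: "subst \<sigma> (x + y) = subst \<sigma> x + subst \<sigma> y"
  unfolding subst_def by (rule sum_keys_add) (simp_all add: scal_add distrib_right)

lemma subst_mult: "subst \<sigma> (x * y) = subst \<sigma> x * subst \<sigma> y"
proof (induction x rule: poly_mapping_single_induct)
  case (single w c)
  show ?case
  proof (induction y rule: poly_mapping_single_induct)
    case (single v b)
    show ?case by (simp add: mult_single subst_single plus_yh_word_def mult.assoc scal_pull scal_scal)
  qed (simp add: distrib_left subst_add)
qed (simp add: distrib_right subst_add)

lemma subst_scal: "subst \<sigma> (scal c) = scal c"
  unfolding scal_def[of c] subst_single by (simp add: scal_def zero_yh_word_def)
lemma subst_1: "subst \<sigma> 1 = 1" using subst_scal[of \<sigma> 1] by simp
lemma subst_0: "subst \<sigma> 0 = 0" using subst_scal[of \<sigma> 0] by simp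
lemma subst_uminus: "subst \<sigma> (- x) = - subst \<sigma> x"
  using subst_mult[of \<sigma> "scal (-1)" x] unfolding subst_scal by (simp add: scal_uminus)
lemma subst_diff: "subst \<sigma> (x - y) = subst \<sigma> x - subst \<sigma> y"
  using subst_add[of \<sigma> x "- y"] by (simp add: subst_uminus)
lemma subst_power: "subst \<sigma> (x ^ k) = subst \<sigma> x ^ k"
  by (induction k) (simp_all add: subst_1 subst_mult)
lemma subst_sum: "subst \<sigma> (sum f A) = (\<Sum>i\<in>A. subst \<sigma> (f i))"
  by (induction A rule: infinite_finite_induct) (simp_all add: subst_0 subst_add)
lemma subst_g: "subst \<sigma> (yh_g i) = \<sigma> (G i)" and subst_t: "subst \<sigma> (yh_t j) = \<sigma> (T j)"
  by (simp_all add: yh_g_eq yh_t_eq subst_single)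

lemmas subst_simps = subst_mult subst_add subst_diff subst_scal subst_1 subst_power subst_sum subst_g subst_t

lemma subst_free_on:
  assumes "\<And>a. a \<in> yh_gens n \<Longrightarrow> \<sigma> a \<in> yh_free_on m" "x \<in> yh_free_on n"
  shows "subst \<sigma> x \<in> yh_free_on m"
  using assms(2)
proof (induction rule: free_on_induct)
  case (monomial c l)
  then have "prod_list (map \<sigma> l) \<in> yh_free_on m"
    by (induction l) (auto intro: free_on_mult assms(1))
  then show ?case by (simp add: subst_mult subst_scal subst_single free_on_mult)
qed (simp add: subst_add free_on_add)

lemma subst_ideal:
  assumes "\<And>a. a \<in> yh_gens n \<Longrightarrow> \<sigma> a \<in> yh_free_on m"
    "\<And>r. r \<in> yh_relators d q n \<Longrightarrow> subst \<sigma> r \<in> yh_ideal d' q m"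
    "x \<in> yh_ideal d q n"
  shows "subst \<sigma> x \<in> yh_ideal d' q m"
  using assms(3)
proof (induction rule: yh_ideal.induct)
  case (gen a r b)
  have "subst \<sigma> a \<in> yh_free_on m" "subst \<sigma> b \<in> yh_free_on m"
    using subst_free_on[OF assms(1)] gen by auto
  then show ?case unfolding subst_mult by (intro ideal_left ideal_right assms(2) gen)
qed (auto simp: subst_0 subst_add intro: yh_ideal.intros)

definition shift_gen :: "nat \<Rightarrow> yh_gen \<Rightarrow> yh_free" where
  "shift_gen m a = (case a of G i \<Rightarrow> yh_g (i + m) | T j \<Rightarrow> yh_t (j + m))"

lemma shift_gen_simps [simp]: "shift_gen m (G i) = yh_g (i + m)" "shift_gen m (T j) = yh_t (j + m)"
  by (simp_all add: shift_gen_def)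

lemma shift_gen_free_on: "a \<in> yh_gens n \<Longrightarrow> shift_gen m a \<in> yh_free_on (m + n)"
  by (auto simp: yh_gens_def intro!: free_on_g free_on_t)

lemma subst_shift_e: "subst (shift_gen m) (yh_e d i) = yh_e d (i + m)"
  by (simp add: yh_e_def subst_simps)

lemma transpose_add: "transpose (i + m) (Suc (i + m)) (j + m) = transpose i (Suc i) j + (m :: nat)"
  by (auto simp: transpose_def)

lemma shift_relators: "r \<in> yh_relators d q n \<Longrightarrow> subst (shift_gen m) r \<in> yh_relators d q (m + n)"
proof (induction rule: yh_relators.induct)
  case (swap i j)
  then show ?case using yh_relators.swap[of "i + m" "m + n" "j + m" d q] by (simp add: subst_simps transpose_add)
next
  case (quadratic i)
  then show ?case using yh_relators.quadratic[of "i + m" "m + n" q d] by (simp add: subst_simps subst_shift_e)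
next
  case (braid i)
  then show ?case using yh_relators.braid[of "i + m" "m + n" d q] by (simp add: subst_simps)
next
  case (far i j)
  then show ?case using yh_relators.far[of "i + m" "m + n" "j + m" d q] by (simp add: subst_simps)
next
  case (comm i j)
  then show ?case using yh_relators.comm[of "i + m" "m + n" "j + m" d q] by (simp add: subst_simps)
next
  case (torsion j)
  then show ?case using yh_relators.torsion[of "j + m" "m + n" d q] by (simp add: subst_simps)
qed

lemma shift_ideal: "x \<in> yh_ideal d q n \<Longrightarrow> subst (shift_gen m) x \<in> yh_ideal d q (m + n)"
  by (rule subst_ideal[of n _ _ d q d]) (auto intro: shift_gen_free_on relator_ideal shift_relators)

lemma intertwines_shift:
  assumes "x \<in> yh_free_on m" "y \<in> yh_free_on n"
  shows "intertwines d q (m + n) x (subst (shift_gen m) y) x"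
proof -
  have *: "intertwines d q (m + n) (subst (shift_gen m) y) x (subst (shift_gen m) y)" 
    using assms(2)
  proof (induction rule: free_on_induct)
    case (monomial c l)
    have "intertwines d q (m + n) (prod_list (map (shift_gen m) l)) x (prod_list (map (shift_gen m) l))"
      using monomial
    proof (induction l)
      case Nil
      then show ?case using assms free_on_mono by (auto intro!: intertwines_1)
    next
      case (Cons a l)
      have "intertwines d q (m + n) x (shift_gen m a) x"
      proof (cases a)
        case (G i)
        then have i: "Suc i < n" using Cons.prems by (auto simp: yh_gens_def)
        show ?thesis unfolding G shift_gen_simps
        proof (rule intertwines_free_on[OF assms(1)])
          show "intertwines d q (m + n) (yh_g k) (yh_g (i + m)) (yh_g k)" if "Suc k < m" for k
            unfolding intertwines_def using that i by (auto intro!: free_on_g relation_far)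
          show "intertwines d q (m + n) (yh_t k) (yh_g (i + m)) (yh_t k)" if "k < m" for k
            using intertwines_t_g[of "i + m" "m + n" k d q] that i by (simp add: transpose_def)
        qed (use i in \<open>auto intro: free_on_g\<close>)
      next
        case (T j)
        then have j: "j < n" using Cons.prems by (auto simp: yh_gens_def)
        show ?thesis unfolding T shift_gen_simps
        proof (rule intertwines_free_on[OF assms(1)])
          show "intertwines d q (m + n) (yh_g k) (yh_t (j + m)) (yh_g k)" if "Suc k < m" for k
          proof (rule intertwines_sym)
            show "intertwines d q (m + n) (yh_t (j + m)) (yh_g k) (yh_t (j + m))"
              using intertwines_t_g[of k "m + n" "j + m" d q] that j by (simp add: transpose_def)
          qed
          show "intertwines d q (m + n) (yh_t k) (yh_t (j + m)) (yh_t k)" if "k < m" for k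
            using intertwines_t_t that j by simp
        qed (use j in \<open>auto intro: free_on_t\<close>)
      qed
      then have "intertwines d q (m + n) (shift_gen m a) x (shift_gen m a)" by (rule intertwines_sym)
      moreover have "intertwines d q (m + n) (prod_list (map (shift_gen m) l)) x (prod_list (map (shift_gen m) l))"
        using Cons by simp
      ultimately show ?case using intertwines_mult_left by simp
    qed
    then have "intertwines d q (m + n) (scal c * prod_list (map (shift_gen m) l)) x (scal c * prod_list (map (shift_gen m) l))"
      by (intro intertwines_mult_left intertwines_scal_left) (use assms free_on_mono in auto)
    then show ?case by (simp add: subst_mult subst_scal subst_single)
  qed (simp add: subst_add intertwines_add_left)
  then show ?thesis by (rule intertwines_sym)
qed

text \<open>
  As a function of \<open>x\<close> the left-hand side is a Markov trace, because \<open>a\<close>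
  commutes with shifted elements.
\<close>

lemma trace_multiplicative:
  assumes "markov_family d q z (\<lambda>_. \<phi>)" "\<phi> 1 = 1" "1 \<le> d" "a \<in> yh_free_on m" "x \<in> yh_free_on n"
  shows "\<phi> (a * subst (shift_gen m) x) = \<phi> a * \<phi> x"
proof -
  note M = markov_familyD[OF assms(1)]
  have am: "a \<in> yh_free_on (m + k)" for k using assms(4) free_on_mono by auto
  have sh: "subst (shift_gen m) y \<in> yh_free_on (m + k)" if "y \<in> yh_free_on k" for y k
    by (rule subst_free_on[OF shift_gen_free_on that])
  have "markov_family d q z (\<lambda>_ x. \<phi> (a * subst (shift_gen m) x))"
    unfolding markov_family_def
  proof (intro conjI allI ballI impI)
    fix n x y c
    show "\<phi> (a * subst (shift_gen m) (x + y)) = \<phi> (a * subst (shift_gen m) x) + \<phi> (a * subst (shift_gen m) y)"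
      by (simp add: subst_add distrib_left M)
    show "\<phi> (a * subst (shift_gen m) (scal c * x)) = c * \<phi> (a * subst (shift_gen m) x)"
      by (simp only: subst_mult subst_scal scal_left_commute[of a] M)
  next
    fix n x assume "x \<in> yh_ideal d q n"
    then show "\<phi> (a * subst (shift_gen m) x) = 0"
      by (intro M(3)[where n = "m + n"] ideal_left shift_ideal am)
  next
    fix n x y assume xy: "x \<in> yh_free_on n" "y \<in> yh_free_on n"
    let ?x = "subst (shift_gen m) x" and ?y = "subst (shift_gen m) y"
    have "\<phi> ((a * ?x) * ?y) = \<phi> (?y * (a * ?x))"
      by (rule M(4)[where n = "m + n"]) (intro free_on_mult am sh xy)+
    also have "?y * (a * ?x) = (?y * a) * ?x" by (simp add: mult.assoc)
    also have "\<phi> ((?y * a) * ?x) = \<phi> ((a * ?y) * ?x)"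
      by (rule markov_family_cong[OF assms(1), where n = "m + n"], rule cong_right[OF cong_sym])
         (intro intertwinesD[OF intertwines_shift[OF assms(4) xy(2)]] sh xy)+
    finally show "\<phi> (a * subst (shift_gen m) (x * y)) = \<phi> (a * subst (shift_gen m) (y * x))"
      by (simp add: subst_mult mult.assoc)
  next
    fix n x assume x: "x \<in> yh_free_on (Suc n)"
    have "a * subst (shift_gen m) x \<in> yh_free_on (Suc (n + m))"
      using free_on_mult[OF am sh[OF x]] by (simp add: add.commute)
    from M(6)[OF this] show "\<phi> (a * subst (shift_gen m) (x * yh_g n)) = z * \<phi> (a * subst (shift_gen m) x)"
      by (simp add: subst_simps mult.assoc)
  next
    fix n x k assume x: "x \<in> yh_free_on n" and k: "1 \<le> k \<and> k \<le> d - 1"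
    have "a * subst (shift_gen m) x \<in> yh_free_on (n + m)"
      using free_on_mult[OF am sh[OF x]] by (simp add: add.commute)
    from M(7)[OF this] k show "\<phi> (a * subst (shift_gen m) (x * yh_t n ^ k)) = 0"
      by (simp add: subst_simps mult.assoc)
  qed auto
  from markov_family_unique[OF this assms(1,3,5)] show ?thesis using assms(2) by (simp add: subst_1)
qed

text \<open>
  The automorphism \<open>t\<^sub>j \<mapsto> \<zeta> t\<^sub>j\<close>, where
  \<open>\<zeta>\<^sup>d = 1\<close>.
\<close>

definition twist_gen :: "complex \<Rightarrow> yh_gen \<Rightarrow> yh_free" where
  "twist_gen \<zeta> a = (case a of G i \<Rightarrow> yh_g i | T j \<Rightarrow> scal \<zeta> * yh_t j)"

lemma twist_gen_simps [simp]: "twist_gen \<zeta> (G i) = yh_g i" "twist_gen \<zeta> (T j) = scal \<zeta> * yh_t j"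
  by (simp_all add: twist_gen_def)

lemma twist_gen_free_on: "a \<in> yh_gens n \<Longrightarrow> twist_gen \<zeta> a \<in> yh_free_on n"
  by (auto simp: yh_gens_def intro!: free_on_g free_on_t free_on_mult)

lemma scal_mult_power: "(scal c * x) ^ k = scal (c ^ k) * x ^ k"
  by (induction k) (simp_all add: mult.assoc scal_pull scal_scal)

lemma subst_twist_e: assumes "\<zeta> ^ d = 1" shows "subst (twist_gen \<zeta>) (yh_e d i) = yh_e d i"
proof -
  have "(scal \<zeta> * yh_t i) ^ s * (scal \<zeta> * yh_t (Suc i)) ^ (d - s) = yh_t i ^ s * yh_t (Suc i) ^ (d - s)" if "s < d" for s
  proof -
    have "(scal \<zeta> * yh_t i) ^ s * (scal \<zeta> * yh_t (Suc i)) ^ (d - s) = scal (\<zeta> ^ s * \<zeta> ^ (d - s)) * (yh_t i ^ s * yh_t (Suc i) ^ (d - s))"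
      by (simp add: scal_mult_power mult.assoc scal_pull scal_scal)
    also have "\<zeta> ^ s * \<zeta> ^ (d - s) = 1" using that assms by (simp flip: power_add)
    finally show ?thesis by simp
  qed
  then show ?thesis by (simp add: yh_e_def subst_simps)
qed

text \<open>
  Relators are homogeneous in the framings modulo \<open>d\<close>, so they are multiplied by
  powers of \<open>\<zeta>\<close>.
\<close>

lemma twist_relators:
  assumes "\<zeta> ^ d = 1" "r \<in> yh_relators d q n" shows "subst (twist_gen \<zeta>) r \<in> yh_ideal d q n"
  using assms(2)
proof (induction rule: yh_relators.induct)
  case (swap i j)
  have "subst (twist_gen \<zeta>) (yh_t j * yh_g i - yh_g i * yh_t (transpose i (Suc i) j)) = scal \<zeta> * (yh_t j * yh_g i - yh_g i * yh_t (transpose i (Suc i) j))"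
    by (simp add: subst_simps mult.assoc scal_pull right_diff_distrib)
  then show ?case using ideal_left[OF relator_ideal[OF yh_relators.swap[OF swap]]] by simp
next
  case (quadratic i)
  then show ?case using relator_ideal[OF yh_relators.quadratic] by (simp add: subst_simps subst_twist_e[OF assms(1)])
next
  case (comm i j)
  have "subst (twist_gen \<zeta>) (yh_t i * yh_t j - yh_t j * yh_t i) = scal (\<zeta> * \<zeta>) * (yh_t i * yh_t j - yh_t j * yh_t i)"
    by (simp add: subst_simps mult.assoc scal_pull scal_scal right_diff_distrib)
  then show ?case using ideal_left[OF relator_ideal[OF yh_relators.comm[OF comm]]] by simp
next
  case (torsion j)
  then show ?case using relator_ideal[OF yh_relators.torsion] by (simp add: subst_simps scal_mult_power assms(1))
next
  case (braid i)
  then show ?case using relator_ideal[OF yh_relators.braid] by (simp add: subst_simps)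
next
  case (far i j)
  then show ?case using relator_ideal[OF yh_relators.far] by (simp add: subst_simps)
qed

lemma trace_twist:
  assumes "markov_family d q z (\<lambda>_. \<phi>)" "\<phi> 1 = 1" "1 \<le> d" "\<zeta> ^ d = 1" "x \<in> yh_free_on n"
  shows "\<phi> (subst (twist_gen \<zeta>) x) = \<phi> x"
proof -
  note M = markov_familyD[OF assms(1)]
  note F = subst_free_on[OF twist_gen_free_on]
  have "markov_family d q z (\<lambda>_ x. \<phi> (subst (twist_gen \<zeta>) x))"
    unfolding markov_family_def
  proof (intro conjI allI ballI impI)
    fix n x assume "x \<in> yh_ideal d q n"
    then have "subst (twist_gen \<zeta>) x \<in> yh_ideal d q n"
      by (rule subst_ideal[rotated 2, OF _ twist_gen_free_on twist_relators[OF assms(4)]])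
    then show "\<phi> (subst (twist_gen \<zeta>) x) = 0" by (rule M(3))
  next
    fix n x y assume "x \<in> yh_free_on n" "y \<in> yh_free_on n"
    then show "\<phi> (subst (twist_gen \<zeta>) (x * y)) = \<phi> (subst (twist_gen \<zeta>) (y * x))"
      by (auto simp: subst_mult intro: M(4) F)
  next
    fix n x assume "x \<in> yh_free_on (Suc n)"
    then show "\<phi> (subst (twist_gen \<zeta>) (x * yh_g n)) = z * \<phi> (subst (twist_gen \<zeta>) x)"
      by (auto simp: subst_simps intro: M(6) F)
  next
    fix n x k assume "x \<in> yh_free_on n" "1 \<le> k \<and> k \<le> d - 1"
    then show "\<phi> (subst (twist_gen \<zeta>) (x * yh_t n ^ k)) = 0"
      by (simp add: subst_simps scal_mult_power scal_pull M F)
  qed (auto simp: subst_simps M)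
  from markov_family_unique[OF this assms(1,3,5)] show ?thesis using assms(2) by (simp add: subst_1)
qed

lemma exists_root_of_unity:
  assumes "0 < k" "k < d" shows "\<exists>\<zeta> :: complex. \<zeta> ^ d = 1 \<and> \<zeta> ^ k \<noteq> 1"
proof -
  let ?\<zeta> = "cis (2 * pi / real d)"
  have b: "bij_betw (\<lambda>k. cis (2 * pi * real k / real d)) {..<d} {z. z ^ d = 1}"
    using assms by (intro bij_betw_roots_unity) auto
  have p: "?\<zeta> ^ j = cis (2 * pi * real j / real d)" for j
    by (simp add: DeMoivre mult.commute)
  have "cis (2 * pi * real k / real d) \<noteq> cis (2 * pi * real 0 / real d)"
    using inj_onD[OF bij_betw_imp_inj_on[OF b], of k 0] assms by auto
  moreover have "?\<zeta> ^ d = 1" using assms by (simp add: p)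
  ultimately show ?thesis using p[of k] by (intro exI[of _ ?\<zeta>]) auto
qed

section \<open>Averaging framings\<close>

text \<open>
  The idempotent that projects onto the part where \<open>t\<^sub>j\<close> acts as
  \<open>1\<close>.
\<close>

definition framing_mean :: "nat \<Rightarrow> nat \<Rightarrow> yh_free" where
  "framing_mean d j = scal (1 / of_nat d) * (\<Sum>k<d. yh_t j ^ k)"

fun mean_idempotent :: "nat \<Rightarrow> nat \<Rightarrow> yh_free" where
  "mean_idempotent d 0 = 1"
| "mean_idempotent d (Suc n) = mean_idempotent d n * framing_mean d n"

lemma free_on_framing_mean: "j < n \<Longrightarrow> framing_mean d j \<in> yh_free_on n"
  unfolding framing_mean_def by (intro free_on_intros free_on_scal)

lemma free_on_mean_idempotent: "n \<le> m \<Longrightarrow> mean_idempotent d n \<in> yh_free_on m"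
  by (induction n) (auto intro!: free_on_mult free_on_framing_mean)

lemma mean_idempotent_add: "mean_idempotent d (m + n) = mean_idempotent d m * subst (shift_gen m) (mean_idempotent d n)"
  by (induction n) (simp_all add: subst_simps framing_mean_def mult.assoc add.commute)

context fixes d :: nat and q :: complex assumes d: "1 \<le> d"
begin

abbreviation cong_modulo ("(_ \<equiv>\<^bsub>_\<^esub> _)" [51, 0, 51] 50) where "x \<equiv>\<^bsub>n\<^esub> y \<equiv> yh_cong d q n x y"

lemma scal_inverse_sum: "scal (1 / of_nat d) * (\<Sum>k<d. x) = x"
proof -
  have "(\<Sum>k<d. x) = scal (of_nat d) * x"
    by (induction d) (simp_all add: scal_add distrib_right)
  then have "scal (1 / of_nat d) * (\<Sum>k<d. x) = scal (1 / of_nat d * of_nat d) * x" by (simp only: scal_mult mult.assoc)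
  then show ?thesis using d by simp
qed

lemma framing_mean_t:
  assumes "j < n" shows "framing_mean d j * yh_t j \<equiv>\<^bsub>n\<^esub> framing_mean d j"
proof -
  have "(\<Sum>k<d. yh_t j ^ k) * yh_t j + 1 = (\<Sum>k<Suc d. yh_t j ^ k)"
    by (simp add: sum_distrib_right power_commutes sum.lessThan_Suc_shift del: sum.lessThan_Suc)
  then have "(\<Sum>k<d. yh_t j ^ k) * yh_t j = (\<Sum>k<d. yh_t j ^ k) + yh_t j ^ d - 1"
    by (simp add: algebra_simps)
  moreover have "(\<Sum>k<d. yh_t j ^ k) + yh_t j ^ d - 1 \<equiv>\<^bsub>n\<^esub> (\<Sum>k<d. yh_t j ^ k) + 1 - 1"
    by (intro cong_add cong_diff cong_refl relation_torsion assms)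
  ultimately have "(\<Sum>k<d. yh_t j ^ k) * yh_t j \<equiv>\<^bsub>n\<^esub> (\<Sum>k<d. yh_t j ^ k)" by simp
  from cong_scal[OF this] show ?thesis by (simp add: framing_mean_def mult.assoc)
qed

lemma framing_mean_t_power: "j < n \<Longrightarrow> framing_mean d j * yh_t j ^ k \<equiv>\<^bsub>n\<^esub> framing_mean d j"
proof (induction k)
  case (Suc k)
  have "(framing_mean d j * yh_t j ^ k) * yh_t j \<equiv>\<^bsub>n\<^esub> framing_mean d j * yh_t j"
    using Suc by (intro cong_right free_on_t) auto
  also have "framing_mean d j * yh_t j \<equiv>\<^bsub>n\<^esub> framing_mean d j" using Suc by (intro framing_mean_t)
  finally show ?case by (simp add: power_commutes mult.assoc)
qed simp

lemma intertwines_framing_mean: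
  "intertwines d q n (yh_t j) x (yh_t k) \<Longrightarrow> intertwines d q n (framing_mean d j) x (framing_mean d k)"
  unfolding framing_mean_def
  by (intro intertwines_mult_left intertwines_scal_left intertwines_sum_left intertwines_power_left)
     (auto simp: intertwines_def)

lemma intertwines_t_framing_mean: "i < n \<Longrightarrow> j < n \<Longrightarrow> intertwines d q n (yh_t i) (framing_mean d j) (yh_t i)"
  using intertwines_sym[OF intertwines_framing_mean[OF intertwines_t_t[of j n i]]] by simp

lemma intertwines_t_mean_idempotent: "i < n \<Longrightarrow> m \<le> n \<Longrightarrow> intertwines d q n (yh_t i) (mean_idempotent d m) (yh_t i)"
  by (induction m) (auto intro!: intertwines_1 free_on_t intertwines_mult_right intertwines_t_framing_mean)

lemma intertwines_framing_mean_mean: "i < n \<Longrightarrow> j < n \<Longrightarrow> intertwines d q n (framing_mean d i) (framing_mean d j) (framing_mean d i)"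
  by (rule intertwines_framing_mean[OF intertwines_t_framing_mean])

lemma intertwines_mean_mean_idempotent: "i < n \<Longrightarrow> m \<le> n \<Longrightarrow> intertwines d q n (framing_mean d i) (mean_idempotent d m) (framing_mean d i)"
  by (rule intertwines_framing_mean[OF intertwines_t_mean_idempotent])

text \<open>
  The generator \<open>g\<^sub>i\<close> exchanges the two averages of its own strands and
  commutes with all the others.
\<close>

lemma intertwines_g_mean_idempotent:
  "Suc i < m \<or> m \<le> i \<Longrightarrow> Suc i < n \<Longrightarrow> m \<le> n \<Longrightarrow> intertwines d q n (yh_g i) (mean_idempotent d m) (yh_g i)"
proof (induction m)
  case 0
  then show ?case by (auto intro!: intertwines_1 free_on_g)
next
  case (Suc m)
  have far: "intertwines d q n (yh_g i) (framing_mean d j) (yh_g i)" if "j \<noteq> i" "j \<noteq> Suc i" "j < n" for j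
  proof (rule intertwines_sym, rule intertwines_framing_mean)
    show "intertwines d q n (yh_t j) (yh_g i) (yh_t j)"
      using intertwines_t_g[of i n j d q] that Suc.prems by (simp add: transpose_def)
  qed
  show ?case
  proof (cases "Suc i = m")
    case False
    then show ?thesis using Suc far[of m] by (auto intro!: intertwines_mult_right)
  next
    case True
    have "intertwines d q n (framing_mean d i * framing_mean d m) (yh_g i) (framing_mean d m * framing_mean d i)"
      using intertwines_t_g[of i n i d q] intertwines_t_g[of i n m d q] Suc.prems True
      by (intro intertwines_mult_left intertwines_framing_mean) (auto simp: transpose_def)
    moreover have "yh_g i * (framing_mean d m * framing_mean d i) \<equiv>\<^bsub>n\<^esub> yh_g i * (framing_mean d i * framing_mean d m)"
      using Suc.prems True by (intro cong_left intertwinesD[OF intertwines_framing_mean_mean] free_on_g) auto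
    ultimately have "intertwines d q n (framing_mean d i * framing_mean d m) (yh_g i) (framing_mean d i * framing_mean d m)"
      using Suc.prems True unfolding intertwines_def by (auto intro: cong_trans free_on_mult free_on_framing_mean)
    then have 1: "intertwines d q n (yh_g i) (framing_mean d i * framing_mean d m) (yh_g i)" by (rule intertwines_sym)
    have 2: "intertwines d q n (yh_g i) (mean_idempotent d i) (yh_g i)"
    proof -
      have "intertwines d q n (yh_g i) (mean_idempotent d l) (yh_g i)" if "l \<le> i" for l
        using that Suc.prems far by (induction l) (auto intro!: intertwines_1 free_on_g intertwines_mult_right)
      then show ?thesis by simp
    qed
    have "mean_idempotent d (Suc m) = mean_idempotent d i * (framing_mean d i * framing_mean d m)"
      by (simp flip: True add: mult.assoc)
    then show ?thesis using intertwines_mult_right[OF 2 1] by simp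
  qed
qed

lemma mean_idempotent_central: "x \<in> yh_free_on n \<Longrightarrow> intertwines d q n x (mean_idempotent d n) x"
  by (rule intertwines_free_on)
     (auto intro: free_on_mean_idempotent intertwines_g_mean_idempotent intertwines_t_mean_idempotent)

lemma t_mean_idempotent: "j < m \<Longrightarrow> m \<le> n \<Longrightarrow> yh_t j * mean_idempotent d m \<equiv>\<^bsub>n\<^esub> mean_idempotent d m"
proof (induction m)
  case (Suc m)
  show ?case
  proof (cases "j = m")
    case False
    then have "yh_t j * mean_idempotent d m * framing_mean d m \<equiv>\<^bsub>n\<^esub> mean_idempotent d m * framing_mean d m"
      using Suc by (intro cong_right free_on_framing_mean) auto
    then show ?thesis by (simp add: mult.assoc)
  next
    case True
    have "(yh_t m * mean_idempotent d m) * framing_mean d m \<equiv>\<^bsub>n\<^esub> (mean_idempotent d m * yh_t m) * framing_mean d m"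
      using Suc.prems by (intro cong_right intertwinesD[OF intertwines_t_mean_idempotent] free_on_framing_mean) auto
    also have "(mean_idempotent d m * yh_t m) * framing_mean d m = mean_idempotent d m * (yh_t m * framing_mean d m)"
      by (rule mult.assoc)
    also have "mean_idempotent d m * (yh_t m * framing_mean d m) \<equiv>\<^bsub>n\<^esub> mean_idempotent d m * (framing_mean d m * yh_t m)"
      using Suc.prems by (intro cong_left intertwinesD[OF intertwines_t_framing_mean] free_on_mean_idempotent) auto
    also have "mean_idempotent d m * (framing_mean d m * yh_t m) \<equiv>\<^bsub>n\<^esub> mean_idempotent d m * framing_mean d m"
      using Suc.prems by (intro cong_left framing_mean_t free_on_mean_idempotent) auto
    finally show ?thesis using True by (simp add: mult.assoc)
  qed
qed simp

lemma t_power_mean_idempotent: "j < m \<Longrightarrow> m \<le> n \<Longrightarrow> yh_t j ^ k * mean_idempotent d m \<equiv>\<^bsub>n\<^esub> mean_idempotent d m"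
proof (induction k)
  case (Suc k)
  have "yh_t j * (yh_t j ^ k * mean_idempotent d m) \<equiv>\<^bsub>n\<^esub> yh_t j * mean_idempotent d m"
    using Suc by (intro cong_left free_on_t) auto
  also have "\<dots> \<equiv>\<^bsub>n\<^esub> mean_idempotent d m" using Suc.prems by (rule t_mean_idempotent)
  finally show ?case by (simp add: mult.assoc)
qed simp

lemma framing_mean_mean_idempotent: "j < m \<Longrightarrow> m \<le> n \<Longrightarrow> framing_mean d j * mean_idempotent d m \<equiv>\<^bsub>n\<^esub> mean_idempotent d m"
proof -
  assume j: "j < m" "m \<le> n"
  have "scal (1 / of_nat d) * (\<Sum>k<d. yh_t j ^ k * mean_idempotent d m) \<equiv>\<^bsub>n\<^esub> scal (1 / of_nat d) * (\<Sum>k<d. mean_idempotent d m)"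
    by (intro cong_scal cong_sum t_power_mean_idempotent j)
  then show ?thesis unfolding scal_inverse_sum by (simp add: framing_mean_def mult.assoc sum_distrib_right)
qed

lemma e_mean_idempotent: "Suc i < n \<Longrightarrow> yh_e d i * mean_idempotent d n \<equiv>\<^bsub>n\<^esub> mean_idempotent d n"
proof -
  assume i: "Suc i < n"
  have *: "yh_t i ^ s * (yh_t (Suc i) ^ (d - s) * mean_idempotent d n) \<equiv>\<^bsub>n\<^esub> mean_idempotent d n" for s
  proof -
    have "yh_t i ^ s * (yh_t (Suc i) ^ (d - s) * mean_idempotent d n) \<equiv>\<^bsub>n\<^esub> yh_t i ^ s * mean_idempotent d n"
      using i by (intro cong_left t_power_mean_idempotent free_on_power free_on_t) auto
    also have "\<dots> \<equiv>\<^bsub>n\<^esub> mean_idempotent d n" using i by (intro t_power_mean_idempotent) auto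
    finally show ?thesis .
  qed
  have "scal (1 / of_nat d) * (\<Sum>s<d. yh_t i ^ s * (yh_t (Suc i) ^ (d - s) * mean_idempotent d n)) \<equiv>\<^bsub>n\<^esub> scal (1 / of_nat d) * (\<Sum>k<d. mean_idempotent d n)"
    by (intro cong_scal cong_sum *)
  then show ?thesis unfolding scal_inverse_sum by (simp add: yh_e_def mult.assoc sum_distrib_right)
qed

text \<open>
  Both sides are sums over the powers with total exponent \<open>d + 1\<close>; the sums differ in
  one term at each end, and these two agree by torsion.
\<close>

lemma e_t_exchange: assumes i: "Suc i < n" shows "yh_e d i * yh_t i \<equiv>\<^bsub>n\<^esub> yh_e d i * yh_t (Suc i)"
proof -
  define f where "f s = yh_t i ^ s * yh_t (Suc i) ^ (Suc d - s)" for s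
  have "yh_t i ^ s * yh_t (Suc i) ^ (d - s) * yh_t i \<equiv>\<^bsub>n\<^esub> f (Suc s)" for s
  proof -
    have "yh_t i ^ s * (yh_t (Suc i) ^ (d - s) * yh_t i) \<equiv>\<^bsub>n\<^esub> yh_t i ^ s * (yh_t i * yh_t (Suc i) ^ (d - s))"
      using i by (intro cong_left intertwinesD intertwines_power_left intertwines_t_t free_on_power free_on_t) auto
    moreover have "yh_t i ^ s * (yh_t i * yh_t (Suc i) ^ (d - s)) = f (Suc s)"
      by (simp only: f_def power_Suc2 diff_Suc_Suc mult.assoc)
    ultimately show ?thesis by (simp add: mult.assoc)
  qed
  then have 1: "(\<Sum>s<d. yh_t i ^ s * yh_t (Suc i) ^ (d - s)) * yh_t i \<equiv>\<^bsub>n\<^esub> (\<Sum>s<d. f (Suc s))"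
    unfolding sum_distrib_right by (intro cong_sum)
  have "f 0 + (\<Sum>s<d. f (Suc s)) = (\<Sum>s<d. f s) + f d"
    by (simp add: sum.lessThan_Suc[symmetric] sum.lessThan_Suc_shift del: sum.lessThan_Suc)
  then have 2: "(\<Sum>s<d. f (Suc s)) = (\<Sum>s<d. f s) + f d - f 0" by (simp add: algebra_simps)
  have "f d \<equiv>\<^bsub>n\<^esub> 1 * yh_t (Suc i)" unfolding f_def using i by (simp del: mult_1_left) (intro cong_right relation_torsion free_on_t, auto)
  moreover have "f 0 \<equiv>\<^bsub>n\<^esub> yh_t (Suc i) * 1" unfolding f_def using i by (simp del: mult_1_right) (intro cong_left relation_torsion free_on_t, auto)
  ultimately have "(\<Sum>s<d. f s) + f d - f 0 \<equiv>\<^bsub>n\<^esub> (\<Sum>s<d. f s) + 1 * yh_t (Suc i) - yh_t (Suc i) * 1"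
    by (intro cong_diff cong_add cong_refl)
  with 1 2 have "(\<Sum>s<d. yh_t i ^ s * yh_t (Suc i) ^ (d - s)) * yh_t i \<equiv>\<^bsub>n\<^esub> (\<Sum>s<d. f s)"
    by (auto intro: cong_trans)
  also have "(\<Sum>s<d. f s) = (\<Sum>s<d. yh_t i ^ s * yh_t (Suc i) ^ (d - s)) * yh_t (Suc i)"
    unfolding sum_distrib_right f_def
    by (intro sum.cong refl) (simp add: mult.assoc Suc_diff_le power_commutes less_imp_le)
  finally show ?thesis using cong_scal by (simp add: yh_e_def mult.assoc)
qed

lemma intertwines_t_t_e: "Suc i < n \<Longrightarrow> j < n \<Longrightarrow> intertwines d q n (yh_t j) (yh_e d i) (yh_t j)"
  unfolding yh_e_def
  by (intro intertwines_mult_right[OF intertwines_scal_middle] intertwines_sum_right intertwines_mult_right[OF intertwines_power_right]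
      intertwines_power_right intertwines_t_t free_on_t) auto

lemma intertwines_t_e: assumes "Suc i < n" "j < n" shows "intertwines d q n (yh_t j) (yh_e d i) (yh_t (transpose i (Suc i) j))"
proof -
  have "yh_t j * yh_e d i \<equiv>\<^bsub>n\<^esub> yh_e d i * yh_t j" by (intro intertwinesD intertwines_t_t_e assms)
  also have "yh_e d i * yh_t j \<equiv>\<^bsub>n\<^esub> yh_e d i * yh_t (transpose i (Suc i) j)"
    using e_t_exchange[OF assms(1)] cong_sym[OF e_t_exchange[OF assms(1)]] by (auto simp: transpose_def)
  finally show ?thesis using assms by (auto simp: intertwines_def intro: free_on_t free_on_e transpose_less)
qed

lemma intertwines_t_ginv: assumes "Suc i < n" "j < n" shows "intertwines d q n (yh_t j) (yh_ginv d q i) (yh_t (transpose i (Suc i) j))"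
  unfolding yh_ginv_def
  by (intro intertwines_diff_right intertwines_t_g intertwines_mult_right[OF intertwines_scal_middle] intertwines_t_e assms free_on_t)

end

text \<open>
  The position at which the strand starting at position \<open>j\<close> leaves the braid.
\<close>

fun strand_end :: "braid_word \<Rightarrow> nat \<Rightarrow> nat" where
  "strand_end [] j = j"
| "strand_end ((i, b) # w) j = strand_end w (transpose i (Suc i) j)"

lemma strand_end_less: "braid_word n w \<Longrightarrow> j < n \<Longrightarrow> strand_end w j < n"
  by (induction w j rule: strand_end.induct) (auto simp: transpose_less)

lemma permute_strand_end:
  "braid_word (length cs) w \<Longrightarrow> j < length cs \<Longrightarrow> permute w cs ! strand_end w j = cs ! j"
proof (induction w arbitrary: cs j)
  case (Cons a w)
  obtain i b where a: "a = (i, b)" by force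
  have "permute w (swap_at i cs) ! strand_end w (transpose i (Suc i) j) = swap_at i cs ! transpose i (Suc i) j"
    by (rule Cons.IH) (use Cons.prems in \<open>auto simp: a transpose_less\<close>)
  also have "\<dots> = cs ! j" using Cons.prems by (auto simp: a swap_at_def transpose_def nth_list_update)
  finally show ?case by (simp add: a)
qed simp

lemma braid_image_simps [simp]:
  "braid_image d q [] = 1"
  "braid_image d q ((i, b) # w) = (if b then yh_g i else yh_ginv d q i) * braid_image d q w"
  "braid_image d q (v @ w) = braid_image d q v * braid_image d q w"
  by (simp_all add: braid_image_def)

lemma free_on_braid_image: "braid_word n w \<Longrightarrow> braid_image d q w \<in> yh_free_on n"
  by (induction w) (auto intro!: free_on_mult free_on_g free_on_ginv)

lemma subst_shift_braid_image: "subst (shift_gen m) (braid_image d q w) = braid_image d q (shift_word m w)"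
  by (induction w) (auto simp: shift_word_def subst_simps yh_ginv_def subst_shift_e)

lemma subst_twist_braid_image: "\<zeta> ^ d = 1 \<Longrightarrow> subst (twist_gen \<zeta>) (braid_image d q w) = braid_image d q w"
  by (induction w) (auto simp: subst_simps yh_ginv_def subst_twist_e)

lemma intertwines_t_braid_image:
  assumes "1 \<le> d"
  shows "braid_word n w \<Longrightarrow> j < n \<Longrightarrow> intertwines d q n (yh_t j) (braid_image d q w) (yh_t (strand_end w j))"
proof (induction w arbitrary: j)
  case Nil
  then show ?case by (simp add: intertwines_1 free_on_t)
next
  case (Cons a w)
  obtain i b where a: "a = (i, b)" by force
  have "intertwines d q n (yh_t j) (if b then yh_g i else yh_ginv d q i) (yh_t (transpose i (Suc i) j))"
    using Cons.prems intertwines_t_g intertwines_t_ginv[OF assms] by (auto simp: a)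
  then show ?case using Cons.IH[of "transpose i (Suc i) j"] Cons.prems
    by (auto simp: a transpose_less intro: intertwines_mult_right)
qed

text \<open>
  Positions on the same cycle of the permutation of the braid, that is, on the same component of
  its closure.
\<close>

definition connected_strands :: "braid_word \<Rightarrow> nat \<Rightarrow> nat \<Rightarrow> nat \<Rightarrow> bool" where
  "connected_strands w n = equivclp (\<lambda>i j. i < n \<and> j = strand_end w i)"

context
  fixes d q z \<phi> n w
  assumes M: "markov_family d q z (\<lambda>_. \<phi>)" and d: "1 \<le> d" and w: "braid_word n w"
begin

text \<open>
  By cyclicity a framing at position \<open>j\<close> at one end of the braid may be put at
  position \<open>j\<close> at the other end, from where it moves along the strand that starts
  there.
\<close>

lemma trace_move_framing_step:
  assumes "y \<in> yh_free_on n" "\<And>j. j < n \<Longrightarrow> intertwines d q n (yh_t j) y (yh_t j)" "j < n"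
  shows "\<phi> (braid_image d q w * y * yh_t j) = \<phi> (braid_image d q w * y * yh_t (strand_end w j))"
proof -
  let ?B = "braid_image d q w"
  have B: "?B \<in> yh_free_on n" by (rule free_on_braid_image[OF w])
  have t: "yh_t j \<in> yh_free_on n" "strand_end w j < n" using assms(3) strand_end_less[OF w] free_on_t by auto
  have "\<phi> ((?B * y) * yh_t j) = \<phi> (yh_t j * (?B * y))"
    by (rule markov_familyD(4)[OF M, where n = n]) (intro free_on_mult B assms t)+
  also have "\<dots> = \<phi> (yh_t j * ?B * y)" by (simp add: mult.assoc)
  also have "\<dots> = \<phi> (?B * yh_t (strand_end w j) * y)"
    by (intro markov_family_cong[OF M, where n = n] cong_right assms intertwinesD[OF intertwines_t_braid_image[OF d w]])
  also have "\<dots> = \<phi> (?B * (yh_t (strand_end w j) * y))" by (simp add: mult.assoc)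
  also have "\<dots> = \<phi> (?B * (y * yh_t (strand_end w j)))"
    by (intro markov_family_cong[OF M, where n = n] cong_left B intertwinesD[OF assms(2)] t)
  finally show ?thesis by (simp add: mult.assoc)
qed

lemma trace_move_framing:
  assumes "y \<in> yh_free_on n" "\<And>j. j < n \<Longrightarrow> intertwines d q n (yh_t j) y (yh_t j)" "connected_strands w n i j"
  shows "\<phi> (braid_image d q w * y * yh_t i) = \<phi> (braid_image d q w * y * yh_t j)"
  using assms(3) unfolding connected_strands_def
proof (induction rule: equivclp_induct)
  case (step j k)
  then show ?case using trace_move_framing_step[OF assms(1,2)] by metis
qed simp

lemma trace_move_framing_power:
  assumes "y \<in> yh_free_on n" "\<And>j. j < n \<Longrightarrow> intertwines d q n (yh_t j) y (yh_t j)" "connected_strands w n i j" "i < n" "j < n"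
  shows "\<phi> (braid_image d q w * y * yh_t i ^ k) = \<phi> (braid_image d q w * y * yh_t j ^ k)"
  using assms(1,2)
proof (induction k arbitrary: y)
  case (Suc k)
  let ?B = "braid_image d q w"
  have B: "?B \<in> yh_free_on n" by (rule free_on_braid_image[OF w])
  have "\<phi> (?B * y * yh_t i ^ Suc k) = \<phi> (?B * (y * yh_t i ^ k) * yh_t i)"
    by (simp add: mult.assoc power_commutes)
  also have "\<dots> = \<phi> (?B * (y * yh_t i ^ k) * yh_t j)"
    using Suc.prems assms(4)
    by (intro trace_move_framing[OF _ _ assms(3)] free_on_intros intertwines_mult_right[OF Suc.prems(2) intertwines_power_right] intertwines_t_t)
  also have "\<dots> = \<phi> ((?B * y) * (yh_t i ^ k * yh_t j))" by (simp add: mult.assoc)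
  also have "\<dots> = \<phi> ((?B * y) * (yh_t j * yh_t i ^ k))"
    using Suc.prems assms(4,5) B
    by (intro markov_family_cong[OF M, where n = n] cong_left intertwinesD intertwines_power_left intertwines_t_t free_on_mult) auto
  also have "\<dots> = \<phi> (?B * (y * yh_t j) * yh_t i ^ k)" by (simp add: mult.assoc)
  also have "\<dots> = \<phi> (?B * (y * yh_t j) * yh_t j ^ k)"
    using Suc.prems assms(5) by (intro Suc.IH free_on_mult free_on_t intertwines_mult_right[OF Suc.prems(2)] intertwines_t_t)
  finally show ?case by (simp add: mult.assoc)
qed simp

text \<open>
  Both framings in each term of \<open>e\<^sub>i\<close> are collected on one strand, where they
  cancel by torsion.
\<close>

lemma trace_e:
  assumes "Suc i < n" "connected_strands w n (Suc i) i"
  shows "\<phi> (braid_image d q w * yh_e d i) = \<phi> (braid_image d q w)"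
proof -
  let ?B = "braid_image d q w"
  have B: "?B \<in> yh_free_on n" by (rule free_on_braid_image[OF w])
  have "\<phi> (?B * (yh_t i ^ s * yh_t (Suc i) ^ (d - s))) = \<phi> ?B" if "s < d" for s
  proof -
    have "\<phi> (?B * yh_t i ^ s * yh_t (Suc i) ^ (d - s)) = \<phi> (?B * yh_t i ^ s * yh_t i ^ (d - s))"
      using assms(1) by (intro trace_move_framing_power[OF _ _ assms(2)] free_on_power free_on_t intertwines_power_right intertwines_t_t) auto
    also have "\<dots> = \<phi> (?B * yh_t i ^ d)" using that by (simp add: mult.assoc flip: power_add)
    also have "\<dots> = \<phi> (?B * 1)"
      using assms(1) by (intro markov_family_cong[OF M, where n = n] cong_left relation_torsion B) auto
    finally show ?thesis by (simp add: mult.assoc)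
  qed
  then have "\<phi> (scal (1 / of_nat d) * (\<Sum>s<d. ?B * (yh_t i ^ s * yh_t (Suc i) ^ (d - s)))) = \<phi> ?B"
    using d by (simp add: markov_familyD(2)[OF M] markov_family_sum[OF M])
  then show ?thesis by (simp add: yh_e_def scal_pull sum_distrib_left)
qed

text \<open>
  All averages are collected on strand \<open>0\<close>, where they reduce to a single one. Its
  nontrivial framings have trace \<open>0\<close>, since the trace is invariant under twisting by
  a root of unity and the twist multiplies them by a factor different from \<open>1\<close>.
\<close>

lemma trace_mean_idempotent:
  assumes "\<phi> 1 = 1" "1 \<le> n" "\<And>j. j < n \<Longrightarrow> connected_strands w n j 0"
  shows "of_nat d * \<phi> (braid_image d q w * mean_idempotent d n) = \<phi> (braid_image d q w)"
proof -
  let ?B = "braid_image d q w"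
  have B: "?B \<in> yh_free_on n" by (rule free_on_braid_image[OF w])
  have mean: "\<phi> (?B * y * framing_mean d j) = \<phi> (?B * y * framing_mean d 0)"
    if "y \<in> yh_free_on n" "\<And>j. j < n \<Longrightarrow> intertwines d q n (yh_t j) y (yh_t j)" "j < n" for y j
  proof -
    have expand: "\<phi> (?B * y * framing_mean d i) = 1 / of_nat d * (\<Sum>k<d. \<phi> (?B * y * yh_t i ^ k))" for i
      by (simp only: framing_mean_def scal_left_commute[of "?B * y"] markov_familyD(2)[OF M] sum_distrib_left[of "?B * y"] markov_family_sum[OF M])
    have "\<phi> (?B * y * yh_t j ^ k) = \<phi> (?B * y * yh_t 0 ^ k)" for k
      using that assms(2) by (intro trace_move_framing_power assms(3)) auto
    then show ?thesis unfolding expand by simp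
  qed
  have "\<phi> (?B * mean_idempotent d (Suc m)) = \<phi> (?B * framing_mean d 0)" if "Suc m \<le> n" for m
    using that
  proof (induction m)
    case (Suc m)
    have "\<phi> (?B * mean_idempotent d (Suc (Suc m))) = \<phi> (?B * mean_idempotent d (Suc m) * framing_mean d (Suc m))"
      by (simp add: mult.assoc)
    also have "\<dots> = \<phi> (?B * mean_idempotent d (Suc m) * framing_mean d 0)"
      using Suc.prems by (intro mean free_on_mean_idempotent intertwines_t_mean_idempotent d) auto
    also have "\<dots> = \<phi> (?B * (mean_idempotent d (Suc m) * framing_mean d 0))" by (simp only: mult.assoc)
    also have "\<dots> = \<phi> (?B * (framing_mean d 0 * mean_idempotent d (Suc m)))"
      using Suc.prems assms(2) by (intro markov_family_cong[OF M, where n = n] cong_left B cong_sym[OF intertwinesD[OF intertwines_mean_mean_idempotent]] d) auto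
    also have "\<dots> = \<phi> (?B * mean_idempotent d (Suc m))"
      using Suc.prems by (intro markov_family_cong[OF M, where n = n] cong_left B framing_mean_mean_idempotent d) auto
    finally show ?case using Suc by simp
  qed simp
  from this[of "n - 1"] have "\<phi> (?B * mean_idempotent d n) = \<phi> (?B * framing_mean d 0)"
    using assms(2) by simp
  moreover have "\<phi> (?B * yh_t 0 ^ k) = 0" if k: "0 < k" "k < d" for k
  proof -
    obtain \<zeta> :: complex where \<zeta>: "\<zeta> ^ d = 1" "\<zeta> ^ k \<noteq> 1" using exists_root_of_unity[OF k] by blast
    have "\<phi> (subst (twist_gen \<zeta>) (?B * yh_t 0 ^ k)) = \<phi> (?B * yh_t 0 ^ k)"
      using B assms(2) by (intro trace_twist[OF M assms(1) d \<zeta>(1), of _ n] free_on_intros) auto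
    then have "\<zeta> ^ k * \<phi> (?B * yh_t 0 ^ k) = \<phi> (?B * yh_t 0 ^ k)"
      by (simp add: subst_simps subst_twist_braid_image[OF \<zeta>(1)] scal_mult_power scal_pull markov_familyD(2)[OF M])
    then show ?thesis using \<zeta>(2) by simp
  qed
  then have "(\<Sum>k<d. \<phi> (?B * yh_t 0 ^ k)) = (\<Sum>k<d. if k = 0 then \<phi> ?B else 0)"
    by (intro sum.cong) auto
  then have "(\<Sum>k<d. \<phi> (?B * yh_t 0 ^ k)) = \<phi> ?B" using d by simp
  then have "of_nat d * \<phi> (?B * framing_mean d 0) = \<phi> ?B"
    using d by (simp add: framing_mean_def scal_pull sum_distrib_left markov_familyD(2)[OF M] markov_family_sum[OF M])
  ultimately show ?thesis by simp
qed

end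

section \<open>The Homflypt polynomial as a Markov trace\<close>

definition linear_extension :: "(yh_gen list \<Rightarrow> complex) \<Rightarrow> yh_free \<Rightarrow> complex" where
  "linear_extension f x = (\<Sum>w\<in>Poly_Mapping.keys x. Poly_Mapping.lookup x w * f (letters w))"

lemma linear_extension_add: "linear_extension f (x + y) = linear_extension f x + linear_extension f y"
  unfolding linear_extension_def by (rule sum_keys_add) (simp_all add: distrib_right)

lemma linear_extension_single: "linear_extension f (Poly_Mapping.single w c) = c * f (letters w)"
  by (cases "c = 0") (simp_all add: linear_extension_def)

lemma linear_extension_scal: "linear_extension f (scal c * x) = c * linear_extension f x"
  by (induction x rule: poly_mapping_single_induct)
     (simp_all add: scal_single linear_extension_single linear_extension_add distrib_left)

lemma linear_extension_diff: "linear_extension f (x - y) = linear_extension f x - linear_extension f y"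
  using linear_extension_add[of f x "scal (-1) * y"] linear_extension_scal[of f "-1" y] by (simp add: scal_uminus)

lemma linear_extension_0: "linear_extension f 0 = 0"
  by (simp add: linear_extension_def)

lemma yh_e_1: "yh_e (Suc 0) i = yh_t (Suc i)"
  by (simp add: yh_e_def)

text \<open>
  Framings are forgotten, as they are trivial for \<open>d = 1\<close>.
\<close>

fun braid_letters :: "yh_gen list \<Rightarrow> braid_word" where
  "braid_letters [] = []"
| "braid_letters (G i # l) = (i, True) # braid_letters l"
| "braid_letters (T j # l) = braid_letters l"

lemma braid_letters_append: "braid_letters (l @ m) = braid_letters l @ braid_letters m"
  by (induction l rule: braid_letters.induct) auto

lemma braid_word_letters: "set l \<subseteq> yh_gens n \<Longrightarrow> n \<le> m \<Longrightarrow> braid_word m (braid_letters l)"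
  by (induction l rule: braid_letters.induct) (auto simp: yh_gens_def)

locale homflypt =
  fixes q s :: complex and P :: "link \<Rightarrow> complex"
  assumes params: "admissible q s" and P: "is_Homflypt q s P"
begin

definition "c = q - inverse q"
definition "z = c / (1 - s\<^sup>2)"

lemma nonzero: "q \<noteq> 0" "s \<noteq> 0" "1 - s\<^sup>2 \<noteq> 0" "c \<noteq> 0" "z \<noteq> 0"
proof -
  show "q \<noteq> 0" "s \<noteq> 0" "1 - s\<^sup>2 \<noteq> 0" using params by (auto simp: admissible_def)
  have "q\<^sup>2 \<noteq> 1" using params by (simp add: admissible_def)
  then show "c \<noteq> 0" using \<open>q \<noteq> 0\<close> by (simp add: c_def power2_eq_square field_simps)
  then show "z \<noteq> 0" using \<open>1 - s\<^sup>2 \<noteq> 0\<close> by (simp add: z_def)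
qed

lemma skein: "conway_triple Lp Lm L0 \<Longrightarrow> 1 / s * P Lp - s * P Lm = c * P L0"
  using P by (auto simp: is_Homflypt_def c_def)

lemma conway_triple_closures:
  assumes "Suc i < n" "braid_word n u" "braid_word n v"
  shows "conway_triple (braid_closure n (u @ [(i, True)] @ v)) (braid_closure n (u @ [(i, False)] @ v)) (braid_closure n (u @ v))"
proof -
  let ?X = "cups n @ crossings u" and ?Y = "crossings v @ caps 0 n"
  have "run ?X [] = Some (replicate n True @ replicate n False)"
    using run_crossings[OF assms(2)] by (simp add: run_append run_cups)
  then have st: "strands ?X = replicate n True @ replicate n False" by (simp add: strands_def)
  have par: "parallel ?X i" unfolding parallel_def st using assms(1) by (simp add: nth_append)
  have eqs: "pos_diagram ?X i ?Y = closure_diagram n (u @ [(i, True)] @ v)"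
    "neg_diagram ?X i ?Y = closure_diagram n (u @ [(i, False)] @ v)"
    "smooth_diagram ?X i ?Y = closure_diagram n (u @ v)"
    using par by (simp_all add: pos_diagram_def neg_diagram_def smooth_diagram_def closure_diagram_eq)
  moreover have "link_diagram (closure_diagram n (u @ [(i, True)] @ v))"
    using assms by (intro link_diagram_closure) simp
  ultimately show ?thesis unfolding conway_triple_def braid_closure_def
    by (intro exI[of _ ?X] exI[of _ i] exI[of _ ?Y]) simp
qed

lemma skein_closures:
  assumes "Suc i < n" "braid_word n u" "braid_word n v"
  shows "1 / s * P (braid_closure n (u @ (i, True) # v)) - s * P (braid_closure n (u @ (i, False) # v)) = c * P (braid_closure n (u @ v))"
  using skein[OF conway_triple_closures[OF assms]] by simp

text \<open>
  Smoothing the curl in a stabilised braid splits off an unknot, while both signs of the curl give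
  back the original closure.
\<close>

lemma add_strand:
  assumes "braid_word (Suc n) w"
  shows "P (braid_closure (Suc (Suc n)) w) = 1 / (z * s) * P (braid_closure (Suc n) w)"
proof -
  have "1 / s * P (braid_closure (Suc n) w) - s * P (braid_closure (Suc n) w) = c * P (braid_closure (Suc (Suc n)) w)"
    using skein_closures[of n "Suc (Suc n)" w "[]"] braid_word_mono[OF assms, of "Suc (Suc n)"]
      braid_closure_stabilise[OF assms, of True] braid_closure_stabilise[OF assms, of False] by simp
  then have "c * P (braid_closure (Suc (Suc n)) w) = (1 / s - s) * P (braid_closure (Suc n) w)"
    by (simp add: left_diff_distrib)
  moreover have "1 / s - s = c * (1 / (z * s))"
    using nonzero by (simp add: z_def field_simps power2_eq_square)
  ultimately have "c * P (braid_closure (Suc (Suc n)) w) = c * (1 / (z * s) * P (braid_closure (Suc n) w))"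
    by (simp only: mult.assoc)
  then show ?thesis using nonzero(4) by (simp only: mult_cancel_left) simp
qed

text \<open>
  The factors \<open>\<Lambda>\<close> and \<open>s\<close> in the definition of an invariant from
  a trace are removed. On \<open>0\<close> strands the value is that of the closure of one trivial
  strand.
\<close>

definition word_value :: "nat \<Rightarrow> yh_gen list \<Rightarrow> complex" where
  "word_value n l = (z * s) ^ (max 1 n - 1) * inverse s ^ length (braid_letters l) * P (braid_closure (max 1 n) (braid_letters l))"

definition P_functional :: "nat \<Rightarrow> yh_free \<Rightarrow> complex" where
  "P_functional n = linear_extension (word_value n)"

lemma P_functional_linear:
  "P_functional n (x + y) = P_functional n x + P_functional n y"
  "P_functional n (x - y) = P_functional n x - P_functional n y"
  "P_functional n (scal a * x) = a * P_functional n x"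
  "P_functional n 0 = 0"
  "P_functional n (word_monomial l) = word_value n l"
  by (simp_all add: P_functional_def linear_extension_add linear_extension_diff linear_extension_scal linear_extension_0 linear_extension_single)

text \<open>
  Each relation of the Hecke algebra is an isotopy of closed braids, except for the quadratic
  relation, which is the skein relation.
\<close>

lemma P_functional_relator:
  assumes r: "r \<in> yh_relators 1 q n" and l: "set l \<subseteq> yh_gens n" and m: "set m \<subseteq> yh_gens n"
  shows "P_functional n (word_monomial l * r * word_monomial m) = 0"
proof -
  let ?N = "max 1 n" and ?u = "braid_letters l" and ?v = "braid_letters m"
  have bw: "braid_word ?N ?u" "braid_word ?N ?v" "braid_word ?N (?u @ ?v)" "\<And>i. Suc i < n \<Longrightarrow> Suc i < ?N"
    using braid_word_letters l m by (auto simp: le_max_iff_disj)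
  note expand = yh_g_eq yh_t_eq word_monomial_mult left_diff_distrib right_diff_distrib P_functional_linear
    word_value_def braid_letters_append word_monomial_Nil[symmetric]
  show ?thesis using r
  proof cases
    case (braid i)
    then show ?thesis
      using braid_closure_braid_relation[of i ?N ?u ?v True] bw by (simp add: expand)
  next
    case (far i j)
    then show ?thesis
      using braid_closure_far[of i ?N j ?u ?v True True] bw by (simp add: expand)
  next
    case (comm i j)
    then show ?thesis by (simp add: expand)
  next
    case (swap i j)
    then show ?thesis by (simp add: expand)
  next
    case (torsion j)
    have "r = yh_t j - word_monomial []" using torsion by (simp add: word_monomial_Nil)
    then show ?thesis by (simp add: expand)
  next
    case (quadratic i)
    let ?K = "(z * s) ^ (?N - 1) * inverse s ^ (length ?u + length ?v)"
    have i: "Suc i < ?N" using quadratic bw(4) by simp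
    have "1 / s * P (braid_closure ?N ((?u @ [(i, True)]) @ (i, True) # ?v)) - s * P (braid_closure ?N ((?u @ [(i, True)]) @ (i, False) # ?v))
       = c * P (braid_closure ?N ((?u @ [(i, True)]) @ ?v))"
      by (rule skein_closures) (use i bw in auto)
    moreover have "braid_closure ?N (?u @ [(i, True), (i, False)] @ ?v) = braid_closure ?N (?u @ ?v)"
      using braid_closure_cancel[of i ?N ?u ?v True] i bw by simp
    ultimately have sk: "1 / s * P (braid_closure ?N (?u @ (i, True) # (i, True) # ?v)) - s * P (braid_closure ?N (?u @ ?v))
       = c * P (braid_closure ?N (?u @ (i, True) # ?v))" by simp
    have r: "r = yh_g i * yh_g i - (word_monomial [] + scal c * (yh_t (Suc i) * yh_g i))"
      using quadratic by (simp add: yh_e_1 power2_eq_square c_def word_monomial_Nil mult.assoc)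
    have "word_monomial l * r * word_monomial m = word_monomial (l @ [G i, G i] @ m) -
        (word_monomial (l @ m) + scal c * word_monomial (l @ [T (Suc i), G i] @ m))"
    proof -
      have "word_monomial l * (scal c * word_monomial [T (Suc i), G i]) * word_monomial m = scal c * word_monomial (l @ [T (Suc i), G i] @ m)"
        by (simp only: scal_left_commute mult.assoc word_monomial_mult append_assoc)
      then show ?thesis
        by (simp add: r yh_g_eq yh_t_eq word_monomial_mult left_diff_distrib right_diff_distrib distrib_left distrib_right)
    qed
    then have "P_functional n (word_monomial l * r * word_monomial m) =
       ?K * inverse s * (inverse s * P (braid_closure ?N (?u @ (i, True) # (i, True) # ?v)) - s * P (braid_closure ?N (?u @ ?v))
         - c * P (braid_closure ?N (?u @ (i, True) # ?v)))"
      by (simp only: P_functional_linear word_value_def braid_letters_append)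
         (use nonzero in \<open>simp add: field_simps power_add\<close>)
    then show ?thesis using sk by (simp add: inverse_eq_divide)
  qed
qed

lemma P_functional_relator_context:
  assumes r: "r \<in> yh_relators 1 q n" and a: "a \<in> yh_free_on n" and b: "b \<in> yh_free_on n"
  shows "P_functional n (a * r * b) = 0"
  using a
proof (induction rule: free_on_induct)
  case (monomial e l)
  show ?case using b
  proof (induction rule: free_on_induct)
    case (monomial e' m)
    have "scal e * word_monomial l * r * (scal e' * word_monomial m) = scal (e * e') * (word_monomial l * r * word_monomial m)"
      by (simp add: scal_pull scal_scal mult.assoc)
    then show ?case using P_functional_relator[OF r \<open>set l \<subseteq> yh_gens n\<close> monomial] by (simp add: P_functional_linear)
  qed (simp add: distrib_left P_functional_linear)
qed (simp add: distrib_right P_functional_linear)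

lemma P_functional_ideal: "x \<in> yh_ideal 1 q n \<Longrightarrow> P_functional n x = 0"
  by (induction rule: yh_ideal.induct) (simp_all add: P_functional_linear P_functional_relator_context)

lemma P_functional_trace:
  assumes a: "a \<in> yh_free_on n" and b: "b \<in> yh_free_on n"
  shows "P_functional n (a * b) = P_functional n (b * a)"
  using a
proof (induction rule: free_on_induct)
  case (monomial e l)
  show ?case using b
  proof (induction rule: free_on_induct)
    case (monomial e' m)
    have "scal e * word_monomial l * (scal e' * word_monomial m) = scal (e * e') * word_monomial (l @ m)"
      "scal e' * word_monomial m * (scal e * word_monomial l) = scal (e * e') * word_monomial (m @ l)"
      by (simp_all add: scal_pull scal_scal mult.assoc mult.commute[of e'] flip: word_monomial_mult)
    moreover have "braid_word (max 1 n) (braid_letters l @ braid_letters m)"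
      using braid_word_letters \<open>set l \<subseteq> yh_gens n\<close> monomial by (auto simp: le_max_iff_disj)
    ultimately show ?case
      using braid_closure_cycle[of "max 1 n" "braid_letters l" "braid_letters m"]
      by (simp only: P_functional_linear word_value_def braid_letters_append) (simp add: add.commute)
  qed (simp add: distrib_left distrib_right P_functional_linear)
qed (simp add: distrib_left distrib_right P_functional_linear)

lemma P_functional_markov: "markov_family 1 q z P_functional"
  unfolding markov_family_def
proof (intro conjI allI ballI impI)
  fix n a assume "a \<in> yh_free_on n"
  then show "P_functional (Suc n) a = P_functional n a"
  proof (induction rule: free_on_induct)
    case (monomial e l)
    have "word_value (Suc n) l = word_value n l"
    proof (cases n)
      case (Suc m)
      have "braid_word (Suc m) (braid_letters l)" using braid_word_letters[OF monomial] Suc by simp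
      from add_strand[OF this] show ?thesis using nonzero by (simp add: word_value_def Suc)
    qed (simp add: word_value_def)
    then show ?case by (simp only: P_functional_linear)
  qed (simp add: P_functional_linear)
next
  fix n a assume "a \<in> yh_free_on (Suc n)"
  then show "P_functional (Suc (Suc n)) (a * yh_g n) = z * P_functional (Suc n) a"
  proof (induction rule: free_on_induct)
    case (monomial e l)
    have "braid_word (Suc n) (braid_letters l)" using braid_word_letters[OF monomial] by simp
    from braid_closure_stabilise[OF this, of True] have "word_value (Suc (Suc n)) (l @ [G n]) = z * word_value (Suc n) l"
      using nonzero by (simp add: word_value_def braid_letters_append)
    then show ?case by (simp only: yh_g_eq mult.assoc word_monomial_mult P_functional_linear) simp
  qed (simp add: P_functional_linear distrib_left distrib_right)
qed (auto simp: P_functional_linear P_functional_ideal intro: P_functional_trace)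

lemma P_functional_1: "P_functional 0 1 = 1"
proof -
  have "braid_closure 1 [] = unknot" by (simp add: braid_closure_def closure_diagram_def unknot_def)
  then show ?thesis using P P_functional_linear(5)[of 0 "[]"] by (simp add: word_monomial_Nil word_value_def is_Homflypt_def)
qed

text \<open>
  The formula for \<open>g\<^sub>i\<^sup>-\<^sup>1\<close> is the skein relation once more.
\<close>

lemma P_functional_braid_image:
  assumes "braid_word (Suc n) w"
  shows "P_functional (Suc n) (braid_image 1 q w) = (z * s) ^ n * s powi (- exponent_sum w) * P (braid_closure (Suc n) w)"
proof -
  have "P_functional (Suc n) (word_monomial l * braid_image 1 q w) =
      (z * s) ^ n * inverse s ^ length (braid_letters l) * s powi (- exponent_sum w) * P (braid_closure (Suc n) (braid_letters l @ w))"
    if "set l \<subseteq> yh_gens (Suc n)" for l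
    using assms that
  proof (induction w arbitrary: l)
    case Nil
    then show ?case by (simp add: P_functional_linear word_value_def exponent_sum_def)
  next
    case (Cons a w)
    obtain i b where a: "a = (i, b)" by force
    let ?N = "Suc n" and ?u = "braid_letters l"
    from Cons.prems have i: "Suc i < ?N" "braid_word ?N w" by (auto simp: a)
    have bl: "braid_word ?N ?u" using braid_word_letters[OF Cons.prems(2)] by simp
    have G: "set (l @ [G i]) \<subseteq> yh_gens ?N" "set (l @ [T (Suc i)]) \<subseteq> yh_gens ?N"
      using Cons.prems i by (auto simp: yh_gens_def)
    have 1: "P_functional ?N (word_monomial (l @ [G i]) * braid_image 1 q w) =
      (z * s) ^ n * inverse s ^ Suc (length ?u) * s powi (- exponent_sum w) * P (braid_closure ?N (?u @ (i, True) # w))"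
      using Cons.IH[OF i(2) G(1)] by (simp add: braid_letters_append)
    have 2: "P_functional ?N (word_monomial (l @ [T (Suc i)]) * braid_image 1 q w) =
      (z * s) ^ n * inverse s ^ length ?u * s powi (- exponent_sum w) * P (braid_closure ?N (?u @ w))"
      using Cons.IH[OF i(2) G(2)] by (simp add: braid_letters_append)
    show ?case
    proof (cases b)
      case True
      have "exponent_sum (a # w) = 1 + exponent_sum w" by (simp add: a True exponent_sum_def)
      then have "s powi (- exponent_sum (a # w)) = inverse s * s powi (- exponent_sum w)"
        using nonzero by (simp add: power_int_diff inverse_eq_divide power_int_minus field_simps power_int_add)
      then show ?thesis using 1 True by (simp add: a yh_g_eq mult.assoc flip: word_monomial_mult)
    next
      case False
      have "- exponent_sum (a # w) = 1 + - exponent_sum w" by (simp add: a False exponent_sum_def)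
      then have pw: "s powi (- exponent_sum (a # w)) = s * s powi (- exponent_sum w)"
        using nonzero power_int_add[of s 1 "- exponent_sum w"] by (simp only:) simp
      have "word_monomial l * braid_image 1 q (a # w) = word_monomial (l @ [G i]) * braid_image 1 q w - scal c * (word_monomial (l @ [T (Suc i)]) * braid_image 1 q w)"
      proof -
        have "word_monomial l * (scal c * word_monomial [T (Suc i)] * braid_image 1 q w) = scal c * (word_monomial (l @ [T (Suc i)]) * braid_image 1 q w)"
          by (simp only: scal_left_commute[of "word_monomial l"] mult.assoc flip: word_monomial_mult)
        moreover have "word_monomial l * (word_monomial [G i] * braid_image 1 q w) = word_monomial (l @ [G i]) * braid_image 1 q w"
          by (simp only: mult.assoc flip: word_monomial_mult)
        ultimately show ?thesis
          by (simp add: a False yh_ginv_def yh_e_1 c_def yh_g_eq yh_t_eq left_diff_distrib right_diff_distrib)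
      qed
      then have "P_functional ?N (word_monomial l * braid_image 1 q (a # w)) =
         (z * s) ^ n * inverse s ^ length ?u * s powi (- exponent_sum w) *
          (1 / s * P (braid_closure ?N (?u @ (i, True) # w)) - c * P (braid_closure ?N (?u @ w)))"
        by (simp only: P_functional_linear 1 2) (simp add: algebra_simps divide_inverse)
      also have "1 / s * P (braid_closure ?N (?u @ (i, True) # w)) - c * P (braid_closure ?N (?u @ w)) = s * P (braid_closure ?N (?u @ (i, False) # w))"
        using skein_closures[OF i(1) bl i(2)] by (simp add: algebra_simps)
      finally show ?thesis unfolding pw by (simp add: a False mult_ac)
    qed
  qed
  from this[of "[]"] show ?thesis by (simp add: word_monomial_Nil)
qed

end

definition unframe_gen :: "yh_gen \<Rightarrow> yh_free" where
  "unframe_gen a = (case a of G i \<Rightarrow> yh_g i | T j \<Rightarrow> 1)"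

lemma unframe_gen_simps [simp]: "unframe_gen (G i) = yh_g i" "unframe_gen (T j) = 1"
  by (simp_all add: unframe_gen_def)

lemma unframe_gen_free_on: "a \<in> yh_gens n \<Longrightarrow> unframe_gen a \<in> yh_free_on n"
  by (auto simp: yh_gens_def intro!: free_on_g)

lemma unframe_free_on: "x \<in> yh_free_on n \<Longrightarrow> subst unframe_gen x \<in> yh_free_on n"
  by (rule subst_free_on[OF unframe_gen_free_on])

context
  fixes d q z \<phi>
  assumes M: "markov_family d q z (\<lambda>_. \<phi>)" and d: "1 \<le> d"
begin

text \<open>
  The Markov trace on Hecke algebras induced by \<open>\<phi>\<close> on the part of the
  Yokonuma-Hecke algebra where all framings act trivially.
\<close>

definition framed_functional :: "nat \<Rightarrow> yh_free \<Rightarrow> complex" where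
  "framed_functional n x = of_nat d ^ n * \<phi> (subst unframe_gen x * mean_idempotent d n)"

text \<open>
  In the presence of the average, \<open>e\<^sub>i\<close> can be replaced by \<open>1\<close>.
\<close>

lemma unframe_relator:
  assumes "r \<in> yh_relators 1 q n"
  shows "yh_cong d q n (subst unframe_gen r * mean_idempotent d n) 0"
proof -
  let ?E = "mean_idempotent d n"
  have E: "?E \<in> yh_free_on n" by (simp add: free_on_mean_idempotent)
  show ?thesis using assms
  proof cases
    case (braid i)
    have "yh_cong d q n (subst unframe_gen r) 0" 
      using relation_braid[OF braid(2), of d q] by (simp add: braid subst_simps yh_cong_def)
    from cong_right[OF this E] show ?thesis by simp
  next
    case (far i j)
    have "yh_cong d q n (subst unframe_gen r) 0" 
      using relation_far[OF far(2-4), of d q] by (simp add: far subst_simps yh_cong_def)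
    from cong_right[OF this E] show ?thesis by simp
  next
    case (quadratic i)
    have g: "yh_g i \<in> yh_free_on n" by (rule free_on_g[OF quadratic(2)])
    have e: "yh_e d i \<in> yh_free_on n" by (rule free_on_e[OF quadratic(2)])
    have gE: "yh_cong d q n (yh_g i * ?E) (?E * yh_g i)"
      by (intro intertwinesD mean_idempotent_central d g)
    have "yh_cong d q n (yh_e d i * (yh_g i * ?E)) (yh_e d i * (?E * yh_g i))"
      by (intro cong_left gE e)
    also have "yh_e d i * (?E * yh_g i) = (yh_e d i * ?E) * yh_g i" by (simp add: mult.assoc)
    also have "yh_cong d q n \<dots> (?E * yh_g i)"
      by (intro cong_right e_mean_idempotent d quadratic g)
    also have "yh_cong d q n (?E * yh_g i) (yh_g i * ?E)" by (rule cong_sym[OF gE])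
    finally have ege: "yh_cong d q n (scal (q - inverse q) * (yh_e d i * (yh_g i * ?E))) (scal (q - inverse q) * (yh_g i * ?E))"
      by (rule cong_scal)
    have "yh_cong d q n ((yh_g i * yh_g i) * ?E) ((1 + scal (q - inverse q) * yh_e d i * yh_g i) * ?E)"
      by (intro cong_right relation_quadratic quadratic E)
    also have "(1 + scal (q - inverse q) * yh_e d i * yh_g i) * ?E = ?E + scal (q - inverse q) * (yh_e d i * (yh_g i * ?E))"
      by (simp add: distrib_right mult.assoc)
    also have "yh_cong d q n \<dots> (?E + scal (q - inverse q) * (yh_g i * ?E))"
      by (intro cong_add cong_refl ege)
    finally have "yh_cong d q n (yh_g i * yh_g i * ?E - (?E + scal (q - inverse q) * (yh_g i * ?E))) 0"
      by (simp add: yh_cong_def)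
    then show ?thesis by (simp add: quadratic yh_e_1 subst_simps power2_eq_square left_diff_distrib distrib_right mult.assoc)
  qed (simp_all add: subst_simps)
qed

lemma unframe_ideal: "x \<in> yh_ideal 1 q n \<Longrightarrow> yh_cong d q n (subst unframe_gen x * mean_idempotent d n) 0"
proof (induction rule: yh_ideal.induct)
  case (add x y)
  from cong_add[OF add.IH] show ?case by (simp add: subst_add distrib_right)
next
  case (gen a r b)
  let ?E = "mean_idempotent d n" and ?s = "subst unframe_gen"
  have F: "?s a \<in> yh_free_on n" "?s b \<in> yh_free_on n" using gen by (auto intro: unframe_free_on)
  have R: "?s r \<in> yh_free_on n"
  proof -
    have "r \<in> yh_free_on n" using gen(2)
      by cases (auto intro!: free_on_intros free_on_e transpose_less)
    then show ?thesis by (rule unframe_free_on)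
  qed
  have "yh_cong d q n ((?s a * ?s r) * (?s b * ?E)) ((?s a * ?s r) * (?E * ?s b))"
    by (intro cong_left intertwinesD mean_idempotent_central d F R free_on_mult)
  also have "(?s a * ?s r) * (?E * ?s b) = ?s a * (?s r * ?E) * ?s b" by (simp add: mult.assoc)
  also have "yh_cong d q n \<dots> (?s a * 0 * ?s b)"
    by (intro cong_context unframe_relator gen F)
  finally show ?case by (simp add: subst_mult mult.assoc)
qed (simp add: subst_0)

text \<open>
  An additional factor in the average contributes \<open>1 / d\<close> to the trace, since only
  the trivial framing of the last strand survives; this accounts for the normalisation. If a
  generator \<open>g\<^sub>n\<close> is present, it moves that factor to strand \<open>n\<close>,
  where it is absorbed, so the Markov parameter is multiplied by \<open>d\<close>.
\<close>

lemma framed_functional_markov: "markov_family 1 q (of_nat d * z) framed_functional"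
  unfolding markov_family_def framed_functional_def
proof (intro conjI allI ballI impI)
  note D = markov_familyD[OF M]
  fix n
  show "of_nat d ^ n * \<phi> (subst unframe_gen (x + y) * mean_idempotent d n) =
     of_nat d ^ n * \<phi> (subst unframe_gen x * mean_idempotent d n) + of_nat d ^ n * \<phi> (subst unframe_gen y * mean_idempotent d n)" for x y
    by (simp add: subst_add distrib_left distrib_right D)
  show "of_nat d ^ n * \<phi> (subst unframe_gen (scal c * x) * mean_idempotent d n) = c * (of_nat d ^ n * \<phi> (subst unframe_gen x * mean_idempotent d n))" for c x
    by (simp add: subst_mult subst_scal mult.assoc D)
  show "of_nat d ^ n * \<phi> (subst unframe_gen x * mean_idempotent d n) = 0" if "x \<in> yh_ideal 1 q n" for x
    using markov_family_cong[OF M unframe_ideal[OF that]] markov_family_0[OF M] by simp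
  let ?E = "mean_idempotent d n" and ?s = "subst unframe_gen"
  have E: "?E \<in> yh_free_on n" by (simp add: free_on_mean_idempotent)
  show "of_nat d ^ n * \<phi> (?s (a * b) * ?E) = of_nat d ^ n * \<phi> (?s (b * a) * ?E)"
    if ab: "a \<in> yh_free_on n" "b \<in> yh_free_on n" for a b
  proof -
    have F: "?s a \<in> yh_free_on n" "?s b \<in> yh_free_on n" using ab by (auto intro: unframe_free_on)
    have "\<phi> (?s a * (?s b * ?E)) = \<phi> ((?s b * ?E) * ?s a)"
      by (rule D(4)[where n = n]) (intro F E free_on_mult)+
    also have "\<dots> = \<phi> (?s b * (?E * ?s a))" by (simp add: mult.assoc)
    also have "\<dots> = \<phi> (?s b * (?s a * ?E))"
      by (intro markov_family_cong[OF M, where n = n] cong_left cong_sym[OF intertwinesD[OF mean_idempotent_central]] F d)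
    finally show ?thesis by (simp add: subst_mult mult.assoc)
  qed
  show "of_nat d ^ Suc n * \<phi> (?s a * mean_idempotent d (Suc n)) = of_nat d ^ n * \<phi> (?s a * ?E)"
    if a: "a \<in> yh_free_on n" for a
  proof -
    let ?x = "?s a * ?E"
    have x: "?x \<in> yh_free_on n" using a by (intro free_on_mult E unframe_free_on)
    have "\<phi> (?x * framing_mean d n) = 1 / of_nat d * (\<Sum>k<d. \<phi> (?x * yh_t n ^ k))"
      by (simp only: framing_mean_def scal_left_commute[of ?x] D(2) sum_distrib_left[of ?x] markov_family_sum[OF M])
    also have "(\<Sum>k<d. \<phi> (?x * yh_t n ^ k)) = (\<Sum>k<d. if k = 0 then \<phi> ?x else 0)"
      by (intro sum.cong refl) (auto intro: D(7)[OF x])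
    also have "\<dots> = \<phi> ?x" using d by simp
    finally show ?thesis using d by (simp add: mult.assoc)
  qed
  show "of_nat d ^ Suc (Suc n) * \<phi> (?s (a * yh_g n) * mean_idempotent d (Suc (Suc n))) =
     of_nat d * z * (of_nat d ^ Suc n * \<phi> (?s a * mean_idempotent d (Suc n)))"
    if a: "a \<in> yh_free_on (Suc n)" for a
  proof -
    let ?E1 = "mean_idempotent d (Suc n)" and ?N = "Suc (Suc n)"
    have sa: "?s a \<in> yh_free_on (Suc n)" "?s a \<in> yh_free_on ?N" using a free_on_mono by (auto intro: unframe_free_on)
    have E1: "?E1 \<in> yh_free_on (Suc n)" "?E1 \<in> yh_free_on ?N" by (simp_all add: free_on_mean_idempotent del: mean_idempotent.simps)
    have g: "yh_g n \<in> yh_free_on ?N" by (simp add: free_on_g)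
    have m: "framing_mean d n \<in> yh_free_on (Suc n)" "framing_mean d n \<in> yh_free_on ?N" by (simp_all add: free_on_framing_mean)
    have "\<phi> (?s a * (yh_g n * mean_idempotent d ?N)) = \<phi> (?s a * (mean_idempotent d ?N * yh_g n))"
      by (intro markov_family_cong[OF M, where n = ?N] cong_left intertwinesD[OF mean_idempotent_central] sa g d)
    also have "\<dots> = \<phi> ((?s a * ?E1) * (framing_mean d (Suc n) * yh_g n))" by (simp add: mult.assoc)
    also have "\<dots> = \<phi> ((?s a * ?E1) * (yh_g n * framing_mean d n))"
      using intertwines_t_g[of n ?N "Suc n" d q] 
      by (intro markov_family_cong[OF M, where n = ?N] cong_left intertwinesD[OF intertwines_framing_mean[OF d]] free_on_mult sa E1)
         (simp add: transpose_def)
    also have "\<dots> = \<phi> ((?s a * ?E1 * yh_g n) * framing_mean d n)" by (simp add: mult.assoc)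
    also have "\<dots> = \<phi> (framing_mean d n * (?s a * ?E1 * yh_g n))"
      by (rule D(4)[where n = ?N]) (intro free_on_mult sa E1 g m)+
    also have "\<dots> = \<phi> ((framing_mean d n * ?s a * ?E1) * yh_g n)" by (simp add: mult.assoc)
    also have "\<dots> = z * \<phi> (framing_mean d n * ?s a * ?E1)"
      by (rule D(6)) (intro free_on_mult sa E1 m)
    also have "framing_mean d n * ?s a * ?E1 = framing_mean d n * (?s a * ?E1)" by (rule mult.assoc)
    also have "\<phi> (framing_mean d n * (?s a * ?E1)) = \<phi> ((?s a * ?E1) * framing_mean d n)"
      by (rule D(4)[where n = "Suc n"]) (intro free_on_mult sa E1 m)+
    also have "\<dots> = \<phi> (?s a * (?E1 * framing_mean d n))" by (simp only: mult.assoc)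
    also have "\<dots> = \<phi> (?s a * (framing_mean d n * ?E1))"
      by (intro markov_family_cong[OF M, where n = "Suc n"] cong_left cong_sym[OF intertwinesD[OF intertwines_mean_mean_idempotent]] sa d) auto
    also have "\<dots> = \<phi> (?s a * ?E1)"
      by (intro markov_family_cong[OF M, where n = "Suc n"] cong_left framing_mean_mean_idempotent sa d) auto
    finally show ?thesis by (simp add: subst_simps mult.assoc del: mean_idempotent.simps)
  qed
qed auto

lemma unframe_braid_image:
  "braid_word n w \<Longrightarrow> yh_cong d q n (subst unframe_gen (braid_image 1 q w) * mean_idempotent d n) (braid_image d q w * mean_idempotent d n)"
proof (induction w)
  case (Cons a w)
  let ?E = "mean_idempotent d n" and ?s = "subst unframe_gen"
  have E: "?E \<in> yh_free_on n" by (simp add: free_on_mean_idempotent)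
  obtain i b where a: "a = (i, b)" by force
  from Cons.prems have i: "Suc i < n" "braid_word n w" by (auto simp: a)
  let ?X = "?s (braid_image 1 q w)" and ?B = "braid_image d q w"
  have IH: "yh_cong d q n (?X * ?E) (?B * ?E)" using Cons i by simp
  have B: "?B \<in> yh_free_on n" by (rule free_on_braid_image[OF i(2)])
  have g: "yh_g i \<in> yh_free_on n" by (rule free_on_g[OF i(1)])
  have e: "yh_e d i \<in> yh_free_on n" by (rule free_on_e[OF i(1)])
  show ?case
  proof (cases b)
    case True
    from cong_left[OF IH g] show ?thesis by (simp add: a True subst_simps mult.assoc)
  next
    case False
    have BE: "yh_cong d q n (?B * ?E) (?E * ?B)" by (intro intertwinesD mean_idempotent_central d B)
    have "yh_cong d q n (?B * ?E) (?E * ?B)" by (rule BE)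
    also have "yh_cong d q n (?E * ?B) ((yh_e d i * ?E) * ?B)"
      by (intro cong_right cong_sym[OF e_mean_idempotent[OF d i(1)]] B)
    also have "(yh_e d i * ?E) * ?B = yh_e d i * (?E * ?B)" by (rule mult.assoc)
    also have "yh_cong d q n (yh_e d i * (?E * ?B)) (yh_e d i * (?B * ?E))"
      by (intro cong_left cong_sym[OF BE] e)
    finally have "yh_cong d q n (?X * ?E) (yh_e d i * (?B * ?E))" using IH cong_trans by blast
    then have "yh_cong d q n (yh_g i * (?X * ?E) - scal (q - inverse q) * (?X * ?E)) (yh_g i * (?B * ?E) - scal (q - inverse q) * (yh_e d i * (?B * ?E)))"
      by (intro cong_diff cong_scal cong_left IH g)
    then show ?thesis by (simp add: a False subst_simps yh_ginv_def yh_e_1 left_diff_distrib mult.assoc)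
  qed
qed (simp add: subst_1)

end

text \<open>
  Both sides are values of Markov families with the same parameter.
\<close>

theorem (in homflypt) P_braid_closure:
  assumes M: "markov_family d q (z / of_nat d) (\<lambda>_. \<phi>)" and d: "1 \<le> d" and "\<phi> 1 = 1" and w: "braid_word (Suc n) w"
  shows "P (braid_closure (Suc n) w) = (1 / (z * s)) ^ n * s powi exponent_sum w *
     (of_nat d ^ Suc n * \<phi> (braid_image d q w * mean_idempotent d (Suc n)))"
proof -
  have "markov_family 1 q z (framed_functional d \<phi>)"
    using framed_functional_markov[OF M d] d by simp
  moreover have "framed_functional d \<phi> 0 1 = 1"
    using assms(3) by (simp add: framed_functional_def[OF M d] subst_1)
  moreover have "braid_image 1 q w \<in> yh_free_on (Suc n)" by (rule free_on_braid_image[OF w])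
  ultimately have "P_functional (Suc n) (braid_image 1 q w) = framed_functional d \<phi> (Suc n) (braid_image 1 q w)"
    using markov_family_unique[OF P_functional_markov, of "framed_functional d \<phi>"] P_functional_1 by simp
  also have "\<dots> = of_nat d ^ Suc n * \<phi> (braid_image d q w * mean_idempotent d (Suc n))"
    unfolding framed_functional_def[OF M d] using markov_family_cong[OF M unframe_braid_image[OF M d w]] by simp
  finally have "(z * s) ^ n * s powi (- exponent_sum w) * P (braid_closure (Suc n) w) =
     of_nat d ^ Suc n * \<phi> (braid_image d q w * mean_idempotent d (Suc n))"
    unfolding P_functional_braid_image[OF w] .
  then show ?thesis using nonzero by (simp add: power_int_minus field_simps)
qed

section \<open>Resolutions\<close>

lemma eval_laurent_0 [simp]: "eval_laurent q s 0 = 0"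
  by (simp add: eval_laurent_def)

lemma eval_laurent_add: "eval_laurent q s (x + y) = eval_laurent q s x + eval_laurent q s y"
  unfolding eval_laurent_def case_prod_unfold prod.collapse
  by (rule sum_keys_add[where f = "\<lambda>w r. of_rat r * q powi fst w * s powi snd w"])
     (simp_all add: of_rat_add distrib_right)

lemma eval_laurent_single: "eval_laurent q s (Poly_Mapping.single (a, b) r) = of_rat r * q powi a * s powi b"
  by (cases "r = 0") (simp_all add: eval_laurent_def)

lemma eval_laurent_uminus: "eval_laurent q s (- x) = - eval_laurent q s x"
  using eval_laurent_add[of q s x "- x"] by (simp add: add_eq_0_iff)

lemma eval_laurent_diff: "eval_laurent q s (x - y) = eval_laurent q s x - eval_laurent q s y"
  using eval_laurent_add[of q s x "- y"] by (simp add: eval_laurent_uminus)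

lemma eval_laurent_mult:
  assumes "q \<noteq> 0" "s \<noteq> 0"
  shows "eval_laurent q s (x * y) = eval_laurent q s x * eval_laurent q s y"
proof (induction x rule: poly_mapping_single_induct)
  case (single v r)
  obtain a b where v: "v = (a, b)" by force
  show ?case
  proof (induction y rule: poly_mapping_single_induct)
    case (single w t)
    obtain a' b' where "w = (a', b')" by force
    then show ?case using assms by (simp add: v mult_single eval_laurent_single of_rat_mult power_int_add)
  qed (simp add: distrib_left eval_laurent_add)
qed (simp add: distrib_right eval_laurent_add)

definition comb_value :: "complex \<Rightarrow> complex \<Rightarrow> (link \<Rightarrow> complex) \<Rightarrow> link_comb \<Rightarrow> complex" where
  "comb_value q s F C = (\<Sum>K\<in>Poly_Mapping.keys C. eval_laurent q s (Poly_Mapping.lookup C K) * F K)"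

lemma comb_value_add: "comb_value q s F (x + y) = comb_value q s F x + comb_value q s F y"
  unfolding comb_value_def by (rule sum_keys_add) (simp_all add: eval_laurent_add distrib_right)

lemma comb_value_single: "comb_value q s F (Poly_Mapping.single K c) = eval_laurent q s c * F K"
  by (cases "c = 0") (simp_all add: comb_value_def)

lemma comb_value_diff: "comb_value q s F (x - y) = comb_value q s F x - comb_value q s F y"
  using comb_value_add[of q s F "x - y" y] by simp

lemma comb_value_replace:
  assumes "q \<noteq> 0" "s \<noteq> 0" "F L = eval_laurent q s x * F L' + eval_laurent q s y * F L0"
  shows "comb_value q s F (replace_link C L x L' y L0) = comb_value q s F C"
  by (simp add: replace_link_def Let_def comb_value_add comb_value_diff comb_value_single
      eval_laurent_mult[OF assms(1,2)] assms(3) distrib_left)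

lemma comb_value_resolves:
  assumes "q \<noteq> 0" "s \<noteq> 0" "resolves_to L C"
    and F: "\<And>Lp Lm L0. mixed_conway_triple Lp Lm L0 \<Longrightarrow> F Lp = s\<^sup>2 * F Lm + (q - inverse q) * s * F L0"
  shows "comb_value q s F C = F L"
  using assms(3)
proof (induction rule: resolves_to.induct)
  case start
  have "eval_laurent q s (Poly_Mapping.single 0 1) = 1"
    using eval_laurent_single[of q s 0 0 1] by (simp add: zero_prod_def)
  then show ?case by (simp add: comb_value_single)
next
  case (pos C Lp Lm L0)
  have "comb_value q s F (replace_link C Lp (monomial 0 2) Lm ((monomial 1 0 - monomial (- 1) 0) * monomial 0 1) L0) = comb_value q s F C"
    by (rule comb_value_replace)
       (use assms(1,2) F[OF pos(2)] in \<open>simp_all add: monomial_def eval_laurent_mult eval_laurent_diff eval_laurent_single power_int_minus\<close>)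
  then show ?case using pos by simp
next
  case (neg C Lp Lm L0)
  have "s\<^sup>2 * F Lm = F Lp - (q - inverse q) * s * F L0" using F[OF neg(2)] by simp
  then have "F Lm = inverse (s\<^sup>2) * (F Lp - (q - inverse q) * s * F L0)"
    using assms(2) by (simp add: field_simps)
  then have "F Lm = inverse (s\<^sup>2) * F Lp + - (q - inverse q) * inverse s * F L0"
    using assms(2) by (simp add: power2_eq_square field_simps)
  then have "comb_value q s F (replace_link C Lm (monomial 0 (- 2)) Lp (- (monomial 1 0 - monomial (- 1) 0) * monomial 0 (- 1)) L0) = comb_value q s F C"
    using assms(1,2)
    by (intro comb_value_replace) (simp_all add: monomial_def eval_laurent_mult eval_laurent_diff eval_laurent_single eval_laurent_uminus power_int_minus)
  then show ?case using neg by simp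
qed

section \<open>Strands of closed braids\<close>

lemma trace_markov_family:
  assumes "yh_trace d q tr"
  shows "markov_family d q z (\<lambda>_ x. poly (tr x) z)"
  using assms unfolding yh_trace_def markov_family_def by (auto simp: poly_smult)

lemma strand_end_inj: "inj (strand_end w)"
proof (induction w)
  case (Cons a w)
  obtain i b where a: "a = (i, b)" by force
  have "strand_end (a # w) = strand_end w \<circ> transpose i (Suc i)" by (auto simp: a)
  then show ?case using inj_compose[OF Cons.IH inj_transpose[of i "Suc i"]] by (simp only:)
qed (simp add: inj_on_def)

lemma strand_end_surj:
  assumes "braid_word n w" "k < n" obtains j where "j < n" "strand_end w j = k"
proof -
  have "strand_end w ` {..<n} = {..<n}"
    by (rule endo_inj_surj) (use assms strand_end_less inj_on_subset[OF strand_end_inj] in auto)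
  then show ?thesis using that assms(2) by (metis imageE lessThan_iff)
qed

lemma connected_strands_sym: "connected_strands w n i j \<Longrightarrow> connected_strands w n j i"
  unfolding connected_strands_def by (rule equivclp_sym)

lemma connected_strands_end:
  assumes "j < n" shows "connected_strands w n i (strand_end w j) \<longleftrightarrow> connected_strands w n i j"
proof -
  have "connected_strands w n j (strand_end w j)"
    unfolding connected_strands_def using assms by (intro r_into_equivclp) simp
  then show ?thesis unfolding connected_strands_def
    using equivclp_trans[of _ i j "strand_end w j"] equivclp_trans[of _ i "strand_end w j" j]
      equivclp_sym[of _ j "strand_end w j"] by blast
qed

lemma permute_replicate: "braid_word n w \<Longrightarrow> permute w (replicate n x) = replicate n x"
proof (induction w)
  case (Cons a w)
  obtain i b where a: "a = (i, b)" by force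
  have "swap_at i (replicate n x) = replicate n x" using Cons.prems
    by (intro nth_equalityI) (auto simp: a swap_at_def nth_list_update)
  then show ?case using Cons by (simp add: a)
qed simp

text \<open>
  The indicator of a cycle is a colouring of the closed braid. If there are only the two constant
  colourings, the cycle contains all strands.
\<close>

lemma knot_strands_connected:
  assumes w: "braid_word n w" and two: "card {cs :: bool list. length cs = n \<and> permute w cs = cs} = 2"
  shows "1 \<le> n" "j < n \<Longrightarrow> connected_strands w n j 0"
proof -
  let ?Fix = "{cs :: bool list. length cs = n \<and> permute w cs = cs}"
  show n: "1 \<le> n"
  proof (rule ccontr)
    assume "\<not> 1 \<le> n"
    then have "n = 0" by simp
    then have "?Fix \<subseteq> {[]}" by auto
    then have "card ?Fix \<le> 1" using card_mono[of "{[]}" ?Fix] by simp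
    then show False using two by simp
  qed
  \<comment> \<open>the cycle of strand \<open>0\<close>, as a colouring\<close>
  define h where "h = map (connected_strands w n 0) [0..<n]"
  have hn: "length h = n" by (simp add: h_def)
  have "permute w h = h"
  proof (rule nth_equalityI)
    fix k assume "k < length (permute w h)"
    then have "k < n" by (simp add: hn)
    then obtain j where j: "j < n" "strand_end w j = k" using strand_end_surj[OF w] by blast
    have "permute w h ! k = h ! j" using permute_strand_end[of h w j] w j by (simp add: hn)
    then show "permute w h ! k = h ! k"
      using j \<open>k < n\<close> connected_strands_end[of j n w 0] by (simp add: h_def)
  qed simp
  then have "h \<in> ?Fix" by (simp add: hn)
  moreover have "replicate n True \<in> ?Fix" "replicate n False \<in> ?Fix"
    using permute_replicate[OF w] by auto
  moreover have "replicate n True \<noteq> replicate n False" using n by (cases n) auto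
  moreover have "finite ?Fix" by (rule ccontr) (use two in simp)
  ultimately have "?Fix = {replicate n True, replicate n False}"
    using two card_subset_eq[of ?Fix "{replicate n True, replicate n False}"] by simp
  then have "h = replicate n True \<or> h = replicate n False" using \<open>h \<in> ?Fix\<close> by blast
  moreover have "h ! 0" using n by (simp add: h_def connected_strands_def)
  ultimately have "h = replicate n True" using n by auto
  then show "connected_strands w n j 0" if "j < n"
  proof -
    have "h ! j" using \<open>h = replicate n True\<close> that by simp
    then have "connected_strands w n 0 j" using that by (simp add: h_def)
    then show ?thesis by (rule connected_strands_sym)
  qed
qed

text \<open>
  Some colouring of the closure gives different colours to the two strands at the crossing. If
  \<open>i\<close> and \<open>i + 1\<close> were on different cycles of the smoothed braid, then
  its permutation would be a bijection from the \<open>True\<close> strands above the crossing to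
  those below it within the cycle of \<open>i\<close>. But these numbers differ by one, as the
  crossing changes the colour at \<open>i\<close> only.
\<close>

lemma mixed_strands_connected:
  assumes i: "Suc i < n" and \<alpha>: "braid_word n \<alpha>" and \<beta>: "braid_word n \<beta>"
    and less: "card {cs :: bool list. length cs = n \<and> permute (\<alpha> @ \<beta>) cs = cs} <
      card {cs :: bool list. length cs = n \<and> permute (\<alpha> @ [(i, True)] @ \<beta>) cs = cs}"
  shows "connected_strands (\<beta> @ \<alpha>) n (Suc i) i"
proof (rule ccontr)
  assume nc: "\<not> connected_strands (\<beta> @ \<alpha>) n (Suc i) i"
  have fin: "finite {cs :: bool list. length cs = n \<and> permute (\<alpha> @ \<beta>) cs = cs}"
    by (rule finite_subset[OF _ finite_lists_length[of n]]) auto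
  have "\<not> {cs :: bool list. length cs = n \<and> permute (\<alpha> @ [(i, True)] @ \<beta>) cs = cs} \<subseteq> {cs. length cs = n \<and> permute (\<alpha> @ \<beta>) cs = cs}"
    using card_mono[OF fin] less by (meson not_less)
  then obtain cs :: "bool list" where cs: "length cs = n" "permute (\<alpha> @ [(i, True)] @ \<beta>) cs = cs" "permute (\<alpha> @ \<beta>) cs \<noteq> cs"
    by blast
  define u where "u = permute \<alpha> cs"
  define v where "v = swap_at i u"
  have len: "length u = n" "length v = n" by (simp_all add: u_def v_def cs)
  have "permute \<beta> v = cs" using cs(2) by (simp add: permute_append u_def v_def)
  then have vu: "permute (\<beta> @ \<alpha>) v = u" by (simp add: permute_append u_def)
  have "u ! i \<noteq> u ! Suc i"
  proof
    assume "u ! i = u ! Suc i"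
    then have "v = u" unfolding v_def swap_at_def
      by (intro nth_equalityI) (use i len(1) in \<open>auto simp: nth_list_update\<close>)
    then show False using cs(3) \<open>permute \<beta> v = cs\<close> by (simp add: permute_append u_def)
  qed
  \<comment> \<open>the cycle of strand \<open>i\<close> in the smoothed braid, read from just above the crossing\<close>
  define A where "A = {j. j < n \<and> connected_strands (\<beta> @ \<alpha>) n i j}"
  have iA: "i \<in> A" using i by (simp add: A_def connected_strands_def)
  have siA: "Suc i \<notin> A" using nc by (auto simp: A_def dest: connected_strands_sym)
  let ?\<pi> = "strand_end (\<beta> @ \<alpha>)"
  have w: "braid_word n (\<beta> @ \<alpha>)" using \<alpha> \<beta> by simp
  have u\<pi>: "u ! ?\<pi> j = v ! j" if "j < n" for j
    using permute_strand_end[of v "\<beta> @ \<alpha>" j] w that len vu by simp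
  have "?\<pi> ` {j \<in> A. v ! j} = {j \<in> A. u ! j}"
  proof (intro equalityI subsetI)
    fix k assume "k \<in> ?\<pi> ` {j \<in> A. v ! j}"
    then show "k \<in> {j \<in> A. u ! j}" using u\<pi> connected_strands_end strand_end_less[OF w] by (auto simp: A_def)
  next
    fix k assume k: "k \<in> {j \<in> A. u ! j}"
    then obtain j where "j < n" "?\<pi> j = k" using strand_end_surj[OF w] by (auto simp: A_def)
    then show "k \<in> ?\<pi> ` {j \<in> A. v ! j}" using k u\<pi>[of j] connected_strands_end[of j n "\<beta> @ \<alpha>" i] by (auto simp: A_def)
  qed
  then have "card {j \<in> A. v ! j} = card {j \<in> A. u ! j}"
    using card_image[OF inj_on_subset[OF strand_end_inj subset_UNIV], of "\<beta> @ \<alpha>" "{j \<in> A. v ! j}"] by simp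
  moreover have other: "v ! j = u ! j" if "j \<in> A" "j \<noteq> i" for j
    using that siA len i by (auto simp: v_def swap_at_def nth_list_update A_def)
  moreover have "v ! i = u ! Suc i" using len i by (simp add: v_def swap_at_def)
  ultimately have "card {j \<in> A - {i}. u ! j} + (if u ! Suc i then 1 else 0) = card {j \<in> A - {i}. u ! j} + (if u ! i then 1 else 0 :: nat)"
  proof -
    have finA: "finite A" by (simp add: A_def)
    have "{j \<in> A. x ! j} = {j \<in> A - {i}. x ! j} \<union> (if x ! i then {i} else {})" for x :: "bool list"
      using iA by auto
    then have c: "card {j \<in> A. x ! j} = card {j \<in> A - {i}. x ! j} + (if x ! i then 1 else 0)" for x :: "bool list"
      using finA by (simp add: card_Un_disjoint)
    have "{j \<in> A - {i}. v ! j} = {j \<in> A - {i}. u ! j}" using other by auto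
    then show ?thesis using c[of u] c[of v] \<open>card {j \<in> A. v ! j} = card {j \<in> A. u ! j}\<close> \<open>v ! i = u ! Suc i\<close> by simp
  qed
  then show False using \<open>u ! i \<noteq> u ! Suc i\<close> by (simp split: if_splits)
qed

section \<open>Disjoint unions of knots\<close>

lemma colourings_knot_union:
  "(\<And>D. D \<in> set Ds \<Longrightarrow> knot_diagram D) \<Longrightarrow> link_diagram (concat Ds) \<and> colourings (concat Ds) [] = 2 ^ length Ds"
proof (induction Ds)
  case (Cons D Ds)
  then have D: "link_diagram D" "colourings D [] = 2" using colourings_knot by (auto simp: knot_diagram_def)
  have "fit D (length ([] :: bool list)) = Some 0" using run_fit[of D "[]" "[]"] D(1) by (simp add: link_diagram_def)
  from colourings_append_closed[OF this] D Cons show ?case by (simp add: link_diagram_append)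
qed (simp add: link_diagram_def)

lemma disjoint_union_of_knots_unique:
  assumes "disjoint_union_of_knots k K" "disjoint_union_of_knots k' K" shows "k = k'"
proof -
  obtain Ds Ds' where D: "length Ds = k" "\<forall>D\<in>set Ds. knot_diagram D" "K = link_of (concat Ds)"
    "length Ds' = k'" "\<forall>D\<in>set Ds'. knot_diagram D" "K = link_of (concat Ds')"
    using assms unfolding disjoint_union_of_knots_def by blast
  then have "colourings (concat Ds) [] = colourings (concat Ds') []"
    using colourings_knot_union colourings_link_of by metis
  then have "(2 :: nat) ^ k = 2 ^ k'" using D colourings_knot_union by metis
  then show ?thesis by simp
qed

text \<open>
  The average over \<open>n + m\<close> strands is the product of those over the first
  \<open>n\<close> and the last \<open>m\<close> strands, so by multiplicativity of the trace
  every knot contributes one factor \<open>1 / d\<close>.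
\<close>

lemma knot_union_braid:
  assumes M: "markov_family d q z (\<lambda>_. \<phi>)" and d: "1 \<le> d" and "\<phi> 1 = 1"
    and "\<And>D. D \<in> set Ds \<Longrightarrow> knot_diagram D" "Ds \<noteq> []"
  shows "\<exists>n w. 1 \<le> n \<and> braid_word n w \<and> link_of (concat Ds) = braid_closure n w \<and>
    of_nat d ^ length Ds * \<phi> (braid_image d q w * mean_idempotent d n) = \<phi> (braid_image d q w)"
  using assms(4,5)
proof (induction Ds)
  case (Cons D Ds)
  have D: "knot_diagram D" "link_diagram D" using Cons.prems by (auto simp: knot_diagram_def)
  obtain n w where w: "braid_word n w" "link_of D = braid_closure n w" using Alexander[OF D(2)] by blast
  have "colourings (closure_diagram n w) [] = 2"
    using colourings_link_of[of D "closure_diagram n w"] w D link_diagram_closure colourings_knot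
    by (simp add: braid_closure_def)
  then have "card {cs :: bool list. length cs = n \<and> permute w cs = cs} = 2"
    using colourings_closure[OF w(1)] by simp
  from knot_strands_connected[OF w(1) this] have n: "1 \<le> n" "\<And>j. j < n \<Longrightarrow> connected_strands w n j 0" by auto
  have knot: "of_nat d * \<phi> (braid_image d q w * mean_idempotent d n) = \<phi> (braid_image d q w)"
    by (rule trace_mean_idempotent[OF M d w(1) assms(3) n])
  show ?case
  proof (cases "Ds = []")
    case True
    then show ?thesis using w n knot by auto
  next
    case False
    then obtain m v where v: "1 \<le> m" "braid_word m v" "link_of (concat Ds) = braid_closure m v"
      "of_nat d ^ length Ds * \<phi> (braid_image d q v * mean_idempotent d m) = \<phi> (braid_image d q v)"
      using Cons by auto
    have "link_diagram (concat Ds)" using colourings_knot_union Cons.prems by simp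
    then have "link_of (concat (D # Ds)) = braid_closure (n + m) (w @ shift_word n v)"
      using link_of_append_closures[OF w(1) v(2) D(2) _ w(2) v(3)] by simp
    moreover have "braid_word (n + m) (w @ shift_word n v)"
      using w v braid_word_shift braid_word_mono by simp
    moreover have "\<phi> (braid_image d q (w @ shift_word n v)) = \<phi> (braid_image d q w) * \<phi> (braid_image d q v)"
      using trace_multiplicative[OF M assms(3) d free_on_braid_image[OF w(1)] free_on_braid_image[OF v(2)]]
      by (simp add: subst_shift_braid_image)
    moreover have "\<phi> (braid_image d q (w @ shift_word n v) * mean_idempotent d (n + m)) =
       \<phi> (braid_image d q w * mean_idempotent d n) * \<phi> (braid_image d q v * mean_idempotent d m)"
    proof -
      let ?B = "braid_image d q w" and ?C = "braid_image d q v" and ?E = "mean_idempotent d n" and ?F = "mean_idempotent d m"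
      let ?S = "subst (shift_gen n)"
      have in_n: "?B \<in> yh_free_on n" "?E \<in> yh_free_on n" using w free_on_braid_image free_on_mean_idempotent by auto
      have in_m: "?C \<in> yh_free_on m" "?F \<in> yh_free_on m" using v free_on_braid_image free_on_mean_idempotent by auto
      have S: "?S x \<in> yh_free_on (n + m)" if "x \<in> yh_free_on m" for x
        by (rule subst_free_on[OF shift_gen_free_on that])
      have "\<phi> (braid_image d q (w @ shift_word n v) * mean_idempotent d (n + m)) = \<phi> (?B * (?S ?C * ?E) * ?S ?F)"
        by (simp add: mean_idempotent_add subst_shift_braid_image mult.assoc)
      also have "\<dots> = \<phi> (?B * (?E * ?S ?C) * ?S ?F)"
        by (rule markov_family_cong[OF M, where n = "n + m"], rule cong_context[OF cong_sym])
           (use in_n in_m S free_on_mono intertwinesD[OF intertwines_shift[OF in_n(2) in_m(1)]] in auto)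
      also have "\<dots> = \<phi> ((?B * ?E) * ?S (?C * ?F))" by (simp add: subst_mult mult.assoc)
      also have "\<dots> = \<phi> (?B * ?E) * \<phi> (?C * ?F)"
        by (rule trace_multiplicative[OF M assms(3) d, where n = m]) (intro free_on_mult in_n in_m)+
      finally show ?thesis .
    qed
    moreover have "of_nat d ^ length (D # Ds) * (\<phi> (braid_image d q w * mean_idempotent d n) * \<phi> (braid_image d q v * mean_idempotent d m)) =
       \<phi> (braid_image d q w) * \<phi> (braid_image d q v)"
      unfolding knot[symmetric] v(4)[symmetric] by (simp add: mult_ac)
    ultimately have "1 \<le> n + m \<and> braid_word (n + m) (w @ shift_word n v) \<and>
       link_of (concat (D # Ds)) = braid_closure (n + m) (w @ shift_word n v) \<and>
       of_nat d ^ length (D # Ds) * \<phi> (braid_image d q (w @ shift_word n v) * mean_idempotent d (n + m)) =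
       \<phi> (braid_image d q (w @ shift_word n v))"
      using n(1) by (simp only:) simp
    then show ?thesis by blast
  qed
qed simp

section \<open>Comparison of the two invariants\<close>

locale theta_setting = homflypt +
  fixes d :: nat and tr :: "yh_free \<Rightarrow> complex poly" and \<Theta> :: "link \<Rightarrow> complex"
  assumes d: "1 \<le> d" and tr: "yh_trace d q tr" and Theta: "is_Theta d q s tr \<Theta>"
begin

definition "\<phi> x = poly (tr x) (z_of d q s)"

lemma z_of_eq: "z_of d q s = z / of_nat d"
  by (simp add: z_of_def z_def E_D_def c_def)

lemma Lambda_D_eq: "Lambda_D d q s = of_nat d * (1 / (z * s))"
  using d by (simp add: Lambda_D_def z_of_eq)

lemma trace_markov: "markov_family d q (z / of_nat d) (\<lambda>_. \<phi>)"
  unfolding \<phi>_def z_of_eq by (rule trace_markov_family[OF tr])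

lemma trace_1: "\<phi> 1 = 1"
  using tr by (simp add: \<phi>_def yh_trace_def)

lemma Theta_braid_closure:
  "1 \<le> n \<Longrightarrow> braid_word n w \<Longrightarrow> \<Theta> (braid_closure n w) =
     (of_nat d * (1 / (z * s))) ^ (n - 1) * s powi exponent_sum w * \<phi> (braid_image d q w)"
  using Theta by (simp add: is_Theta_def theta_braid_def Lambda_D_eq \<phi>_def)

text \<open>
  Resolving \<open>g\<^sub>i - g\<^sub>i\<^sup>-\<^sup>1\<close> gives a multiple of
  \<open>e\<^sub>i\<close> and not of \<open>1\<close>, but at a mixed crossing
  \<open>e\<^sub>i\<close> has no effect inside the trace.
\<close>

lemma Theta_mixed_skein:
  assumes "mixed_conway_triple Lp Lm L0"
  shows "\<Theta> Lp = s\<^sup>2 * \<Theta> Lm + (q - inverse q) * s * \<Theta> L0"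
proof -
  obtain X k Y where XY: "link_diagram (pos_diagram X k Y)"
    "\<not> same_component (pos_diagram X k Y) (length X, k) (length X, Suc k)"
    "Lp = link_of (pos_diagram X k Y)" "Lm = link_of (neg_diagram X k Y)" "L0 = link_of (smooth_diagram X k Y)"
    using assms unfolding mixed_conway_triple_def by blast
  obtain n i \<alpha> \<beta> where b: "Suc i < n" "braid_word n \<alpha>" "braid_word n \<beta>" "link_diagram (smooth_diagram X k Y)"
    "link_of (pos_diagram X k Y) = braid_closure n (\<alpha> @ [(i, True)] @ \<beta>)"
    "link_of (neg_diagram X k Y) = braid_closure n (\<alpha> @ [(i, False)] @ \<beta>)"
    "link_of (smooth_diagram X k Y) = braid_closure n (\<alpha> @ \<beta>)"
    using Alexander_Conway_triple[OF XY(1)] by blast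
  have bw: "braid_word n (\<alpha> @ [(i, True)] @ \<beta>)" "braid_word n (\<alpha> @ [(i, False)] @ \<beta>)" "braid_word n (\<alpha> @ \<beta>)"
    using b by simp_all
  have "colourings (closure_diagram n (\<alpha> @ \<beta>)) [] < colourings (closure_diagram n (\<alpha> @ [(i, True)] @ \<beta>)) []"
    using colourings_mixed[OF XY(1,2)] colourings_link_of[of "smooth_diagram X k Y" "closure_diagram n (\<alpha> @ \<beta>)"]
      colourings_link_of[of "pos_diagram X k Y" "closure_diagram n (\<alpha> @ [(i, True)] @ \<beta>)"]
      b XY(1) link_diagram_closure[OF bw(1)] link_diagram_closure[OF bw(3)]
    by (simp add: braid_closure_def)
  then have con: "connected_strands (\<beta> @ \<alpha>) n (Suc i) i"
    by (intro mixed_strands_connected b) (simp only: colourings_closure[OF bw(1)] colourings_closure[OF bw(3)])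
  let ?A = "braid_image d q \<alpha>" and ?B = "braid_image d q \<beta>"
  note M = markov_familyD[OF trace_markov]
  have in_n: "?A \<in> yh_free_on n" "?B \<in> yh_free_on n" "yh_e d i \<in> yh_free_on n"
    using b free_on_braid_image free_on_e by auto
  have "\<phi> (?A * (yh_e d i * ?B)) = \<phi> ((yh_e d i * ?B) * ?A)"
    by (rule M(4)[where n = n]) (intro in_n free_on_mult)+
  also have "\<dots> = \<phi> (yh_e d i * (?B * ?A))" by (simp only: mult.assoc)
  also have "\<dots> = \<phi> ((?B * ?A) * yh_e d i)"
    by (rule M(4)[where n = n]) (intro in_n free_on_mult)+
  also have "\<dots> = \<phi> (?B * ?A)"
    using trace_e[OF trace_markov d _ b(1) con] b by simp
  also have "\<dots> = \<phi> (?A * ?B)"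
    by (rule M(4)[where n = n]) (intro in_n)+
  finally have e: "\<phi> (?A * (yh_e d i * ?B)) = \<phi> (?A * ?B)" .
  have "?A * (yh_g i * ?B) = ?A * (yh_ginv d q i * ?B) + scal (q - inverse q) * (?A * (yh_e d i * ?B))"
    by (simp add: yh_ginv_def left_diff_distrib right_diff_distrib scal_left_commute mult.assoc)
  then have g: "\<phi> (?A * (yh_g i * ?B)) = \<phi> (?A * (yh_ginv d q i * ?B)) + (q - inverse q) * \<phi> (?A * ?B)"
    by (simp add: M e)
  have ex: "exponent_sum (\<alpha> @ [(i, True)] @ \<beta>) = exponent_sum (\<alpha> @ \<beta>) + 1"
    "exponent_sum (\<alpha> @ [(i, False)] @ \<beta>) = exponent_sum (\<alpha> @ \<beta>) - 1"
    by (simp_all add: exponent_sum_def)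
  have "s powi (exponent_sum (\<alpha> @ \<beta>) + 1) = s powi exponent_sum (\<alpha> @ \<beta>) * s"
    "s\<^sup>2 * s powi (exponent_sum (\<alpha> @ \<beta>) - 1) = s powi exponent_sum (\<alpha> @ \<beta>) * s"
    using nonzero by (simp_all add: power_int_add power_int_diff power2_eq_square)
  then show ?thesis
    unfolding XY b(5-7) using Theta_braid_closure[OF _ bw(1)] Theta_braid_closure[OF _ bw(2)] Theta_braid_closure[OF _ bw(3)] b(1)
    unfolding ex by (simp add: g algebra_simps)
qed

lemma P_mixed_skein:
  assumes "mixed_conway_triple Lp Lm L0"
  shows "P Lp = s\<^sup>2 * P Lm + (q - inverse q) * s * P L0"
proof -
  have "conway_triple Lp Lm L0" using assms unfolding mixed_conway_triple_def conway_triple_def by blast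
  from skein[OF this] show ?thesis using nonzero(2) by (simp add: c_def field_simps power2_eq_square)
qed

lemma Theta_knot_union:
  assumes "disjoint_union_of_knots k K" "1 \<le> k"
  shows "\<Theta> K = of_nat d ^ (k - 1) * P K"
proof -
  obtain Ds where Ds: "length Ds = k" "\<forall>D\<in>set Ds. knot_diagram D" "K = link_of (concat Ds)"
    using assms unfolding disjoint_union_of_knots_def by blast
  then obtain n w where nw: "1 \<le> n" "braid_word n w" "K = braid_closure n w"
    "of_nat d ^ k * \<phi> (braid_image d q w * mean_idempotent d n) = \<phi> (braid_image d q w)"
    using knot_union_braid[OF trace_markov d trace_1, of Ds] assms(2) by fastforce
  from nw(1) obtain m where m: "n = Suc m" by (cases n) auto
  have "P K = (1 / (z * s)) ^ m * s powi exponent_sum w * (of_nat d ^ Suc m * \<phi> (braid_image d q w * mean_idempotent d (Suc m)))"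
    using P_braid_closure[OF trace_markov d trace_1] nw m by simp
  moreover have "\<Theta> K = (of_nat d * (1 / (z * s))) ^ m * s powi exponent_sum w * \<phi> (braid_image d q w)"
    using Theta_braid_closure[OF nw(1,2)] nw m by simp
  moreover have "of_nat d ^ k = of_nat d ^ (k - 1) * (of_nat d :: complex)"
    using assms(2) by (cases k) auto
  ultimately show ?thesis
    using nw(4)[symmetric] unfolding m by (simp only: power_mult_distrib) (simp add: algebra_simps)
qed

end

text \<open>
  The links that occur in the resolution are grouped by their numbers of components. The terms
  with \<open>k = 1\<close> agree for both invariants, which gives the second form of each
  formula.
\<close>

theorem theorem5:
  fixes d l :: nat and q s :: complex
    and tr :: "yh_free \<Rightarrow> complex poly"
    and \<Theta> P :: "link \<Rightarrow> complex"
    and D :: diagram and L :: link and C :: link_comb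
  assumes d: "1 \<le> d"
    and params: "admissible q s"
    and tr: "yh_trace d q tr"
    and Theta: "is_Theta d q s tr \<Theta>"
    and P: "is_Homflypt q s P"
    and D: "link_diagram D" "L = link_of D"
    and l: "card (components D) = l" "1 \<le> l"
    and C: "resolution L l C"
  shows "\<Theta> L = (\<Sum>k=1..l. E_D d powi (1 - int k) * knot_unions_sum q s C k P)
    \<and> \<Theta> L = P L + (\<Sum>k=2..l. (E_D d powi (1 - int k) - 1) * knot_unions_sum q s C k P)
    \<and> P L = (\<Sum>k=1..l. E_D d powi (int k - 1) * knot_unions_sum q s C k \<Theta>)
    \<and> P L = \<Theta> L + (\<Sum>k=2..l. (E_D d powi (int k - 1) - 1) * knot_unions_sum q s C k \<Theta>)"
proof -
  interpret theta_setting q s P d tr \<Theta>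
    by unfold_locales (fact params P d tr Theta)+
  have E: "E_D d \<noteq> 0" using d by (simp add: E_D_def)
  have res: "resolves_to L C"
    and keys: "\<And>K. K \<in> Poly_Mapping.keys C \<Longrightarrow> \<exists>k. 1 \<le> k \<and> k \<le> l \<and> disjoint_union_of_knots k K"
    using C by (auto simp: resolution_def)
  have decompose: "F L = (\<Sum>k=1..l. knot_unions_sum q s C k F)"
    if "\<And>Lp Lm L0. mixed_conway_triple Lp Lm L0 \<Longrightarrow> F Lp = s\<^sup>2 * F Lm + (q - inverse q) * s * F L0" for F
  proof -
    have "F L = comb_value q s F C"
      using comb_value_resolves[OF nonzero(1,2) res that] by simp
    also have "\<dots> = (\<Sum>K\<in>(\<Union>k\<in>{1..l}. knot_unions C k). eval_laurent q s (Poly_Mapping.lookup C K) * F K)"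
      unfolding comb_value_def
    proof (rule sum.cong)
      have "\<exists>k\<in>{1..l}. disjoint_union_of_knots k K" if "K \<in> Poly_Mapping.keys C" for K
        using keys[OF that] by auto
      then show "Poly_Mapping.keys C = (\<Union>k\<in>{1..l}. knot_unions C k)"
        by (fastforce simp: knot_unions_def)
    qed simp
    also have "\<dots> = (\<Sum>k=1..l. knot_unions_sum q s C k F)"
      unfolding knot_unions_sum_def
      by (rule sum.UNION_disjoint) (auto simp: knot_unions_def dest: disjoint_union_of_knots_unique)
    finally show ?thesis .
  qed
  have PL: "P L = (\<Sum>k=1..l. knot_unions_sum q s C k P)"
    by (rule decompose[OF P_mixed_skein])
  have ThetaL: "\<Theta> L = (\<Sum>k=1..l. knot_unions_sum q s C k \<Theta>)"
    by (rule decompose[OF Theta_mixed_skein])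
  have Theta_sum: "knot_unions_sum q s C k \<Theta> = E_D d powi (1 - int k) * knot_unions_sum q s C k P" if "1 \<le> k" for k
  proof -
    have "E_D d powi (1 - int k) = of_nat d ^ (k - 1)"
    proof -
      have "1 - int k = - int (k - 1)" using that by simp
      then show ?thesis using d by (simp only: power_int_minus power_int_of_nat E_D_def) (simp add: power_one_over)
    qed
    then show ?thesis using Theta_knot_union[OF _ that]
      by (simp add: knot_unions_sum_def knot_unions_def sum_distrib_left mult_ac)
  qed
  have P_sum: "knot_unions_sum q s C k P = E_D d powi (int k - 1) * knot_unions_sum q s C k \<Theta>" if "1 \<le> k" for k
  proof -
    have "E_D d powi (int k - 1) * E_D d powi (1 - int k) = 1"
      using E by (simp flip: power_int_add)
    then show ?thesis unfolding Theta_sum[OF that] by (simp flip: mult.assoc)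
  qed
  have split: "(\<Sum>k=1..l. a k * f k) = (\<Sum>k=1..l. f k) + (\<Sum>k=2..l. (a k - 1) * f k)" if "a 1 = 1" for a f :: "nat \<Rightarrow> complex"
    using l(2) that by (simp add: sum.atLeast_Suc_atMost left_diff_distrib sum_subtractf numeral_2_eq_2)
  have 1: "\<Theta> L = (\<Sum>k=1..l. E_D d powi (1 - int k) * knot_unions_sum q s C k P)"
    unfolding ThetaL by (intro sum.cong refl Theta_sum) simp
  have 2: "P L = (\<Sum>k=1..l. E_D d powi (int k - 1) * knot_unions_sum q s C k \<Theta>)"
    unfolding PL by (intro sum.cong refl P_sum) simp
  show ?thesis
    using 1 2 PL ThetaL split[of "\<lambda>k. E_D d powi (1 - int k)" "\<lambda>k. knot_unions_sum q s C k P"]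
      split[of "\<lambda>k. E_D d powi (int k - 1)" "\<lambda>k. knot_unions_sum q s C k \<Theta>"]
    by simp
qed

end
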